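(* Assume $\mathcal{T}^\star$-Bellman completeness: $\mathcal{T}^\star_h f_{h+1}\in\mathcal{F}_h$ for all $h\in[H]$ and all $f_{h+1}\in\mathcal{F}_{h+1}$. Then for any $\delta\in(0,1)$, with probability at least $1-\delta$, the optimistic online RL algorithm (defined in the context) run with the loss $\ell=\ell_{\mathrm{bce}}$ and threshold $\beta=2\ln(H|\mathcal{F}|/\delta)$ produces policies $\pi^1,\dots,\pi^K$ with $$\sum_{k=1}^K\big(V^{\pi^k}-V^\star\big)\ \le\ \widetilde{\mathcal{O}}\Big(H\sqrt{V^\star K\cdot d\,\beta}+H^2 d\,\beta\Big),$$ where $d=d_{\mathrm{bce}}$ if the uniform-action (UA) flag is false, and $d=A\,d_{\mathrm{bce}}^{\mathrm{V}}$ if the UA flag is true, with $A=|\mathcal{A}|$ the number of actions.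
   Context: **MDP.** An MDP has observation space $\mathcal{X}$, action space $\mathcal{A}$, horizon $H$, transition kernels $P_h:\mathcal{X}\times\mathcal{A}\to\Delta(\mathcal{X})$ and conditional cost distributions $C_h:\mathcal{X}\times\mathcal{A}\to\Delta([0,1])$, $h\in[H]$. A policy is $\pi=\{\pi_h:\mathcal{X}\to\Delta(\mathcal{A})\}_{h\in[H]}$. Rolling in $\pi$: start at a fixed known initial state $x_1$; for $h=1,\dots,H$ draw $a_h\sim\pi_h(x_h)$, $c_h\sim C_h(x_h,a_h)$, $x_{h+1}\sim P_h(x_h,a_h)$. The cumulative cost $\sum_{h=1}^Hc_h$ is assumed to lie in $[0,1]$ almost surely. $V^\pi=\mathbb{E}_\pi[\sum_{h=1}^H c_h]$ and $V^\star=\min_\pi V^\pi$. The Bellman optimality operator is $\mathcal{T}^\star_h f(x,a)=\mathbb{E}_{c\sim C_h(x,a),\,x'\sim P_h(x,a)}[c+\min_{a'}f(x',a')]$. **Function class.** $\mathcal{F}$ is a (finite) set of tuples $f=(f_1,\dots,f_H)$ with $f_h:\mathcal{X}\times\mathcal{A}\to[0,1]$, with the convention $f_{H+1}=0$; $\mathcal{F}_h$ is the set of step-$h$ components. **Loss.** $\ell_{\mathrm{bce}}(\hat y,y)=-y\ln\hat y-(1-y)\ln(1-\hat y)$, with $0\ln0=0$. **Algorithm (optimistic online RL)** with inputs $K$, $\mathcal{F}$, $\ell$, $\beta$, UA flag. For $k=1,\dots,K$, let $\mathcal{D}_{<k}$ be the data collected before round $k$, with step-$h$ part $\mathcal{D}_h=\{(x_{h,i},a_{h,i},c_{h,i},x'_{h,i})\}_i$.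 For such a dataset $\mathcal{D}=(\mathcal{D}_1,\dots,\mathcal{D}_H)$ set $L_h^\ell(f_h,g,\mathcal{D}_h)=\sum_i\ell\big(f_h(x_{h,i},a_{h,i}),\,c_{h,i}+\min_{a'}g(x'_{h,i},a')\big)$ and $$\mathcal{C}^\ell_\beta(\mathcal{D})=\Big\{f\in\mathcal{F}:\ \forall h\in[H],\ L^\ell_h(f_h,f_{h+1},\mathcal{D}_h)-\min_{g_h\in\mathcal{F}_h}L_h^\ell(g_h,f_{h+1},\mathcal{D}_h)\le\beta\Big\}.$$ Choose $f^k\in\operatorname{argmin}_{f\in\mathcal{C}^\ell_\beta(\mathcal{D}_{<k})}\min_af_1(x_1,a)$, let $\pi^k_h(x)\in\operatorname{argmin}_af^k_h(x,a)$ for all $h$, and collect one new tuple $(x_h,a_h,c_h,x_h')$ for each $h\in[H]$ as follows. If the UA flag is false: roll in $\pi^k$ once to obtain $x_1,a_1,c_1,\dots,x_H,a_H,c_H$ and set $x'_h=x_{h+1}$. If the UA flag is true: separately for each $h\in[H]$, roll in $\pi^k$ to reach $x_h$, draw $a_h\sim\mathrm{Unif}(\mathcal{A})$, and observe $c_h\sim C_h(x_h,a_h)$ and $x'_h\sim P_h(x_h,a_h)$. **Eluder dimension.** For a set $\mathcal{S}$, a class $\Psi$ of functions $\mathcal{S}\to\mathbb{R}$, a class $\mathcal{M}$ of distributions on $\mathcal{S}$, $\varepsilon_0>0$ and $q\in\mathbb{N}$, $\mathrm{EluDim}_q(\Psi,\mathcal{M},\varepsilon_0)$ is the length $L$ of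 the longest sequence $\mu^{(1)},\dots,\mu^{(L)}\in\mathcal{M}$ such that there is $\varepsilon\ge\varepsilon_0$ such that for every $t\in[L]$ there is $\psi\in\Psi$ with $|\mathbb{E}_{\mu^{(t)}}[\psi]|>\varepsilon$ but $\sum_{i<t}|\mathbb{E}_{\mu^{(i)}}[\psi]|^q\le\varepsilon^q$. Let $h^2_{\mathrm{Ber}}(u,v)=\frac12(\sqrt u-\sqrt v)^2+\frac12(\sqrt{1-u}-\sqrt{1-v})^2$ (squared Hellinger distance between Bernoulli distributions with means $u,v$), and $\Psi^{\mathrm{bce}}_h=\{(x,a)\mapsto h^2_{\mathrm{Ber}}(f_h(x,a),\mathcal{T}^\star_hf_{h+1}(x,a)):f\in\mathcal{F}\}$, $\Psi_h^{\mathrm{bce},\mathrm{V}}=\{x\mapsto\mathbb{E}_{a\sim\mathrm{Unif}(\mathcal{A})}[\psi(x,a)]:\psi\in\Psi_h^{\mathrm{bce}}\}$. Let $\mathcal{M}_h$ (resp. $\mathcal{M}_h^{\mathrm{V}}$) be the set of all distributions of $(x_h,a_h)$ (resp. of $x_h$) induced by rolling in any policy. Define $d_{\mathrm{bce}}=\max_{h\in[H]}\mathrm{EluDim}_1(\Psi_h^{\mathrm{bce}},\mathcal{M}_h,1/K)$ and $d_{\mathrm{bce}}^{\mathrm{V}}=\max_{h\in[H]}\mathrm{EluDim}_1(\Psi_h^{\mathrm{bce},\mathrm{V}},\mathcal{M}^{\mathrm{V}}_h,1/K)$. $\widetilde{\mathcal{O}}$ hides universal constants and logarithmic factors.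
   Formalization: Adds that the targets c_h + min f_{h+1}(x_{h+1},·) lie in [0,1] almost surely under every policy and that the tuple Q* belongs to F (automatic for nonempty product classes); d_bce and d_bce^V are replaced by their maximum with 1. *)

theory Defs
  imports "HOL-Probability.Probability"
begin

section \<open>Episodic MDPs\<close>

text \<open>
  The observation space is the whole type \<open>'x\<close> with a sigma-algebra (see \<open>is_mdp\<close>); the action space
  is the finite type \<open>'a\<close> with its discrete sigma-algebra. Steps are numbered \<open>1, ..., H\<close>.
\<close>

record ('x, 'a) mdp =
  obs_space :: "'x measure"
  horizon :: nat
  init_obs :: 'x
  trans_kernel :: "nat \<Rightarrow> 'x \<times> 'a \<Rightarrow> 'x measure"
  cost_kernel :: "nat \<Rightarrow> 'x \<times> 'a \<Rightarrow> real measure"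

text \<open>A transition is \<open>(x, a, c, x')\<close>; a round assigns one transition to every step.\<close>

type_synonym ('x, 'a) transition = "'x \<times> 'a \<times> real \<times> 'x"
type_synonym ('x, 'a) round = "nat \<Rightarrow> ('x, 'a) transition"
type_synonym ('x, 'a) history = "nat \<Rightarrow> ('x, 'a) round"
type_synonym ('x, 'a) policy = "nat \<Rightarrow> 'x \<Rightarrow> 'a measure"
type_synonym ('x, 'a) ftuple = "nat \<Rightarrow> 'x \<times> 'a \<Rightarrow> real"

abbreviation obs_act_space :: "('x, 'a) mdp \<Rightarrow> ('x \<times> 'a) measure" where
  "obs_act_space M \<equiv> obs_space M \<Otimes>\<^sub>M count_space UNIV"

abbreviation trans_space :: "('x, 'a) mdp \<Rightarrow> ('x, 'a) transition measure" where
  "trans_space M \<equiv> obs_space M \<Otimes>\<^sub>M count_space UNIV \<Otimes>\<^sub>M borel \<Otimes>\<^sub>M obs_space M"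

abbreviation round_space :: "('x, 'a) mdp \<Rightarrow> ('x, 'a) round measure" where
  "round_space M \<equiv> PiM {1..horizon M} (\<lambda>_. trans_space M)"

definition is_mdp :: "('x, 'a::finite) mdp \<Rightarrow> bool" where
  "is_mdp M \<longleftrightarrow>
     space (obs_space M) = UNIV \<and> 1 \<le> horizon M \<and>
     (\<forall>h\<in>{1..horizon M}.
        trans_kernel M h \<in> obs_act_space M \<rightarrow>\<^sub>M prob_algebra (obs_space M) \<and>
        cost_kernel M h \<in> obs_act_space M \<rightarrow>\<^sub>M prob_algebra borel \<and>
        (\<forall>z. AE c in cost_kernel M h z. c \<in> {0..1}))"

definition policies :: "('x, 'a::finite) mdp \<Rightarrow> ('x, 'a) policy set" where
  "policies M = {\<pi>. \<forall>h\<in>{1..horizon M}. \<pi> h \<in> obs_space M \<rightarrow>\<^sub>M prob_algebra (count_space UNIV)}"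

definition obs_of :: "('x, 'a) transition \<Rightarrow> 'x" where
  "obs_of = (\<lambda>(x, a, c, x'). x)"

definition act_of :: "('x, 'a) transition \<Rightarrow> 'a" where
  "act_of = (\<lambda>(x, a, c, x'). a)"

definition cost_of :: "('x, 'a) transition \<Rightarrow> real" where
  "cost_of = (\<lambda>(x, a, c, x'). c)"

definition next_of :: "('x, 'a) transition \<Rightarrow> 'x" where
  "next_of = (\<lambda>(x, a, c, x'). x')"

definition step_law ::
  "('x, 'a) mdp \<Rightarrow> nat \<Rightarrow> ('x \<Rightarrow> 'a measure) \<Rightarrow> 'x \<Rightarrow> ('x, 'a) transition measure" where
  "step_law M h p x =
     p x \<bind> (\<lambda>a. cost_kernel M h (x, a) \<bind> (\<lambda>c. trans_kernel M h (x, a) \<bind>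
       (\<lambda>x'. return (trans_space M) (x, a, c, x'))))"

primrec roll_in :: "('x, 'a) mdp \<Rightarrow> ('x, 'a) policy \<Rightarrow> nat \<Rightarrow> ('x, 'a) round measure" where
  "roll_in M \<pi> 0 = return (PiM {1..0} (\<lambda>_. trans_space M)) (\<lambda>_. undefined)"
| "roll_in M \<pi> (Suc n) = roll_in M \<pi> n \<bind> (\<lambda>\<tau>.
     distr (step_law M (Suc n) (\<pi> (Suc n)) (if n = 0 then init_obs M else next_of (\<tau> n)))
       (PiM {1..Suc n} (\<lambda>_. trans_space M)) (\<lambda>s. \<tau>(Suc n := s)))"

definition episode :: "('x, 'a) mdp \<Rightarrow> ('x, 'a) policy \<Rightarrow> ('x, 'a) round measure" where
  "episode M \<pi> = roll_in M \<pi> (horizon M)"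

definition obs_act_law :: "('x, 'a) mdp \<Rightarrow> ('x, 'a) policy \<Rightarrow> nat \<Rightarrow> ('x \<times> 'a) measure" where
  "obs_act_law M \<pi> h = distr (episode M \<pi>) (obs_act_space M) (\<lambda>\<tau>. (obs_of (\<tau> h), act_of (\<tau> h)))"

definition obs_law :: "('x, 'a) mdp \<Rightarrow> ('x, 'a) policy \<Rightarrow> nat \<Rightarrow> 'x measure" where
  "obs_law M \<pi> h = distr (episode M \<pi>) (obs_space M) (\<lambda>\<tau>. obs_of (\<tau> h))"

definition total_cost_normalized :: "('x, 'a::finite) mdp \<Rightarrow> bool" where
  "total_cost_normalized M \<longleftrightarrow>
     (\<forall>\<pi>\<in>policies M. AE \<tau> in episode M \<pi>. (\<Sum>h=1..horizon M. cost_of (\<tau> h)) \<in> {0..1})"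

definition policy_value :: "('x, 'a) mdp \<Rightarrow> ('x, 'a) policy \<Rightarrow> real" where
  "policy_value M \<pi> = (\<integral>\<tau>. (\<Sum>h=1..horizon M. cost_of (\<tau> h)) \<partial>episode M \<pi>)"

definition opt_value :: "('x, 'a::finite) mdp \<Rightarrow> real" where
  "opt_value M = (INF \<pi>\<in>policies M. policy_value M \<pi>)"

definition bellman :: "('x, 'a::finite) mdp \<Rightarrow> nat \<Rightarrow> ('x \<times> 'a \<Rightarrow> real) \<Rightarrow> 'x \<times> 'a \<Rightarrow> real" where
  "bellman M h g z =
     (\<integral>(c, x'). c + (MIN a'. g (x', a')) \<partial>(cost_kernel M h z \<Otimes>\<^sub>M trans_kernel M h z))"


section \<open>Function classes\<close>

text \<open>
  A tuple \<open>(f_1, ..., f_H)\<close> is a function of the step index that is zero outside \<open>{1..H}\<close>. This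
  includes the convention \<open>f_{H+1} = 0\<close> and makes \<open>card F\<close> the number of distinct tuples.
\<close>

definition function_class :: "('x, 'a::finite) mdp \<Rightarrow> ('x, 'a) ftuple set \<Rightarrow> bool" where
  "function_class M F \<longleftrightarrow> finite F \<and>
     (\<forall>f\<in>F. (\<forall>h\<in>{1..horizon M}. f h \<in> borel_measurable (obs_act_space M) \<and> (\<forall>z. f h z \<in> {0..1})) \<and>
            (\<forall>h. h \<notin> {1..horizon M} \<longrightarrow> f h = (\<lambda>_. 0)))"

definition component :: "('x, 'a) ftuple set \<Rightarrow> nat \<Rightarrow> ('x \<times> 'a \<Rightarrow> real) set" where
  "component F h = (\<lambda>f. f h) ` F"

definition bellman_complete :: "('x, 'a::finite) mdp \<Rightarrow> ('x, 'a) ftuple set \<Rightarrow> bool" where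
  "bellman_complete M F \<longleftrightarrow>
     (\<forall>h\<in>{1..horizon M}. \<forall>g\<in>component F (Suc h). bellman M h g \<in> component F h)"

text \<open>The optimal action-value functions, by backward recursion from step \<open>H\<close>.\<close>

function optimal_q :: "('x, 'a::finite) mdp \<Rightarrow> ('x, 'a) ftuple" where
  "optimal_q M h =
     (if h \<in> {1..horizon M} then bellman M h (optimal_q M (Suc h)) else (\<lambda>_. 0))"
  by pat_completeness auto
termination
  by (relation "Wellfounded.measure (\<lambda>(M, h). Suc (horizon M) - h)") auto

declare optimal_q.simps [simp del]

text \<open>
  Completeness is a statement about the component sets. It places each optimal action-value function
  in its component set, but the tuple of these functions belongs to \<open>F\<close> only if the components can be
  recombined. Optimism needs the tuple itself.
\<close>

definition realizable :: "('x, 'a::finite) mdp \<Rightarrow> ('x, 'a) ftuple set \<Rightarrow> bool" where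
  "realizable M F \<longleftrightarrow> optimal_q M \<in> F"

text \<open>For a product class \<open>F_1 \<times> ... \<times> F_H\<close>, completeness implies realizability.\<close>

lemma realizable_if_product:
  assumes fc: "function_class M F" and "F \<noteq> {}" and bc: "bellman_complete M F"
    and prod: "\<And>g. \<forall>h\<in>{1..horizon M}. g h \<in> component F h \<Longrightarrow>
                  \<forall>h. h \<notin> {1..horizon M} \<longrightarrow> g h = (\<lambda>_. 0) \<Longrightarrow> g \<in> F"
  shows "realizable M F"
proof -
  have mem: "optimal_q M h \<in> component F h" if "1 \<le> h" "h \<le> Suc (horizon M)" for h
    using that(2,1)
  proof (induction h rule: inc_induct)
    case base
    obtain f where f: "f \<in> F" using \<open>F \<noteq> {}\<close> by blast
    then have "f (Suc (horizon M)) = (\<lambda>_. 0)"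
      using fc by (simp add: function_class_def)
    then have "optimal_q M (Suc (horizon M)) = f (Suc (horizon M))"
      by (subst optimal_q.simps) simp
    then show ?case using f by (auto simp: component_def)
  next
    case (step h)
    then have h: "h \<in> {1..horizon M}" by simp
    have "optimal_q M h = bellman M h (optimal_q M (Suc h))"
      using h by (subst optimal_q.simps) simp
    then show ?case using step bc h by (simp add: bellman_complete_def)
  qed
  show ?thesis unfolding realizable_def
  proof (rule prod)
    show "\<forall>h\<in>{1..horizon M}. optimal_q M h \<in> component F h" using mem by simp
    show "\<forall>h. h \<notin> {1..horizon M} \<longrightarrow> optimal_q M h = (\<lambda>_. 0)"
      by (subst optimal_q.simps) simp
  qed
qed

text \<open>
  The regression targets \<open>c_h + min f_{h+1}(x_{h+1}, .)\<close> have to lie in \<open>[0,1]\<close>, the domain of the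
  second argument of the binary cross-entropy loss. As costs and \<open>f_{h+1}\<close> are only bounded by \<open>1\<close>
  separately, this is a condition on the class. It is required almost surely along episodes.
\<close>

definition targets_normalized :: "('x, 'a::finite) mdp \<Rightarrow> ('x, 'a) ftuple set \<Rightarrow> bool" where
  "targets_normalized M F \<longleftrightarrow>
     (\<forall>\<pi>\<in>policies M. \<forall>f\<in>F. \<forall>h\<in>{1..horizon M}.
        AE \<tau> in episode M \<pi>. cost_of (\<tau> h) + (MIN a'. f (Suc h) (next_of (\<tau> h), a')) \<in> {0..1})"


section \<open>Binary cross-entropy loss\<close>

text \<open>
  The loss takes values in the extended reals: \<open>ln 0\<close> must be \<open>-\<infinity>\<close> (the library's real \<open>ln\<close> has
  \<open>ln 0 = 0\<close>). The convention \<open>0 ln 0 = 0\<close> holds as \<open>0 * \<infinity> = 0\<close> in \<open>ereal\<close>.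
\<close>

definition ln_ext :: "real \<Rightarrow> ereal" where
  "ln_ext u = (if u = 0 then - \<infinity> else ereal (ln u))"

definition bce_loss :: "real \<Rightarrow> real \<Rightarrow> ereal" where
  "bce_loss u y = - (ereal y * ln_ext u) - ereal (1 - y) * ln_ext (1 - u)"


section \<open>Optimistic online RL\<close>

text \<open>
  A history \<open>D\<close> before round \<open>k\<close> consists of the rounds \<open>D 1, ..., D (k - 1)\<close>; \<open>D i h\<close> is the
  transition stored for step \<open>h\<close> in round \<open>i\<close>.
\<close>

abbreviation history_space :: "('x, 'a) mdp \<Rightarrow> nat \<Rightarrow> ('x, 'a) history measure" where
  "history_space M k \<equiv> PiM {1..<k} (\<lambda>_. round_space M)"

definition emp_loss ::
  "(real \<Rightarrow> real \<Rightarrow> ereal) \<Rightarrow> nat \<Rightarrow> ('x, 'a::finite) history \<Rightarrow> nat \<Rightarrow>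
   ('x \<times> 'a \<Rightarrow> real) \<Rightarrow> ('x \<times> 'a \<Rightarrow> real) \<Rightarrow> ereal" where
  "emp_loss loss k D h fh g =
     (\<Sum>i\<in>{1..<k}. case D i h of (x, a, c, x') \<Rightarrow> loss (fh (x, a)) (c + (MIN a'. g (x', a'))))"

text \<open>In \<open>ereal\<close>, \<open>\<infinity> - \<infinity> = \<infinity>\<close>: a tuple with infinite empirical loss is never in the confidence set.\<close>

definition confidence_set ::
  "('x, 'a::finite) mdp \<Rightarrow> ('x, 'a) ftuple set \<Rightarrow> (real \<Rightarrow> real \<Rightarrow> ereal) \<Rightarrow> real \<Rightarrow> nat \<Rightarrow>
   ('x, 'a) history \<Rightarrow> ('x, 'a) ftuple set" where
  "confidence_set M F loss \<beta> k D =
     {f \<in> F. \<forall>h\<in>{1..horizon M}.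
        emp_loss loss k D h (f h) (f (Suc h))
          - (MIN g\<in>component F h. emp_loss loss k D h g (f (Suc h))) \<le> ereal \<beta>}"

text \<open>
  The algorithm's choices are given by \<open>fsel k D\<close> (the tuple \<open>f^k\<close>) and \<open>act k D h x\<close> (the action
  \<open>\<pi>^k_h(x)\<close>), where \<open>D\<close> is the history before round \<open>k\<close>. Ties may be broken arbitrarily, subject to
  measurability. If the confidence set is empty, the choice of \<open>f^k\<close> in \<open>F\<close> is unconstrained.
\<close>

definition optimistic_choices ::
  "('x, 'a::finite) mdp \<Rightarrow> ('x, 'a) ftuple set \<Rightarrow> (real \<Rightarrow> real \<Rightarrow> ereal) \<Rightarrow> real \<Rightarrow> nat \<Rightarrow>
   (nat \<Rightarrow> ('x, 'a) history \<Rightarrow> ('x, 'a) ftuple) \<Rightarrow>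
   (nat \<Rightarrow> ('x, 'a) history \<Rightarrow> nat \<Rightarrow> 'x \<Rightarrow> 'a) \<Rightarrow> bool" where
  "optimistic_choices M F loss \<beta> K fsel act \<longleftrightarrow>
     (\<forall>k\<in>{1..K}.
        fsel k \<in> history_space M k \<rightarrow>\<^sub>M count_space F \<and>
        (\<forall>h\<in>{1..horizon M}.
           (\<lambda>(D, x). act k D h x) \<in> history_space M k \<Otimes>\<^sub>M obs_space M \<rightarrow>\<^sub>M count_space UNIV) \<and>
        (\<forall>D\<in>space (history_space M k).
           (confidence_set M F loss \<beta> k D \<noteq> {} \<longrightarrow>
              is_arg_min (\<lambda>f. MIN a. f 1 (init_obs M, a))
                (\<lambda>f. f \<in> confidence_set M F loss \<beta> k D) (fsel k D)) \<and>
           (\<forall>h\<in>{1..horizon M}. \<forall>x.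
              is_arg_min (\<lambda>a. fsel k D h (x, a)) (\<lambda>_. True) (act k D h x))))"

definition played_policy ::
  "(nat \<Rightarrow> ('x, 'a) history \<Rightarrow> nat \<Rightarrow> 'x \<Rightarrow> 'a) \<Rightarrow> nat \<Rightarrow> ('x, 'a) history \<Rightarrow> ('x, 'a) policy" where
  "played_policy act k D = (\<lambda>h x. return (count_space UNIV) (act k D h x))"

text \<open>With uniform actions, the \<open>H\<close> transitions of a round come from separate, hence independent,
  episodes.\<close>

definition collect_law ::
  "('x, 'a::finite) mdp \<Rightarrow> bool \<Rightarrow> ('x, 'a) policy \<Rightarrow> ('x, 'a) round measure" where
  "collect_law M ua \<pi> =
     (if ua then PiM {1..horizon M}
        (\<lambda>h. obs_law M \<pi> h \<bind> step_law M h (\<lambda>_. uniform_count_measure UNIV))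
      else episode M \<pi>)"

primrec run_law ::
  "('x, 'a::finite) mdp \<Rightarrow> bool \<Rightarrow> (nat \<Rightarrow> ('x, 'a) history \<Rightarrow> nat \<Rightarrow> 'x \<Rightarrow> 'a) \<Rightarrow> nat \<Rightarrow>
   ('x, 'a) history measure" where
  "run_law M ua act 0 = return (history_space M 1) (\<lambda>_. undefined)"
| "run_law M ua act (Suc n) = run_law M ua act n \<bind> (\<lambda>D.
     distr (collect_law M ua (played_policy act (Suc n) D))
       (history_space M (Suc (Suc n))) (\<lambda>d. D(Suc n := d)))"

text \<open>\<open>D\<close> contains all rounds; the policy of round \<open>k\<close> only sees the rounds before \<open>k\<close>.\<close>

definition regret ::
  "('x, 'a::finite) mdp \<Rightarrow> (nat \<Rightarrow> ('x, 'a) history \<Rightarrow> nat \<Rightarrow> 'x \<Rightarrow> 'a) \<Rightarrow> nat \<Rightarrow>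
   ('x, 'a) history \<Rightarrow> real" where
  "regret M act K D =
     (\<Sum>k=1..K. policy_value M (played_policy act k (restrict D {1..<k})) - opt_value M)"


section \<open>Eluder dimension\<close>

text \<open>
  For a finite class \<open>\<Psi>\<close> the lengths are bounded by \<open>card \<Psi>\<close> if \<open>q > 0\<close> (no function can be a witness
  twice), so that the supremum is the length of the longest sequence.
\<close>

definition eluder_dim ::
  "nat \<Rightarrow> ('s \<Rightarrow> real) set \<Rightarrow> 's measure set \<Rightarrow> real \<Rightarrow> nat" where
  "eluder_dim q \<Psi> \<M> \<epsilon>\<^sub>0 = Sup {L. \<exists>\<mu>. (\<forall>t\<in>{1..L}. \<mu> t \<in> \<M>) \<and>
     (\<exists>\<epsilon>\<ge>\<epsilon>\<^sub>0. \<forall>t\<in>{1..L}. \<exists>\<psi>\<in>\<Psi>.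
        \<bar>\<integral>s. \<psi> s \<partial>\<mu> t\<bar> > \<epsilon> \<and> (\<Sum>i\<in>{1..<t}. \<bar>\<integral>s. \<psi> s \<partial>\<mu> i\<bar> ^ q) \<le> \<epsilon> ^ q)}"

definition hellinger_ber :: "real \<Rightarrow> real \<Rightarrow> real" where
  "hellinger_ber u v = (sqrt u - sqrt v)\<^sup>2 / 2 + (sqrt (1 - u) - sqrt (1 - v))\<^sup>2 / 2"

definition psi_bce ::
  "('x, 'a::finite) mdp \<Rightarrow> ('x, 'a) ftuple set \<Rightarrow> nat \<Rightarrow> ('x \<times> 'a \<Rightarrow> real) set" where
  "psi_bce M F h = {\<lambda>z. hellinger_ber (f h z) (bellman M h (f (Suc h)) z) | f. f \<in> F}"

definition psi_bce_V ::
  "('x, 'a::finite) mdp \<Rightarrow> ('x, 'a) ftuple set \<Rightarrow> nat \<Rightarrow> ('x \<Rightarrow> real) set" where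
  "psi_bce_V M F h = {\<lambda>x. \<integral>a. \<psi> (x, a) \<partial>uniform_count_measure UNIV | \<psi>. \<psi> \<in> psi_bce M F h}"

definition d_bce :: "('x, 'a::finite) mdp \<Rightarrow> ('x, 'a) ftuple set \<Rightarrow> nat \<Rightarrow> nat" where
  "d_bce M F K = (MAX h\<in>{1..horizon M}.
     eluder_dim 1 (psi_bce M F h) {obs_act_law M \<pi> h | \<pi>. \<pi> \<in> policies M} (1 / real K))"

definition d_bce_V :: "('x, 'a::finite) mdp \<Rightarrow> ('x, 'a) ftuple set \<Rightarrow> nat \<Rightarrow> nat" where
  "d_bce_V M F K = (MAX h\<in>{1..horizon M}.
     eluder_dim 1 (psi_bce_V M F h) {obs_law M \<pi> h | \<pi>. \<pi> \<in> policies M} (1 / real K))"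

end

theory Submission
  imports Defs
begin

text \<open>
  For a Bernoulli-type target \<open>y\<close> with mean \<open>p\<close>, the square root of the likelihood ratio of a prediction
  \<open>q\<close> against \<open>p\<close> is bounded by an affine function of \<open>y\<close> with mean \<open>1 - h\<^sup>2(q, p)\<close>. Multiplied along
  the run, with the factors \<open>exp\<close> of the conditional mean of \<open>h\<^sup>2\<close>, these bounds form nonnegative
  supermartingales, one for each step and pair of functions. Ville's inequality for a weighted sum of
  them shows that, in all rounds at once, the confidence set contains the optimal action-value
  functions and each chosen tuple has past squared Hellinger Bellman error at most \<open>3\<beta>/2\<close>.

  The eluder dimension turns the bound on past errors into one on the sum of current errors: the rounds
  with error above \<open>\<epsilon>\<close> are distributed greedily over about \<open>\<beta>/\<epsilon>\<close> eluder sequences, and summing over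
  dyadic \<open>\<epsilon>\<close> costs a factor \<open>ln K\<close>. Finally, the regret of a round is at most the sum over the steps of
  \<open>E[T f - f]\<close>, and \<open>p - q \<le> q / m + (2m + 2) h\<^sup>2(q, p)\<close> for every \<open>m > 0\<close>. By optimism \<open>E[f]\<close> starts below
  the optimal value, and for \<open>m \<ge> H\<close> it stays of that order up to the errors, which yields the
  first-order bound after optimising \<open>m\<close>.
\<close>

section \<open>Real inequalities and the eluder dimension\<close>

text \<open>The prescribed \<beta> has no slack for a union bound over the K rounds or for a
  separate failure event. Hence uniformity over rounds comes from a maximal inequality, the almost
  sure facts about the data enter the same process as a summand whose increments integrate to zero,
  and \<open>Q\<close> itself has to be left out of the families of ratios. The square root is taken
  because its mean is the Hellinger affinity: the gap to 1 is the quantity that the regret needs, so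
  comparing losses controls errors and not only the validity of the confidence set. Targets lie in
  [0,1] but need not be binary; concavity of the logarithm makes an affine majorant sufficient.
  Predictions 0 and 1 can have infinite loss, so finiteness must be known before losses are
  subtracted. The bound 3\<beta>/2 is half of \<beta> (the confidence test) plus 2\<beta> (twice the
  logarithm of the inverse of the smaller weight). In the regret, the inequality with the free m
  replaces a product of square roots, because the recursion over steps needs growth factors of the
  form 1 + 1/m.\<close>

lemma hellinger_ber_eq:
  assumes "u \<in> {0..1}" "v \<in> {0..1}"
  shows "hellinger_ber u v = 1 - (sqrt (u * v) + sqrt ((1 - u) * (1 - v)))"
proof -
  have "(sqrt u)\<^sup>2 = u" "(sqrt v)\<^sup>2 = v" "(sqrt (1 - u))\<^sup>2 = 1 - u" "(sqrt (1 - v))\<^sup>2 = 1 - v"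
    using assms by auto
  then show ?thesis
    unfolding hellinger_ber_def real_sqrt_mult power2_diff by (simp add: field_simps)
qed

lemma hellinger_ber_nonneg: "0 \<le> hellinger_ber u v"
  by (simp add: hellinger_ber_def)

lemma hellinger_ber_le_1: "u \<in> {0..1} \<Longrightarrow> v \<in> {0..1} \<Longrightarrow> hellinger_ber u v \<le> 1"
  using real_sqrt_ge_zero[of "u * v"] real_sqrt_ge_zero[of "(1 - u) * (1 - v)"]
  by (subst hellinger_ber_eq) (auto simp del: real_sqrt_ge_0_iff)

lemma hellinger_ber_same [simp]: "hellinger_ber u u = 0"
  by (simp add: hellinger_ber_def)

text \<open>With \<open>s = sqrt p\<close> and \<open>t = sqrt q\<close>, p - q = 2t(s - t) + (s -
  t)^2. The cross term is split by AM-GM with weight m, and (s - t)^2 is at most twice the Hellinger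
  term. The part \<open>q / m\<close> is relative to the prediction itself, which makes the final
  bound scale with the optimal value.\<close>

lemma diff_le_hellinger_ber:
  assumes "p \<in> {0..1}" "q \<in> {0..1}" "m > 0"
  shows "p - q \<le> q / m + (2 * m + 2) * hellinger_ber q p"
proof -
  define s t where "s = sqrt p" and "t = sqrt q"
  have sq: "s\<^sup>2 = p" "t\<^sup>2 = q" using assms by (auto simp: s_def t_def)
  have h: "(s - t)\<^sup>2 \<le> 2 * hellinger_ber q p"
    by (simp add: hellinger_ber_def s_def t_def power2_commute)
  have "0 \<le> (t - m * (s - t))\<^sup>2 / m" using assms by simp
  also have "\<dots> = t\<^sup>2 / m + m * (s - t)\<^sup>2 - 2 * t * (s - t)"
    using assms by (simp add: power2_eq_square field_simps)
  finally have "2 * t * (s - t) \<le> t\<^sup>2 / m + m * (s - t)\<^sup>2" by simp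
  then have "p - q \<le> t\<^sup>2 / m + (m + 1) * (s - t)\<^sup>2"
    unfolding sq(1)[symmetric] sq(2)[symmetric] by (simp add: power2_eq_square algebra_simps)
  also have "\<dots> \<le> q / m + (m + 1) * (2 * hellinger_ber q p)"
    using h assms by (intro add_mono mult_left_mono) (auto simp: sq)
  finally show ?thesis by (simp add: algebra_simps)
qed

text \<open>
  The values of the estimates grow by at most a factor \<open>1 + 1/m\<close> per step, so all of them stay
  of the order of the first one, which optimism bounds by the optimal value.
\<close>

lemma bellman_error_sum_le:
  fixes e b \<epsilon> :: "nat \<Rightarrow> real" and m v :: real
  assumes H: "1 \<le> H" "real H \<le> m"
    and nonneg: "\<And>h. 0 \<le> \<epsilon> h" "0 \<le> v"
    and first: "e 1 \<le> v"
    and err: "\<And>h. h \<in> {1..H} \<Longrightarrow> b h - e h \<le> e h / m + 4 * m * \<epsilon> h"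
    and succ: "\<And>h. h \<in> {1..<H} \<Longrightarrow> e (Suc h) \<le> b h"
  shows "(\<Sum>h=1..H. b h - e h) \<le> 3 * H * v / m + 16 * m * (\<Sum>h=1..H. \<epsilon> h)"
proof -
  have m: "1 \<le> m" using H by linarith
  define S where "S = (\<Sum>h=1..H. \<epsilon> h)"
  have S0: "0 \<le> S" by (simp add: S_def nonneg sum_nonneg)
  \<comment> \<open>One step multiplies the estimate by at most 1 + 1/m and adds 4m times the error.
    Errors of later steps are inflated by the full power as well, so that a single factor covers the
    bracket.\<close>
  have grow: "e h \<le> (1 + 1 / m) ^ (h - 1) * (v + 4 * m * (\<Sum>t=1..<h. \<epsilon> t))" if "1 \<le> h" "h \<le> H" for h
    using that
  proof (induction h rule: dec_induct)
    case base
    then show ?case using first by simp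
  next
    case (step h)
    let ?g = "1 + 1 / m" and ?s = "\<Sum>t=1..<h. \<epsilon> t"
    have g1: "1 \<le> ?g" using m by simp
    have "e (Suc h) \<le> b h" using step by (intro succ) auto
    also have "\<dots> \<le> ?g * e h + 4 * m * \<epsilon> h" using err[of h] step by (simp add: algebra_simps)
    also have "\<dots> \<le> ?g * (?g ^ (h - 1) * (v + 4 * m * ?s)) + ?g ^ h * (4 * m * \<epsilon> h)"
    proof (intro add_mono mult_left_mono)
      show "4 * m * \<epsilon> h \<le> ?g ^ h * (4 * m * \<epsilon> h)"
        using m nonneg(1)[of h] one_le_power[OF g1, of h]
        mult_right_mono[of 1 "?g ^ h" "4 * m * \<epsilon> h"] by simp
      show "0 \<le> ?g" using g1 by simp
      show "e h \<le> ?g ^ (h - 1) * (v + 4 * m * ?s)" using step by simp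
    qed
    also have "?g * (?g ^ (h - 1) * (v + 4 * m * ?s)) = ?g ^ h * (v + 4 * m * ?s)"
      using \<open>1 \<le> h\<close> by (cases h) auto
    finally show ?case using \<open>1 \<le> h\<close> by (simp add: algebra_simps)
  qed
  have e_le: "e h \<le> 3 * (v + 4 * m * S)" if h: "h \<in> {1..H}" for h
  proof -
    \<comment> \<open>As \<open>real H \<le> m\<close>, compounding over all steps costs at most exp
      1, hence at most 3.\<close>
    have "(1 + 1 / m) ^ (h - 1) \<le> (1 + 1 / m) ^ H" using h m by (intro power_increasing) auto
    also have "\<dots> \<le> exp (1 / m) ^ H" using m by (intro power_mono exp_ge_add_one_self) auto
    also have "\<dots> = exp (real H / m)" by (simp add: exp_of_nat_mult[symmetric])
    also have "\<dots> \<le> exp 1" using H m by simp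
    also have "\<dots> \<le> 3" by (rule exp_le)
    finally have g3: "(1 + 1 / m) ^ (h - 1) \<le> 3" .
    have "(\<Sum>t=1..<h. \<epsilon> t) \<le> S" unfolding S_def using h nonneg by (intro sum_mono2) auto
    then have "v + 4 * m * (\<Sum>t=1..<h. \<epsilon> t) \<le> v + 4 * m * S" using m by simp
    then have "(1 + 1 / m) ^ (h - 1) * (v + 4 * m * (\<Sum>t=1..<h. \<epsilon> t)) \<le> 3 * (v + 4 * m * S)"
      using g3 m nonneg by (intro mult_mono) (auto intro!: sum_nonneg add_nonneg_nonneg mult_nonneg_nonneg)
    then show ?thesis using grow[of h] h by auto
  qed
  have "(\<Sum>h=1..H. b h - e h) \<le> (\<Sum>h=1..H. 3 * (v + 4 * m * S) / m + 4 * m * \<epsilon> h)"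
  proof (intro sum_mono)
    fix h assume h: "h \<in> {1..H}"
    have "e h / m \<le> 3 * (v + 4 * m * S) / m" using e_le[OF h] m by (intro divide_right_mono) auto
    then show "b h - e h \<le> 3 * (v + 4 * m * S) / m + 4 * m * \<epsilon> h" using err[OF h] by simp
  qed
  also have "\<dots> = 3 * H * v / m + 12 * real H * S + 4 * m * S"
  proof -
    have "3 * (v + 4 * m * S) / m = 3 * v / m + 12 * S" using m by (simp add: field_simps)
    then show ?thesis
      by (simp only: sum.distrib sum_distrib_left[symmetric] S_def[symmetric]) (simp add: algebra_simps)
  qed
  \<comment> \<open>12 H S is at most 12 m S, again by \<open>real H \<le> m\<close>; the direct
    errors add 4 m S.\<close>
  also have "\<dots> \<le> 3 * H * v / m + 16 * m * S"
    using mult_right_mono[OF H(2) S0] by (simp add: mult.commute)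
  finally show ?thesis by (simp add: S_def)
qed

section \<open>From counts above thresholds to sums\<close>

lemma dyadic_threshold_le:
  fixes x :: real
  assumes "x \<le> 1"
  shows "x \<le> (1/2) ^ J + (\<Sum>j<J. (1/2) ^ Suc j * of_bool (x > (1/2) ^ Suc j))"
proof (induction J)
  case 0
  then show ?case using assms by simp
next
  case (Suc J)
  have "0 \<le> (\<Sum>j<Suc J. (1/2 :: real) ^ Suc j * of_bool (x > (1/2) ^ Suc j))"
    by (intro sum_nonneg) auto
  \<comment> \<open>If the new threshold is exceeded, its summand compensates for the halving of the
    remainder; otherwise the remainder alone bounds x.\<close>
  then show ?case using Suc by (cases "x > (1/2) ^ Suc J") auto
qed

text \<open>Every dyadic level \<epsilon> contributes \<epsilon> times its count, that is,
  \<open>B * d\<close> plus a geometric part that sums to at most d. The number of levels is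
  logarithmic in K, and a remainder of at most 2/K per round accounts for the constant 2.\<close>

lemma sum_le_of_count_le:
  fixes x :: "nat \<Rightarrow> real" and B d :: real
  assumes K: "1 \<le> K" and x: "\<And>k. k \<in> {1..K} \<Longrightarrow> x k \<le> 1"
    and count: "\<And>\<epsilon>. \<epsilon> \<ge> 1 / real K \<Longrightarrow> real (card {k\<in>{1..K}. x k > \<epsilon>}) \<le> (B / \<epsilon> + 1) * d"
    and B: "0 \<le> B" and d: "0 \<le> d"
  shows "(\<Sum>k=1..K. x k) \<le> 2 + d + 3 / 2 * B * d * ln K"
proof -
  \<comment> \<open>J is the integer part of the binary logarithm of K: large enough for a remainder
    2^-J of at most 2/K, small enough that all thresholds are at least 1/K, where
    \<open>count\<close> applies. Below, ln 2 \<ge> 2/3 turns J into the factor 3/2 of ln K.\<close>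
  obtain J where J: "2 ^ J \<le> K" "K < 2 ^ (J + 1)"
    using ex_power_ivl1[of 2 K] K by auto
  have J': "2 ^ J \<le> real K" "real K < 2 * 2 ^ J"
    using J by (metis of_nat_le_iff of_nat_numeral of_nat_power)
      (metis J(2) of_nat_less_iff of_nat_numeral of_nat_power power_add power_one_right mult.commute)
  have Kp: "0 < real K" using K by simp
  have "real J * ln 2 = ln (2 ^ J)" by (simp add: ln_realpow)
  also have "\<dots> \<le> ln K" using J' Kp by (subst ln_le_cancel_iff) auto
  finally have "real J * ln 2 \<le> ln K" .
  moreover have "real J * (2/3) \<le> real J * ln 2" using ln2_ge_two_thirds by (intro mult_left_mono) auto
  ultimately have Jln: "real J \<le> 3/2 * ln K" by simp
  have "(\<Sum>k=1..K. x k) \<le> (\<Sum>k=1..K. (1/2) ^ J + (\<Sum>j<J. (1/2) ^ Suc j * of_bool (x k > (1/2) ^ Suc j)))"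
    by (intro sum_mono dyadic_threshold_le x)
  also have "\<dots> = K * (1/2) ^ J + (\<Sum>j<J. (1/2) ^ Suc j * real (card {k\<in>{1..K}. x k > (1/2) ^ Suc j}))"
  proof -
    have "(\<Sum>k=1..K. \<Sum>j<J. (1/2 :: real) ^ Suc j * of_bool (x k > (1/2) ^ Suc j)) =
       (\<Sum>j<J. (1/2) ^ Suc j * (\<Sum>k=1..K. of_bool (x k > (1/2) ^ Suc j)))"
      unfolding sum_distrib_left by (rule sum.swap)
    moreover have "(\<Sum>k=1..K. of_bool (x k > c)) = real (card {k\<in>{1..K}. x k > c})" for c
      by (simp add: of_bool_def sum.If_cases Int_def conj_commute)
    ultimately show ?thesis by (simp only: sum.distrib sum_constant card_atLeastAtMost) simp
  qed
  also have "\<dots> \<le> 2 + (\<Sum>j<J. B * d + (1/2) ^ Suc j * d)"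
  proof (intro add_mono sum_mono)
    show "real K * (1/2) ^ J \<le> 2" using J' by (simp add: power_one_over field_simps)
    fix j assume "j \<in> {..<J}"
    then have "(2::real) ^ Suc j \<le> 2 ^ J" by (intro power_increasing) auto
    then have "2 ^ Suc j \<le> real K" using J' by linarith
    then have "(1/2) ^ Suc j \<ge> 1 / real K" using Kp unfolding power_one_over by (intro divide_left_mono mult_pos_pos) auto
    from count[OF this]
    have "(1/2) ^ Suc j * real (card {k\<in>{1..K}. x k > (1/2) ^ Suc j}) \<le> (1/2) ^ Suc j * ((B / (1/2) ^ Suc j + 1) * d)"
      by (intro mult_left_mono) auto
    also have "\<dots> = B * d + (1/2) ^ Suc j * d" by (simp add: field_simps)
    finally show "(1/2) ^ Suc j * real (card {k\<in>{1..K}. x k > (1/2) ^ Suc j}) \<le> B * d + (1/2) ^ Suc j * d" .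
  qed
  also have "(\<Sum>j<J. B * d + (1/2) ^ Suc j * d) = J * (B * d) + (1 - (1/2)^J) * d"
    by (induction J) (auto simp: algebra_simps)
  also have "\<dots> \<le> 3/2 * ln K * (B * d) + 1 * d"
    using B d Jln by (intro add_mono mult_right_mono) auto
  finally show ?thesis by (simp add: algebra_simps)
qed

text \<open>
  Greedy colouring with more than \<open>B/\<epsilon>\<close> colours: an index that fits into no colour class would
  have a predecessor sum above \<open>B\<close>.
\<close>

lemma greedy_bins:
  fixes a :: "nat \<Rightarrow> nat \<Rightarrow> real"
  assumes a: "\<And>i k. 0 \<le> a i k" and B: "\<And>k. k \<in> {1..K} \<Longrightarrow> (\<Sum>i\<in>{1..<k}. a i k) \<le> B"
    and S: "S \<subseteq> {1..K}" and m: "real m * \<epsilon> > B"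
  shows "\<exists>b. \<forall>k\<in>S. b k < m \<and> (\<Sum>i\<in>{i\<in>S. i < k \<and> b i = b k}. a i k) \<le> \<epsilon>"
proof -
  have "\<exists>b. \<forall>k\<in>S. k \<le> n \<longrightarrow> b k < m \<and> (\<Sum>i\<in>{i\<in>S. i < k \<and> b i = b k}. a i k) \<le> \<epsilon>" for n
  proof (induction n)
    case 0
    have "0 \<notin> S" using S by auto
    then show ?case by auto
  next
    case (Suc n)
    then obtain b where b: "\<forall>k\<in>S. k \<le> n \<longrightarrow> b k < m \<and> (\<Sum>i\<in>{i\<in>S. i < k \<and> b i = b k}. a i k) \<le> \<epsilon>"
      by blast
    let ?k = "Suc n"
    show ?case
    proof (cases "?k \<in> S")
      case False
      then show ?thesis using b by (metis le_Suc_eq)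
    next
      case True
      have fin: "finite S" using S finite_subset by blast
      have "\<exists>j<m. (\<Sum>i\<in>{i\<in>S. i < ?k \<and> b i = j}. a i ?k) \<le> \<epsilon>"
      proof (rule ccontr)
        assume "\<not> ?thesis"
        then have big: "\<And>j. j < m \<Longrightarrow> \<epsilon> \<le> (\<Sum>i\<in>{i\<in>S. i < ?k \<and> b i = j}. a i ?k)"
          by fastforce
        have "real m * \<epsilon> = (\<Sum>j<m. \<epsilon>)" by simp
        also have "\<dots> \<le> (\<Sum>j<m. \<Sum>i\<in>{i\<in>S. i < ?k \<and> b i = j}. a i ?k)"
          using big by (intro sum_mono) auto
        also have "\<dots> = (\<Sum>j<m. \<Sum>i\<in>{i\<in>{i\<in>S. i < ?k}. b i = j}. a i ?k)"
          by (intro sum.cong) auto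
        also have "\<dots> = (\<Sum>i\<in>{i\<in>S. i < ?k}. a i ?k)"
          using b fin by (intro sum.group) auto
        also have "\<dots> \<le> (\<Sum>i\<in>{1..<?k}. a i ?k)"
          using S a by (intro sum_mono2) auto
        also have "\<dots> \<le> B" using B[of ?k] True S by blast
        finally show False using m by simp
      qed
      then obtain j where j: "j < m" "(\<Sum>i\<in>{i\<in>S. i < ?k \<and> b i = j}. a i ?k) \<le> \<epsilon>" by blast
      \<comment> \<open>Colouring \<open>?k\<close> does not disturb the conditions at smaller
        indices, which look only at their predecessors.\<close>
      have "(b(?k := j)) k < m \<and>
          (\<Sum>i\<in>{i\<in>S. i < k \<and> (b(?k := j)) i = (b(?k := j)) k}. a i k) \<le> \<epsilon>"
        if k: "k \<in> S" "k \<le> ?k" for k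
      proof -
        have "{i\<in>S. i < k \<and> (b(?k := j)) i = (b(?k := j)) k} =
           {i\<in>S. i < k \<and> b i = (if k = ?k then j else b k)}"
          using k by auto
        then show ?thesis using k j b by auto
      qed
      then show ?thesis by blast
    qed
  qed
  from this[of K] show ?thesis using S by (metis atLeastAtMost_iff subset_iff)
qed

section \<open>Eluder sequences and the number of large errors\<close>

lemma eluder_length_le_card:
  fixes \<Psi> :: "('s \<Rightarrow> real) set" and \<mu> :: "nat \<Rightarrow> 's measure"
  assumes fin: "finite \<Psi>" and \<epsilon>: "0 < \<epsilon>"
    and w: "\<forall>t\<in>{1..L}. \<exists>\<psi>\<in>\<Psi>. \<bar>\<integral>s. \<psi> s \<partial>\<mu> t\<bar> > \<epsilon> \<and> (\<Sum>i\<in>{1..<t}. \<bar>\<integral>s. \<psi> s \<partial>\<mu> i\<bar>) \<le> \<epsilon>"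
  shows "L \<le> card \<Psi>"
proof -
  obtain \<psi> where \<psi>: "\<And>t. t \<in> {1..L} \<Longrightarrow> \<psi> t \<in> \<Psi>" "\<And>t. t \<in> {1..L} \<Longrightarrow> \<bar>\<integral>s. \<psi> t s \<partial>\<mu> t\<bar> > \<epsilon>"
    "\<And>t. t \<in> {1..L} \<Longrightarrow> (\<Sum>i\<in>{1..<t}. \<bar>\<integral>s. \<psi> t s \<partial>\<mu> i\<bar>) \<le> \<epsilon>"
    using w by metis
  have "\<psi> i \<noteq> \<psi> t" if "i \<in> {1..L}" "t \<in> {1..L}" "i < t" for i t
  proof
    assume eq: "\<psi> i = \<psi> t"
    \<comment> \<open>A repeated witness would find its own value at i, which exceeds \<epsilon>,
      among the earlier terms, whose sum is at most \<epsilon>.\<close>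
    have "\<bar>\<integral>s. \<psi> t s \<partial>\<mu> i\<bar> \<le> (\<Sum>i\<in>{1..<t}. \<bar>\<integral>s. \<psi> t s \<partial>\<mu> i\<bar>)"
      using that by (intro member_le_sum[of i "{1..<t}" "\<lambda>i. \<bar>\<integral>s. \<psi> t s \<partial>\<mu> i\<bar>"]) auto
    then show False using \<psi>(2)[OF that(1)] \<psi>(3)[OF that(2)] eq by simp
  qed
  then have "inj_on \<psi> {1..L}" by (metis inj_onI linorder_neqE_nat)
  then have "card {1..L} \<le> card \<Psi>" using \<psi>(1) fin by (intro card_inj_on_le[of \<psi>]) auto
  then show ?thesis by simp
qed

text \<open>A supremum of naturals is known to be an upper bound only if the set is bounded; the
  cardinality of the finite class bounds all lengths.\<close>

lemma le_eluder_dim: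
  fixes \<Psi> :: "('s \<Rightarrow> real) set" and \<mu> :: "nat \<Rightarrow> 's measure"
  assumes fin: "finite \<Psi>" and \<epsilon>: "0 < \<epsilon>\<^sub>0" "\<epsilon>\<^sub>0 \<le> \<epsilon>"
    and \<mu>: "\<And>t. t \<in> {1..L} \<Longrightarrow> \<mu> t \<in> \<M>"
    and w: "\<And>t. t \<in> {1..L} \<Longrightarrow>
        \<exists>\<psi>\<in>\<Psi>. \<bar>\<integral>s. \<psi> s \<partial>\<mu> t\<bar> > \<epsilon> \<and> (\<Sum>i\<in>{1..<t}. \<bar>\<integral>s. \<psi> s \<partial>\<mu> i\<bar>) \<le> \<epsilon>"
  shows "L \<le> eluder_dim 1 \<Psi> \<M> \<epsilon>\<^sub>0"
  unfolding eluder_dim_def power_one_right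
proof (rule cSup_upper)
  show "L \<in> {L. \<exists>\<mu>. (\<forall>t\<in>{1..L}. \<mu> t \<in> \<M>) \<and> (\<exists>\<epsilon>\<ge>\<epsilon>\<^sub>0. \<forall>t\<in>{1..L}. \<exists>\<psi>\<in>\<Psi>.
        \<epsilon> < \<bar>\<integral>s. \<psi> s \<partial>\<mu> t\<bar> \<and> (\<Sum>i\<in>{1..<t}. \<bar>\<integral>s. \<psi> s \<partial>\<mu> i\<bar>) \<le> \<epsilon>)}"
    using \<mu> w \<epsilon>(2) by blast
  show "bdd_above {L :: nat. \<exists>\<mu>. (\<forall>t\<in>{1..L}. \<mu> t \<in> \<M>) \<and> (\<exists>\<epsilon>\<ge>\<epsilon>\<^sub>0. \<forall>t\<in>{1..L}. \<exists>\<psi>\<in>\<Psi>.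
        \<epsilon> < \<bar>\<integral>s. \<psi> s \<partial>\<mu> t\<bar> \<and> (\<Sum>i\<in>{1..<t}. \<bar>\<integral>s. \<psi> s \<partial>\<mu> i\<bar>) \<le> \<epsilon>)}"
  proof (rule bdd_aboveI)
    fix L :: nat assume "L \<in> {L. \<exists>\<mu>. (\<forall>t\<in>{1..L}. \<mu> t \<in> \<M>) \<and> (\<exists>\<epsilon>\<ge>\<epsilon>\<^sub>0. \<forall>t\<in>{1..L}. \<exists>\<psi>\<in>\<Psi>.
        \<epsilon> < \<bar>\<integral>s. \<psi> s \<partial>\<mu> t\<bar> \<and> (\<Sum>i\<in>{1..<t}. \<bar>\<integral>s. \<psi> s \<partial>\<mu> i\<bar>) \<le> \<epsilon>)}"
    then obtain \<mu> :: "nat \<Rightarrow> 's measure" and \<epsilon> where "\<epsilon> \<ge> \<epsilon>\<^sub>0" "\<forall>t\<in>{1..L}. \<exists>\<psi>\<in>\<Psi>. \<epsilon> < \<bar>\<integral>s. \<psi> s \<partial>\<mu> t\<bar> \<and> (\<Sum>i\<in>{1..<t}. \<bar>\<integral>s. \<psi> s \<partial>\<mu> i\<bar>) \<le> \<epsilon>"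
      by blast
    then show "L \<le> card \<Psi>" using eluder_length_le_card[OF fin, of \<epsilon> L \<mu>] \<epsilon>(1) by auto
  qed
qed

text \<open>The set is listed in increasing order to become an eluder sequence. Arbitrary finite
  sets of rounds are needed because colour classes are not intervals.\<close>

lemma card_le_eluder_dim:
  fixes \<mu> :: "nat \<Rightarrow> 's measure" and \<psi> :: "nat \<Rightarrow> 's \<Rightarrow> real" and T :: "nat set"
  assumes fin: "finite \<Psi>" "finite T" and \<epsilon>: "0 < \<epsilon>\<^sub>0" "\<epsilon>\<^sub>0 \<le> \<epsilon>"
    and \<mu>: "\<And>k. k \<in> T \<Longrightarrow> \<mu> k \<in> \<M>" and \<psi>: "\<And>k. k \<in> T \<Longrightarrow> \<psi> k \<in> \<Psi>"
    and gt: "\<And>k. k \<in> T \<Longrightarrow> \<bar>\<integral>s. \<psi> k s \<partial>\<mu> k\<bar> > \<epsilon>"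
    and le: "\<And>k. k \<in> T \<Longrightarrow> (\<Sum>i\<in>{i\<in>T. i < k}. \<bar>\<integral>s. \<psi> k s \<partial>\<mu> i\<bar>) \<le> \<epsilon>"
  shows "card T \<le> eluder_dim 1 \<Psi> \<M> \<epsilon>\<^sub>0"
proof -
  define xs where "xs = sorted_list_of_set T"
  have xs: "sorted_wrt (<) xs" "set xs = T" "length xs = card T"
    using fin by (simp_all add: xs_def)
  \<comment> \<open>Lists are indexed from 0, eluder sequences from 1.\<close>
  define e where "e t = xs ! (t - 1)" for t
  have eT: "e t \<in> T" if "t \<in> {1..card T}" for t
    using that xs by (auto simp: e_def intro!: nth_mem)
  have mono: "e i < e t" if "i \<in> {1..<t}" "t \<in> {1..card T}" for i t
    using that xs by (auto simp: e_def sorted_wrt_iff_nth_less)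
  show ?thesis
  proof (rule le_eluder_dim[OF fin(1) \<epsilon>, where \<mu> = "\<lambda>t. \<mu> (e t)"])
    fix t assume t: "t \<in> {1..card T}"
    show "\<mu> (e t) \<in> \<M>" using \<mu> eT t by blast
    have "inj_on e {1..<t}"
    proof (rule linorder_inj_onI)
      fix i j assume "i < j" "i \<in> {1..<t}" "j \<in> {1..<t}"
      then show "e i \<noteq> e j" using mono[of i j] t by auto
    qed auto
    then have "(\<Sum>i\<in>{1..<t}. \<bar>\<integral>s. \<psi> (e t) s \<partial>\<mu> (e i)\<bar>) = (\<Sum>i\<in>e ` {1..<t}. \<bar>\<integral>s. \<psi> (e t) s \<partial>\<mu> i\<bar>)"
      by (simp add: sum.reindex)
    also have "\<dots> \<le> (\<Sum>i\<in>{i\<in>T. i < e t}. \<bar>\<integral>s. \<psi> (e t) s \<partial>\<mu> i\<bar>)"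
      using t mono eT fin by (intro sum_mono2) auto
    also have "\<dots> \<le> \<epsilon>" using le eT t by blast
    finally show "\<exists>\<psi>\<in>\<Psi>. \<bar>\<integral>s. \<psi> s \<partial>\<mu> (e t)\<bar> > \<epsilon> \<and> (\<Sum>i\<in>{1..<t}. \<bar>\<integral>s. \<psi> s \<partial>\<mu> (e i)\<bar>) \<le> \<epsilon>"
      using \<psi> gt eT t by blast
  qed
qed

text \<open>Within a colour class each round is a witness at level \<epsilon> against the earlier
  rounds of that class, so a class is an eluder sequence and no larger than the dimension. The
  number of classes is the floor of B/\<epsilon> plus 1: enough for the greedy colouring, and at
  most B/\<epsilon> + 1.\<close>

lemma eluder_count_le:
  fixes \<mu> :: "nat \<Rightarrow> 's measure" and \<psi> :: "nat \<Rightarrow> 's \<Rightarrow> real"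
  assumes fin: "finite \<Psi>" and \<epsilon>: "0 < \<epsilon>\<^sub>0" "\<epsilon>\<^sub>0 \<le> \<epsilon>" and B0: "0 \<le> B"
    and \<mu>: "\<And>k. k \<in> {1..K} \<Longrightarrow> \<mu> k \<in> \<M>" and \<psi>: "\<And>k. k \<in> {1..K} \<Longrightarrow> \<psi> k \<in> \<Psi>"
    and B: "\<And>k. k \<in> {1..K} \<Longrightarrow> (\<Sum>i\<in>{1..<k}. \<bar>\<integral>s. \<psi> k s \<partial>\<mu> i\<bar>) \<le> B"
  shows "real (card {k\<in>{1..K}. \<bar>\<integral>s. \<psi> k s \<partial>\<mu> k\<bar> > \<epsilon>}) \<le> (B / \<epsilon> + 1) * eluder_dim 1 \<Psi> \<M> \<epsilon>\<^sub>0"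
proof -
  let ?d = "eluder_dim 1 \<Psi> \<M> \<epsilon>\<^sub>0"
  define S where "S = {k\<in>{1..K}. \<bar>\<integral>s. \<psi> k s \<partial>\<mu> k\<bar> > \<epsilon>}"
  define m where "m = nat \<lfloor>B / \<epsilon>\<rfloor> + 1"
  have \<epsilon>0: "0 < \<epsilon>" using \<epsilon> by simp
  have m: "B / \<epsilon> < real m" "real m \<le> B / \<epsilon> + 1"
  proof -
    have "0 \<le> B / \<epsilon>" using B0 \<epsilon>0 by simp
    then have "real (nat \<lfloor>B / \<epsilon>\<rfloor>) = of_int \<lfloor>B / \<epsilon>\<rfloor>" by simp
    then have "real m = of_int \<lfloor>B / \<epsilon>\<rfloor> + 1" by (simp add: m_def)
    then show "B / \<epsilon> < real m" "real m \<le> B / \<epsilon> + 1" by linarith+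
  qed
  have "B < real m * \<epsilon>" using m(1) \<epsilon>0 by (simp add: field_simps)
  moreover have "S \<subseteq> {1..K}" by (auto simp: S_def)
  ultimately have "\<exists>b. \<forall>k\<in>S. b k < m \<and> (\<Sum>i\<in>{i\<in>S. i < k \<and> b i = b k}. \<bar>\<integral>s. \<psi> k s \<partial>\<mu> i\<bar>) \<le> \<epsilon>"
    using B by (intro greedy_bins[of "\<lambda>i k. \<bar>\<integral>s. \<psi> k s \<partial>\<mu> i\<bar>" K B S m \<epsilon>]) auto
  then obtain b where b: "\<And>k. k \<in> S \<Longrightarrow> b k < m"
    "\<And>k. k \<in> S \<Longrightarrow> (\<Sum>i\<in>{i\<in>S. i < k \<and> b i = b k}. \<bar>\<integral>s. \<psi> k s \<partial>\<mu> i\<bar>) \<le> \<epsilon>"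
    by blast
  have bin: "card {k\<in>S. b k = j} \<le> ?d" for j
  proof (rule card_le_eluder_dim[OF fin _ \<epsilon>])
    fix k assume k: "k \<in> {k\<in>S. b k = j}"
    then show "\<mu> k \<in> \<M>" "\<psi> k \<in> \<Psi>" "\<bar>\<integral>s. \<psi> k s \<partial>\<mu> k\<bar> > \<epsilon>"
      using \<mu> \<psi> by (auto simp: S_def)
    have "{i\<in>{k\<in>S. b k = j}. i < k} = {i\<in>S. i < k \<and> b i = b k}" using k by auto
    then show "(\<Sum>i\<in>{i\<in>{k\<in>S. b k = j}. i < k}. \<bar>\<integral>s. \<psi> k s \<partial>\<mu> i\<bar>) \<le> \<epsilon>"
      using b(2)[of k] k by simp
  qed (simp add: S_def)
  have "card S = (\<Sum>k\<in>S. 1)" by simp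
  also have "\<dots> = (\<Sum>j<m. \<Sum>k\<in>{k\<in>S. b k = j}. 1)"
    by (rule sum.group[symmetric]) (use b in \<open>auto simp: S_def\<close>)
  also have "\<dots> \<le> (\<Sum>j<m. ?d)" using bin by (intro sum_mono) simp
  finally have "card S \<le> m * ?d" by simp
  then have "real (card S) \<le> real m * real ?d" by (metis of_nat_le_iff of_nat_mult)
  also have "\<dots> \<le> (B / \<epsilon> + 1) * ?d" using m by (intro mult_right_mono) auto
  finally show ?thesis by (simp add: S_def)
qed

text \<open>With B = 3\<beta>/2 the dyadic sum gives 2 + d + (9/4) d \<beta> ln K. The lower bounds
  on d and \<beta> serve to absorb the first two terms: 2 + d \<le> 3d as d \<ge> 1, and 3d \<le>
  (9/4) d \<beta> as \<beta> \<ge> 2 ln 2 \<ge> 4/3.\<close>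

lemma eluder_sum_le:
  fixes \<mu> :: "nat \<Rightarrow> 's measure" and \<psi> :: "nat \<Rightarrow> 's \<Rightarrow> real"
  assumes fin: "finite \<Psi>" and K: "1 \<le> K" and \<beta>: "2 * ln 2 \<le> \<beta>"
    and d: "1 \<le> d" "real (eluder_dim 1 \<Psi> \<M> (1 / real K)) \<le> d"
    and \<mu>: "\<And>k. k \<in> {1..K} \<Longrightarrow> \<mu> k \<in> \<M>" and \<psi>: "\<And>k. k \<in> {1..K} \<Longrightarrow> \<psi> k \<in> \<Psi>"
    and B: "\<And>k. k \<in> {1..K} \<Longrightarrow> (\<Sum>i\<in>{1..<k}. \<bar>\<integral>s. \<psi> k s \<partial>\<mu> i\<bar>) \<le> 3 / 2 * \<beta>"
    and le1: "\<And>k. k \<in> {1..K} \<Longrightarrow> \<bar>\<integral>s. \<psi> k s \<partial>\<mu> k\<bar> \<le> 1"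
  shows "(\<Sum>k=1..K. \<bar>\<integral>s. \<psi> k s \<partial>\<mu> k\<bar>) \<le> 3 * (1 + ln K) * (d * \<beta>)"
proof -
  have \<beta>': "4 / 3 \<le> \<beta>" using \<beta> ln2_ge_two_thirds by linarith
  have "(\<Sum>k=1..K. \<bar>\<integral>s. \<psi> k s \<partial>\<mu> k\<bar>) \<le> 2 + d + 3 / 2 * (3 / 2 * \<beta>) * d * ln K"
  proof (rule sum_le_of_count_le[OF K le1])
    fix \<epsilon> assume \<epsilon>: "1 / real K \<le> \<epsilon>"
    have \<epsilon>0: "0 < 1 / real K" using K by simp
    have "real (card {k\<in>{1..K}. \<bar>\<integral>s. \<psi> k s \<partial>\<mu> k\<bar> > \<epsilon>}) \<le> (3 / 2 * \<beta> / \<epsilon> + 1) * eluder_dim 1 \<Psi> \<M> (1 / real K)"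
      using \<beta>' by (intro eluder_count_le[OF fin \<epsilon>0 \<epsilon> _ \<mu> \<psi> B]) auto
    also have "\<dots> \<le> (3 / 2 * \<beta> / \<epsilon> + 1) * d"
      using \<beta>' order_less_le_trans[OF \<epsilon>0 \<epsilon>] d by (intro mult_left_mono add_nonneg_nonneg divide_nonneg_pos) auto
    finally show "real (card {k\<in>{1..K}. \<bar>\<integral>s. \<psi> k s \<partial>\<mu> k\<bar> > \<epsilon>}) \<le> (3 / 2 * \<beta> / \<epsilon> + 1) * d" .
  qed (use \<beta>' d in auto)
  also have "\<dots> \<le> 9/4 * (d * \<beta>) + 9/4 * (d * \<beta>) * ln K"
  proof -
    have "2 + d \<le> 3 * d" using d by simp
    also have "\<dots> \<le> 9/4 * (d * \<beta>)" using mult_left_mono[OF \<beta>', of d] d by simp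
    finally show ?thesis by (simp add: algebra_simps)
  qed
  also have "\<dots> \<le> 3 * (d * \<beta>) + 3 * (d * \<beta>) * ln K"
    using d \<beta>' K by (intro add_mono mult_right_mono) auto
  finally show ?thesis by (simp add: algebra_simps)
qed

section \<open>Step kernels and marginals of episodes\<close>

text \<open>This is the measure over which \<open>bellman\<close> integrates and also the law of the
  rest of a transition once observation and action are fixed.\<close>

definition outcome_law :: "('x, 'a) mdp \<Rightarrow> nat \<Rightarrow> 'x \<times> 'a \<Rightarrow> (real \<times> 'x) measure" where
  "outcome_law M h z = cost_kernel M h z \<Otimes>\<^sub>M trans_kernel M h z"

locale episodic_mdp =
  fixes M :: "('x, 'a::finite) mdp"
  assumes is_mdp: "is_mdp M"
begin

abbreviation "S \<equiv> obs_space M"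
abbreviation "Z \<equiv> obs_act_space M"
abbreviation "T \<equiv> trans_space M"
abbreviation "H \<equiv> horizon M"
abbreviation "AS \<equiv> count_space (UNIV :: 'a set)"

lemma space_S [simp]: "space S = UNIV" and H_ge_1: "1 \<le> H"
  using is_mdp by (auto simp: is_mdp_def)

lemma space_T [simp]: "space T = UNIV" and space_Z [simp]: "space Z = UNIV"
  by (simp_all add: space_pair_measure)

lemma trans_kernel_measurable: "h \<in> {1..H} \<Longrightarrow> trans_kernel M h \<in> Z \<rightarrow>\<^sub>M prob_algebra S"
  and cost_kernel_measurable: "h \<in> {1..H} \<Longrightarrow> cost_kernel M h \<in> Z \<rightarrow>\<^sub>M prob_algebra borel"
  and cost_kernel_AE: "h \<in> {1..H} \<Longrightarrow> AE c in cost_kernel M h z. c \<in> {0..1}"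
  using is_mdp unfolding is_mdp_def by blast+

lemma obs_of_measurable [measurable]: "obs_of \<in> T \<rightarrow>\<^sub>M S"
  and act_of_measurable [measurable]: "act_of \<in> T \<rightarrow>\<^sub>M AS"
  and cost_of_measurable [measurable]: "cost_of \<in> borel_measurable T"
  and next_of_measurable [measurable]: "next_of \<in> T \<rightarrow>\<^sub>M S"
  unfolding obs_of_def act_of_def cost_of_def next_of_def by measurable

lemma outcome_law_measurable:
  "h \<in> {1..H} \<Longrightarrow> outcome_law M h \<in> Z \<rightarrow>\<^sub>M prob_algebra (borel \<Otimes>\<^sub>M S)"
  unfolding outcome_law_def
  by (intro measurable_pair_prob cost_kernel_measurable trans_kernel_measurable)

lemma outcome_law_props:
  assumes "h \<in> {1..H}"
  shows prob_space_outcome_law: "prob_space (outcome_law M h z)"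
    and sets_outcome_law: "sets (outcome_law M h z) = sets (borel \<Otimes>\<^sub>M S)"
  using measurable_space[OF outcome_law_measurable[OF assms], of z]
  by (auto simp: space_prob_algebra)

lemma kernel_props:
  assumes "h \<in> {1..H}"
  shows "prob_space (cost_kernel M h z)" "sets (cost_kernel M h z) = sets borel"
    "prob_space (trans_kernel M h z)" "sets (trans_kernel M h z) = sets S"
  using measurable_space[OF cost_kernel_measurable[OF assms], of z]
    measurable_space[OF trans_kernel_measurable[OF assms], of z]
  by (auto simp: space_prob_algebra)

text \<open>\<open>step_law\<close> reads the action rule only at the current observation, so a
  constant rule loses nothing. In this form the action law may depend on a further parameter, such
  as the history, through w.\<close>

lemma step_law_measurable:
  assumes h: "h \<in> {1..H}" and p: "p \<in> W \<rightarrow>\<^sub>M prob_algebra AS" and x: "x \<in> W \<rightarrow>\<^sub>M S"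
  shows "(\<lambda>w. step_law M h (\<lambda>_. p w) (x w)) \<in> W \<rightarrow>\<^sub>M prob_algebra T"
  unfolding step_law_def
proof (intro measurable_bind_prob_space2[OF p], unfold split_beta')
  note [measurable] = cost_kernel_measurable[OF h] trans_kernel_measurable[OF h] x
  show "(\<lambda>wa. cost_kernel M h (x (fst wa), snd wa) \<bind> (\<lambda>c. trans_kernel M h (x (fst wa), snd wa) \<bind>
      (\<lambda>x'. return T (x (fst wa), snd wa, c, x')))) \<in> W \<Otimes>\<^sub>M AS \<rightarrow>\<^sub>M prob_algebra T"
    by measurable
qed

lemma step_law_kernel:
  assumes "h \<in> {1..H}" "p \<in> S \<rightarrow>\<^sub>M prob_algebra AS"
  shows "step_law M h p \<in> S \<rightarrow>\<^sub>M prob_algebra T"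
proof -
  have "step_law M h p = (\<lambda>x. step_law M h (\<lambda>_. p x) x)" by (simp add: fun_eq_iff step_law_def)
  then show ?thesis using step_law_measurable[OF assms, of "\<lambda>x. x"] by simp
qed

text \<open>For a fixed action the successive draws of cost and next observation form one integral
  over the product measure, by Tonelli. This is what allows later expectations to be computed
  conditionally on observation and action.\<close>

lemma nn_integral_step_law:
  assumes h: "h \<in> {1..H}" and p: "p x \<in> space (prob_algebra AS)"
    and \<phi> [measurable]: "\<phi> \<in> borel_measurable T"
  shows "(\<integral>\<^sup>+s. \<phi> s \<partial>step_law M h p x) =
    (\<integral>\<^sup>+a. (\<integral>\<^sup>+w. \<phi> (x, a, w) \<partial>outcome_law M h (x, a)) \<partial>p x)"
proof -
  have sp: "sets (p x) = sets AS" using p by (simp add: space_prob_algebra)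
  have ck: "(\<lambda>c. trans_kernel M h (x, a) \<bind> (\<lambda>x'. return T (x, a, c, x')))
      \<in> cost_kernel M h (x, a) \<rightarrow>\<^sub>M subprob_algebra T" for a
  proof (rule measurable_prob_algebraD)
    have "(\<lambda>c. trans_kernel M h (x, a) \<bind> (\<lambda>x'. return T (x, a, c, x')))
      \<in> borel \<rightarrow>\<^sub>M prob_algebra T"
      using kernel_props[OF h, of "(x, a)"]
      by (intro measurable_bind_prob_space2[where N = S] measurable_const)
        (auto simp: space_prob_algebra)
    then show "(\<lambda>c. trans_kernel M h (x, a) \<bind> (\<lambda>x'. return T (x, a, c, x')))
      \<in> cost_kernel M h (x, a) \<rightarrow>\<^sub>M prob_algebra T"
      using kernel_props(2)[OF h, of "(x, a)"] by (simp cong: measurable_cong_sets)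
  qed
  have tk: "(\<lambda>x'. return T (x, a, c, x')) \<in> trans_kernel M h (x, a) \<rightarrow>\<^sub>M subprob_algebra T" for a c
  proof -
    have "(\<lambda>x'. return T (x, a, c, x')) \<in> S \<rightarrow>\<^sub>M subprob_algebra T" by measurable
    then show ?thesis using kernel_props(4)[OF h, of "(x, a)"] by (simp cong: measurable_cong_sets)
  qed
  have "(\<lambda>a. cost_kernel M h (x, a) \<bind> (\<lambda>c. trans_kernel M h (x, a) \<bind>
      (\<lambda>x'. return T (x, a, c, x')))) \<in> AS \<rightarrow>\<^sub>M subprob_algebra T"
  proof (rule measurable_prob_algebraD)
    note [measurable] = cost_kernel_measurable[OF h] trans_kernel_measurable[OF h]
    show "(\<lambda>a. cost_kernel M h (x, a) \<bind> (\<lambda>c. trans_kernel M h (x, a) \<bind>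
      (\<lambda>x'. return T (x, a, c, x')))) \<in> AS \<rightarrow>\<^sub>M prob_algebra T"
      by measurable
  qed
  then have ak: "(\<lambda>a. cost_kernel M h (x, a) \<bind> (\<lambda>c. trans_kernel M h (x, a) \<bind>
      (\<lambda>x'. return T (x, a, c, x')))) \<in> p x \<rightarrow>\<^sub>M subprob_algebra T"
    using measurable_cong_sets[OF sp refl] by blast
  have inner: "(\<integral>\<^sup>+s. \<phi> s \<partial>(cost_kernel M h (x, a) \<bind> (\<lambda>c. trans_kernel M h (x, a) \<bind>
      (\<lambda>x'. return T (x, a, c, x'))))) = (\<integral>\<^sup>+w. \<phi> (x, a, w) \<partial>outcome_law M h (x, a))" for a
  proof -
    interpret tr: prob_space "trans_kernel M h (x, a)" by (rule kernel_props[OF h])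
    interpret co: prob_space "cost_kernel M h (x, a)" by (rule kernel_props[OF h])
    interpret pair_prob_space "cost_kernel M h (x, a)" "trans_kernel M h (x, a)" ..
    have "(\<lambda>y. \<phi> (x, a, y)) \<in> borel_measurable (borel \<Otimes>\<^sub>M S)" by measurable
    then have m: "(\<lambda>w. \<phi> (x, a, w)) \<in> borel_measurable (cost_kernel M h (x, a) \<Otimes>\<^sub>M trans_kernel M h (x, a))"
      using kernel_props(2,4)[OF h, of "(x, a)"]
      by (simp add: split_beta' cong: measurable_cong_sets sets_pair_measure_cong)
    show ?thesis
      unfolding outcome_law_def
      by (subst tr.nn_integral_fst[OF m, symmetric])
         (simp add: nn_integral_bind[OF \<phi> ck] nn_integral_bind[OF \<phi> tk] nn_integral_return[OF _ \<phi>])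
  qed
  show ?thesis
    unfolding step_law_def nn_integral_bind[OF \<phi> ak] inner ..
qed

section \<open>Episodes as kernels in the history\<close>

lemma roll_in_measurable:
  assumes pol: "\<And>h. h \<in> {1..H} \<Longrightarrow> (\<lambda>(D, x). pol D h x) \<in> N \<Otimes>\<^sub>M S \<rightarrow>\<^sub>M prob_algebra AS"
    and n: "n \<le> H"
  shows "(\<lambda>D. roll_in M (pol D) n) \<in> N \<rightarrow>\<^sub>M prob_algebra (PiM {1..n} (\<lambda>_. T))"
  using n
proof (induction n)
  case 0
  show ?case unfolding roll_in.simps
    by (intro measurable_const) (auto simp: space_prob_algebra space_PiM intro!: prob_space_return)
next
  case (Suc n)
  let ?x = "\<lambda>\<tau>. if n = 0 then init_obs M else next_of (\<tau> n)"
  have h: "Suc n \<in> {1..H}" using Suc.prems by simp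
  have x: "?x \<in> PiM {1..n} (\<lambda>_. T) \<rightarrow>\<^sub>M S"
  proof (cases "n = 0")
    case False
    then have "n \<in> {1..n}" by simp
    then show ?thesis by measurable
  qed simp
  have x': "(\<lambda>w. ?x (snd w)) \<in> N \<Otimes>\<^sub>M PiM {1..n} (\<lambda>_. T) \<rightarrow>\<^sub>M S"
    by (rule measurable_compose[OF measurable_snd x])
  have p: "(\<lambda>w. pol (fst w) (Suc n) (?x (snd w))) \<in> N \<Otimes>\<^sub>M PiM {1..n} (\<lambda>_. T) \<rightarrow>\<^sub>M prob_algebra AS"
    using measurable_compose[OF measurable_Pair[OF measurable_fst x'] pol[OF h]]
    by (simp add: split_beta')
  have "(\<lambda>D. roll_in M (pol D) n) \<in> N \<rightarrow>\<^sub>M prob_algebra (PiM {1..n} (\<lambda>_. T))" using Suc by simp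
  moreover have "(\<lambda>(D, \<tau>). distr (step_law M (Suc n) (pol D (Suc n)) (?x \<tau>))
       (PiM {1..Suc n} (\<lambda>_. T)) (\<lambda>s. \<tau>(Suc n := s))) \<in> N \<Otimes>\<^sub>M PiM {1..n} (\<lambda>_. T) \<rightarrow>\<^sub>M prob_algebra (PiM {1..Suc n} (\<lambda>_. T))"
    unfolding split_beta'
  proof (rule measurable_distr_prob_space2[where M = T])
    show "(\<lambda>w. step_law M (Suc n) (pol (fst w) (Suc n)) (?x (snd w))) \<in> N \<Otimes>\<^sub>M PiM {1..n} (\<lambda>_. T) \<rightarrow>\<^sub>M prob_algebra T"
      using step_law_measurable[OF h p x'] by (simp add: step_law_def)
    show "(\<lambda>(w, s). (snd w)(Suc n := s)) \<in> (N \<Otimes>\<^sub>M PiM {1..n} (\<lambda>_. T)) \<Otimes>\<^sub>M T \<rightarrow>\<^sub>M PiM {1..Suc n} (\<lambda>_. T)"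
      unfolding split_beta'
      by (rule measurable_fun_upd[where J = "{1..n}"]) auto
  qed
  ultimately show ?case unfolding roll_in.simps by (rule measurable_bind_prob_space2)
qed

lemma policyD: "\<pi> \<in> policies M \<Longrightarrow> h \<in> {1..H} \<Longrightarrow> \<pi> h \<in> S \<rightarrow>\<^sub>M prob_algebra AS"
  by (simp add: policies_def)

lemma roll_in_in_space:
  assumes "\<pi> \<in> policies M" "n \<le> H"
  shows "roll_in M \<pi> n \<in> space (prob_algebra (PiM {1..n} (\<lambda>_. T)))"
proof -
  have "(\<lambda>D. roll_in M \<pi> n) \<in> count_space (UNIV :: unit set) \<rightarrow>\<^sub>M prob_algebra (PiM {1..n} (\<lambda>_. T))"
    by (rule roll_in_measurable[OF _ assms(2)])
      (auto simp: split_beta' intro!: measurable_compose[OF measurable_snd] policyD assms)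
  from measurable_space[OF this] show ?thesis by simp
qed

lemma prob_space_roll_in: "\<pi> \<in> policies M \<Longrightarrow> n \<le> H \<Longrightarrow> prob_space (roll_in M \<pi> n)"
  and sets_roll_in: "\<pi> \<in> policies M \<Longrightarrow> n \<le> H \<Longrightarrow> sets (roll_in M \<pi> n) = sets (PiM {1..n} (\<lambda>_. T))"
  using roll_in_in_space by (auto simp: space_prob_algebra)

lemma step_kernel_roll_in:
  assumes \<pi>: "\<pi> \<in> policies M" and n: "Suc n \<le> H"
  shows "(\<lambda>\<tau>. if n = 0 then init_obs M else next_of (\<tau> n)) \<in> roll_in M \<pi> n \<rightarrow>\<^sub>M S" (is ?A)
    and "(\<lambda>\<tau>. distr (step_law M (Suc n) (\<pi> (Suc n)) (if n = 0 then init_obs M else next_of (\<tau> n)))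
       (PiM {1..Suc n} (\<lambda>_. T)) (\<lambda>s. \<tau>(Suc n := s))) \<in> roll_in M \<pi> n \<rightarrow>\<^sub>M prob_algebra (PiM {1..Suc n} (\<lambda>_. T))" (is ?B)
proof -
  have h: "Suc n \<in> {1..H}" using n by simp
  let ?x = "\<lambda>\<tau>. if n = 0 then init_obs M else next_of (\<tau> n)"
  have x: "?x \<in> PiM {1..n} (\<lambda>_. T) \<rightarrow>\<^sub>M S"
  proof (cases "n = 0")
    case False
    then have "n \<in> {1..n}" by simp
    then show ?thesis by measurable
  qed simp
  have s: "sets (roll_in M \<pi> n) = sets (PiM {1..n} (\<lambda>_. T))" using sets_roll_in[OF \<pi>, of n] n by simp
  show ?A using x s by (simp cong: measurable_cong_sets)
  have "(\<lambda>\<tau>. distr (step_law M (Suc n) (\<pi> (Suc n)) (?x \<tau>)) (PiM {1..Suc n} (\<lambda>_. T)) (\<lambda>s. \<tau>(Suc n := s)))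
      \<in> PiM {1..n} (\<lambda>_. T) \<rightarrow>\<^sub>M prob_algebra (PiM {1..Suc n} (\<lambda>_. T))"
  proof (rule measurable_distr_prob_space2[where M = T])
    show "(\<lambda>w. step_law M (Suc n) (\<pi> (Suc n)) (?x w)) \<in> PiM {1..n} (\<lambda>_. T) \<rightarrow>\<^sub>M prob_algebra T"
      by (rule measurable_compose[OF x step_law_kernel[OF h policyD[OF \<pi> h]]])
    show "(\<lambda>(w, s). w(Suc n := s)) \<in> PiM {1..n} (\<lambda>_. T) \<Otimes>\<^sub>M T \<rightarrow>\<^sub>M PiM {1..Suc n} (\<lambda>_. T)"
      unfolding split_beta'
      by (rule measurable_fun_upd[where J = "{1..n}"]) auto
  qed
  then show ?B using s by (simp cong: measurable_cong_sets)
qed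

lemma step_law_props:
  assumes "\<pi> \<in> policies M" "h \<in> {1..H}"
  shows "prob_space (step_law M h (\<pi> h) x)" "sets (step_law M h (\<pi> h) x) = sets T"
  using measurable_space[OF step_law_kernel[OF assms(2) policyD[OF assms]], of x]
  by (auto simp: space_prob_algebra)

text \<open>The appended transition is a draw from the step law at the last observation, hence a
  mixture; the earlier coordinates are unchanged, and the appended draw has total mass one.\<close>

lemma distr_roll_in_Suc:
  assumes \<pi>: "\<pi> \<in> policies M" and n: "Suc n \<le> H" and h: "h \<in> {1..Suc n}"
  shows "distr (roll_in M \<pi> (Suc n)) T (\<lambda>\<tau>. \<tau> h) =
    (if h = Suc n then distr (roll_in M \<pi> n) S (\<lambda>\<tau>. if n = 0 then init_obs M else next_of (\<tau> n))
        \<bind> step_law M (Suc n) (\<pi> (Suc n))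
     else distr (roll_in M \<pi> n) T (\<lambda>\<tau>. \<tau> h))"
proof -
  let ?x = "\<lambda>\<tau>. if n = 0 then init_obs M else next_of (\<tau> n)"
  have hn: "Suc n \<in> {1..H}" using n by simp
  have ne: "space (roll_in M \<pi> n) \<noteq> {}"
    using prob_space_roll_in[OF \<pi>, of n] n prob_space.not_empty by simp
  have s: "sets (roll_in M \<pi> n) = sets (PiM {1..n} (\<lambda>_. T))" using sets_roll_in[OF \<pi>, of n] n by simp
  have upd: "(\<lambda>s. \<tau>(Suc n := s)) \<in> step_law M (Suc n) (\<pi> (Suc n)) y \<rightarrow>\<^sub>M PiM {1..Suc n} (\<lambda>_. T)"
    if "\<tau> \<in> space (roll_in M \<pi> n)" for \<tau> y
  proof -
    have "\<tau> \<in> space (PiM {1..n} (\<lambda>_. T))" using that s sets_eq_imp_space_eq by blast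
    then have "(\<lambda>s. \<tau>(Suc n := s)) \<in> T \<rightarrow>\<^sub>M PiM {1..Suc n} (\<lambda>_. T)"
      by (intro measurable_fun_upd[where J = "{1..n}"]) auto
    then show ?thesis using step_law_props(2)[OF \<pi> hn] by (simp cong: measurable_cong_sets)
  qed
  have "distr (roll_in M \<pi> (Suc n)) T (\<lambda>\<tau>. \<tau> h) = roll_in M \<pi> n \<bind> (\<lambda>\<tau>. distr (distr
      (step_law M (Suc n) (\<pi> (Suc n)) (?x \<tau>)) (PiM {1..Suc n} (\<lambda>_. T)) (\<lambda>s. \<tau>(Suc n := s))) T (\<lambda>\<tau>. \<tau> h))"
    unfolding roll_in.simps
    by (rule distr_bind[OF measurable_prob_algebraD[OF step_kernel_roll_in(2)[OF \<pi> n]] ne]) (use h in measurable)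
  also have "\<dots> = roll_in M \<pi> n \<bind> (\<lambda>\<tau>. distr
      (step_law M (Suc n) (\<pi> (Suc n)) (?x \<tau>)) T (\<lambda>s. (\<tau>(Suc n := s)) h))"
  proof (intro bind_cong refl)
    fix \<tau> assume \<tau>: "\<tau> \<in> space (roll_in M \<pi> n)"
    have "(\<lambda>\<tau>. \<tau> h) \<in> PiM {1..Suc n} (\<lambda>_. T) \<rightarrow>\<^sub>M T" using h by measurable
    from distr_distr[OF this upd[OF \<tau>]]
    show "distr (distr (step_law M (Suc n) (\<pi> (Suc n)) (?x \<tau>)) (PiM {1..Suc n} (\<lambda>_. T)) (\<lambda>s. \<tau>(Suc n := s))) T (\<lambda>\<tau>. \<tau> h)
      = distr (step_law M (Suc n) (\<pi> (Suc n)) (?x \<tau>)) T (\<lambda>s. (\<tau>(Suc n := s)) h)"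
      by (simp add: comp_def)
  qed
  also have "\<dots> = (if h = Suc n then distr (roll_in M \<pi> n) S ?x \<bind> step_law M (Suc n) (\<pi> (Suc n))
     else distr (roll_in M \<pi> n) T (\<lambda>\<tau>. \<tau> h))"
  proof (cases "h = Suc n")
    case True
    have "distr (step_law M (Suc n) (\<pi> (Suc n)) y) T (\<lambda>s. s) = step_law M (Suc n) (\<pi> (Suc n)) y" for y
      using step_law_props(2)[OF \<pi> hn, of y] by (metis distr_id2)
    then show ?thesis using True
      by (simp add: bind_distr[OF step_kernel_roll_in(1)[OF \<pi> n]
            measurable_prob_algebraD[OF step_law_kernel[OF hn policyD[OF \<pi> hn]]] ne])
  next
    case False
    have "roll_in M \<pi> n \<bind> (\<lambda>\<tau>. distr (step_law M (Suc n) (\<pi> (Suc n)) (?x \<tau>)) T (\<lambda>s. (\<tau>(Suc n := s)) h)) =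
        roll_in M \<pi> n \<bind> (\<lambda>\<tau>. return T (\<tau> h))"
      using False step_law_props(1)[OF \<pi> hn] by (intro bind_cong refl) (simp add: prob_space.distr_const)
    also have "\<dots> = distr (roll_in M \<pi> n) T (\<lambda>\<tau>. \<tau> h)"
    proof (rule bind_return_distr'[OF ne])
      have "(\<lambda>\<tau>. \<tau> h) \<in> PiM {1..n} (\<lambda>_. T) \<rightarrow>\<^sub>M T"
        by (intro measurable_component_singleton) (use h False in auto)
      then show "(\<lambda>\<tau>. \<tau> h) \<in> roll_in M \<pi> n \<rightarrow>\<^sub>M T" using s by (simp cong: measurable_cong_sets)
    qed
    finally show ?thesis using False by simp
  qed
  finally show ?thesis .
qed

end

section \<open>Laws of single transitions: rolled in and stored\<close>

definition trans_law :: "('x, 'a) mdp \<Rightarrow> ('x, 'a) policy \<Rightarrow> nat \<Rightarrow> ('x, 'a) transition measure" where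
  "trans_law M \<pi> h = distr (episode M \<pi>) (trans_space M) (\<lambda>\<tau>. \<tau> h)"

text \<open>One formula covers both modes of data collection, so concentration is proved once. With
  uniform actions this law differs from \<open>trans_law\<close>, on which the regret
  depends.\<close>

definition data_law :: "('x, 'a::finite) mdp \<Rightarrow> bool \<Rightarrow> ('x, 'a) policy \<Rightarrow> nat \<Rightarrow> ('x, 'a) transition measure" where
  "data_law M ua \<pi> h = obs_law M \<pi> h \<bind> step_law M h (if ua then (\<lambda>_. uniform_count_measure UNIV) else \<pi> h)"

context episodic_mdp begin

lemma distr_roll_in:
  assumes \<pi>: "\<pi> \<in> policies M" and h: "h \<in> {1..n}" and n: "n \<le> H"
  shows "distr (roll_in M \<pi> n) T (\<lambda>\<tau>. \<tau> h) = trans_law M \<pi> h"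
proof -
  have "distr (roll_in M \<pi> m) T (\<lambda>\<tau>. \<tau> h) = distr (roll_in M \<pi> h) T (\<lambda>\<tau>. \<tau> h)" if "h \<le> m" "m \<le> H" for m
    using that
  proof (induction m rule: dec_induct)
    case (step m)
    then show ?case using distr_roll_in_Suc[OF \<pi>, of m h] h by simp
  qed simp
  from this[of n] this[of H] show ?thesis using h n by (simp add: trans_law_def episode_def)
qed

lemma measurable_component_episode:
  assumes "\<pi> \<in> policies M" "h \<in> {1..n}" "n \<le> H"
  shows "(\<lambda>\<tau>. \<tau> h) \<in> roll_in M \<pi> n \<rightarrow>\<^sub>M T"
proof -
  have "(\<lambda>\<tau>. \<tau> h) \<in> PiM {1..n} (\<lambda>_. T) \<rightarrow>\<^sub>M T" using assms by measurable
  then show ?thesis using measurable_cong_sets[OF sets_roll_in[OF assms(1,3)] refl] by blast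
qed

lemma trans_law_in_space:
  assumes "\<pi> \<in> policies M" "h \<in> {1..H}"
  shows "trans_law M \<pi> h \<in> space (prob_algebra T)"
  using prob_space.prob_space_distr[OF prob_space_roll_in[OF assms(1)] measurable_component_episode[OF assms(1,2)]]
  by (simp add: space_prob_algebra trans_law_def episode_def)

lemma distr_trans_law:
  assumes "\<pi> \<in> policies M" "h \<in> {1..H}" and [measurable]: "f \<in> T \<rightarrow>\<^sub>M N"
  shows "distr (trans_law M \<pi> h) N f = distr (episode M \<pi>) N (\<lambda>\<tau>. f (\<tau> h))"
  using distr_distr[OF assms(3) measurable_component_episode[OF assms(1,2) order_refl]]
  by (simp add: trans_law_def episode_def comp_def)

lemma obs_law_eq_distr: "\<pi> \<in> policies M \<Longrightarrow> h \<in> {1..H} \<Longrightarrow> obs_law M \<pi> h = distr (trans_law M \<pi> h) S obs_of"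
  by (simp add: distr_trans_law obs_law_def)

lemma obs_act_law_eq_distr:
  "\<pi> \<in> policies M \<Longrightarrow> h \<in> {1..H} \<Longrightarrow> obs_act_law M \<pi> h = distr (trans_law M \<pi> h) Z (\<lambda>s. (obs_of s, act_of s))"
  by (simp add: distr_trans_law obs_act_law_def)

lemma obs_law_in_space:
  assumes "\<pi> \<in> policies M" "h \<in> {1..H}"
  shows "obs_law M \<pi> h \<in> space (prob_algebra S)"
proof -
  have "trans_law M \<pi> h \<in> space (prob_algebra T)" by (rule trans_law_in_space[OF assms])
  from measurable_space[OF measurable_distr_prob_space[OF obs_of_measurable] this]
  show ?thesis by (simp add: obs_law_eq_distr[OF assms])
qed

lemma mix_in_space:
  assumes "\<nu> \<in> space (prob_algebra S)" "h \<in> {1..H}" "p \<in> S \<rightarrow>\<^sub>M prob_algebra AS"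
  shows "\<nu> \<bind> step_law M h p \<in> space (prob_algebra T)"
  using prob_space_bind'[OF assms(1) step_law_kernel[OF assms(2,3)]] sets_bind'[OF assms(1) step_law_kernel[OF assms(2,3)]]
  by (simp add: space_prob_algebra)

lemma nn_integral_mix:
  assumes \<nu>: "\<nu> \<in> space (prob_algebra S)" and h: "h \<in> {1..H}" and p: "p \<in> S \<rightarrow>\<^sub>M prob_algebra AS"
    and \<phi>: "\<phi> \<in> borel_measurable T"
  shows "(\<integral>\<^sup>+s. \<phi> s \<partial>(\<nu> \<bind> step_law M h p)) =
    (\<integral>\<^sup>+x. (\<integral>\<^sup>+a. (\<integral>\<^sup>+w. \<phi> (x, a, w) \<partial>outcome_law M h (x, a)) \<partial>p x) \<partial>\<nu>)"
proof -
  have s: "sets \<nu> = sets S" using \<nu> by (simp add: space_prob_algebra)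
  have "step_law M h p \<in> \<nu> \<rightarrow>\<^sub>M subprob_algebra T"
    using measurable_prob_algebraD[OF step_law_kernel[OF h p]] measurable_cong_sets[OF s refl] by blast
  then show ?thesis using measurable_space[OF p]
    by (subst nn_integral_bind[OF \<phi>]) (auto intro!: nn_integral_cong nn_integral_step_law h \<phi>)
qed

text \<open>Outcome and action integrate to one at every observation. This is used to recover the
  observation law from the mixture produced by the recursion.\<close>

lemma distr_obs_of_mix:
  assumes \<nu>: "\<nu> \<in> space (prob_algebra S)" and h: "h \<in> {1..H}" and p: "p \<in> S \<rightarrow>\<^sub>M prob_algebra AS"
  shows "distr (\<nu> \<bind> step_law M h p) S obs_of = \<nu>"
proof (rule measure_eqI)
  have s: "sets \<nu> = sets S" using \<nu> by (simp add: space_prob_algebra)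
  then show "sets (distr (\<nu> \<bind> step_law M h p) S obs_of) = sets \<nu>" by simp
  fix A assume "A \<in> sets (distr (\<nu> \<bind> step_law M h p) S obs_of)"
  then have A [measurable]: "A \<in> sets S" by simp
  have st: "sets (\<nu> \<bind> step_law M h p) = sets T"
    using mix_in_space[OF assms] by (simp add: space_prob_algebra)
  have oof: "obs_of \<in> (\<nu> \<bind> step_law M h p) \<rightarrow>\<^sub>M S"
    using obs_of_measurable measurable_cong_sets[OF st refl] by blast
  have "emeasure (distr (\<nu> \<bind> step_law M h p) S obs_of) A = (\<integral>\<^sup>+s. indicator A (obs_of s) \<partial>(\<nu> \<bind> step_law M h p))"
    using nn_integral_distr[OF oof, of "indicator A"] A by simp
  also have "\<dots> = (\<integral>\<^sup>+x. (\<integral>\<^sup>+a. (\<integral>\<^sup>+w. indicator A x \<partial>outcome_law M h (x, a)) \<partial>p x) \<partial>\<nu>)"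
    by (subst nn_integral_mix[OF assms]) (auto simp: obs_of_def)
  also have "\<dots> = (\<integral>\<^sup>+x. indicator A x \<partial>\<nu>)"
  proof (rule nn_integral_cong)
    fix x
    have "prob_space (p x)" using measurable_space[OF p, of x] by (simp add: space_prob_algebra)
    then show "(\<integral>\<^sup>+a. (\<integral>\<^sup>+w. indicator A x \<partial>outcome_law M h (x, a)) \<partial>p x) = indicator A x"
      by (simp add: split_beta' prob_space.emeasure_space_1[OF prob_space_outcome_law[OF h]] prob_space.emeasure_space_1)
  qed
  also have "\<dots> = emeasure \<nu> A" using s A by simp
  finally show "emeasure (distr (\<nu> \<bind> step_law M h p) S obs_of) A = emeasure \<nu> A" .
qed

text \<open>Both laws are defined as marginals of the whole episode. Identifying them with what the
  recursion has produced after n steps makes the Markov structure available.\<close>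

lemma obs_law_Suc_eq_roll_in:
  assumes \<pi>: "\<pi> \<in> policies M" and n: "Suc n \<le> H"
  shows "obs_law M \<pi> (Suc n) = distr (roll_in M \<pi> n) S (\<lambda>\<tau>. if n = 0 then init_obs M else next_of (\<tau> n))" (is "_ = ?\<nu>")
    and "trans_law M \<pi> (Suc n) = obs_law M \<pi> (Suc n) \<bind> step_law M (Suc n) (\<pi> (Suc n))"
proof -
  have h: "Suc n \<in> {1..H}" using n by simp
  have \<nu>: "?\<nu> \<in> space (prob_algebra S)"
    using prob_space.prob_space_distr[OF prob_space_roll_in[OF \<pi>] step_kernel_roll_in(1)[OF \<pi> n]] n
    by (simp add: space_prob_algebra)
  have t: "trans_law M \<pi> (Suc n) = ?\<nu> \<bind> step_law M (Suc n) (\<pi> (Suc n))"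
    using distr_roll_in[OF \<pi>, of "Suc n" "Suc n"] distr_roll_in_Suc[OF \<pi> n, of "Suc n"] n by simp
  show o: "obs_law M \<pi> (Suc n) = ?\<nu>"
    unfolding obs_law_eq_distr[OF \<pi> h] t by (rule distr_obs_of_mix[OF \<nu> h policyD[OF \<pi> h]])
  show "trans_law M \<pi> (Suc n) = obs_law M \<pi> (Suc n) \<bind> step_law M (Suc n) (\<pi> (Suc n))"
    unfolding o t ..
qed

lemma trans_law_eq_bind:
  "\<pi> \<in> policies M \<Longrightarrow> h \<in> {1..H} \<Longrightarrow> trans_law M \<pi> h = obs_law M \<pi> h \<bind> step_law M h (\<pi> h)"
  using obs_law_Suc_eq_roll_in(2)[of \<pi> "h - 1"] by simp

lemma obs_law_1:
  assumes "\<pi> \<in> policies M"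
  shows "obs_law M \<pi> 1 = return S (init_obs M)"
  using obs_law_Suc_eq_roll_in(1)[OF assms, of 0] H_ge_1 prob_space_roll_in[OF assms, of 0]
  by (simp add: prob_space.distr_const)

lemma obs_law_Suc:
  assumes "\<pi> \<in> policies M" "h \<in> {1..<H}"
  shows "obs_law M \<pi> (Suc h) = distr (trans_law M \<pi> h) S next_of"
proof -
  have "(\<lambda>\<tau>. \<tau> h) \<in> roll_in M \<pi> h \<rightarrow>\<^sub>M T" using assms by (intro measurable_component_episode) auto
  from distr_distr[OF next_of_measurable this]
  show ?thesis
    using obs_law_Suc_eq_roll_in(1)[OF assms(1), of h] distr_roll_in[OF assms(1), of h h] assms(2)
    by (simp add: comp_def)
qed

text \<open>The observation at step h is drawn before the action at h, so a policy may be altered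
  from step h on. This justifies the uniform action at h.\<close>

lemma obs_law_cong:
  assumes "\<pi> \<in> policies M" "\<pi>' \<in> policies M" "h \<in> {1..H}" and eq: "\<And>j. j < h \<Longrightarrow> \<pi> j = \<pi>' j"
  shows "obs_law M \<pi> h = obs_law M \<pi>' h"
proof -
  obtain n where n: "h = Suc n" using assms(3) by (cases h) auto
  have "roll_in M \<pi> m = roll_in M \<pi>' m" if "m < h" for m
    using that by (induction m) (simp_all add: eq)
  then show ?thesis
    using obs_law_Suc_eq_roll_in(1)[OF assms(1), of n] obs_law_Suc_eq_roll_in(1)[OF assms(2), of n] n assms(3) by simp
qed

lemma uniform_in_space: "uniform_count_measure (UNIV :: 'a set) \<in> space (prob_algebra AS)"
  by (simp add: space_prob_algebra prob_space_uniform_count_measure sets_uniform_count_measure)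

lemma roll_in_policy_kernel:
  assumes "\<pi> \<in> policies M" "h \<in> {1..H}"
  shows "(if ua then (\<lambda>_. uniform_count_measure UNIV) else \<pi> h) \<in> S \<rightarrow>\<^sub>M prob_algebra AS"
  using policyD[OF assms] uniform_in_space by (cases ua) auto

lemma data_law_in_space:
  assumes "\<pi> \<in> policies M" "h \<in> {1..H}"
  shows "data_law M ua \<pi> h \<in> space (prob_algebra T)"
  unfolding data_law_def by (intro mix_in_space obs_law_in_space roll_in_policy_kernel assms)

text \<open>
  The targets are normalised along episodes only. With uniform actions, the stored transitions come from
  episodes of a modified policy.
\<close>

lemma data_law_eq_trans_law:
  assumes \<pi>: "\<pi> \<in> policies M" and h: "h \<in> {1..H}"
  obtains \<pi>' where "\<pi>' \<in> policies M" "data_law M ua \<pi> h = trans_law M \<pi>' h"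
proof -
  define \<pi>' where "\<pi>' = \<pi>(h := if ua then (\<lambda>_. uniform_count_measure UNIV) else \<pi> h)"
  have \<pi>': "\<pi>' \<in> policies M"
    using \<pi> roll_in_policy_kernel[OF \<pi> h, of ua] by (auto simp: \<pi>'_def policies_def)
  have "obs_law M \<pi>' h = obs_law M \<pi> h" by (intro obs_law_cong \<pi> \<pi>' h) (simp add: \<pi>'_def)
  moreover have "\<pi>' h = (if ua then (\<lambda>_. uniform_count_measure UNIV) else \<pi> h)" by (simp add: \<pi>'_def)
  ultimately have "data_law M ua \<pi> h = trans_law M \<pi>' h"
    by (simp add: data_law_def trans_law_eq_bind[OF \<pi>' h])
  with \<pi>' that show ?thesis by blast
qed

lemma distr_collect_law:
  assumes \<pi>: "\<pi> \<in> policies M" and h: "h \<in> {1..H}"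
  shows "distr (collect_law M ua \<pi>) T (\<lambda>d. d h) = data_law M ua \<pi> h"
proof (cases ua)
  case True
  \<comment> \<open>The point mass is a filler: the product locale asks for a probability measure at
    every index, also outside \<open>{1..H}\<close>.\<close>
  define \<kappa> where "\<kappa> j = (if j \<in> {1..H} then data_law M ua \<pi> j else return T undefined)" for j
  have "prob_space (\<kappa> j)" for j
    using data_law_in_space[OF \<pi>, of j ua] by (auto simp: \<kappa>_def space_prob_algebra intro!: prob_space_return)
  then interpret product_prob_space \<kappa> "{1..H}"
    by (simp add: product_prob_space_def product_prob_space_axioms_def product_sigma_finite_def prob_space_imp_sigma_finite)
  have "collect_law M ua \<pi> = PiM {1..H} \<kappa>"
    using True by (auto simp: collect_law_def data_law_def \<kappa>_def intro!: PiM_cong)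
  moreover have "distr (PiM {1..H} \<kappa>) (\<kappa> h) (\<lambda>d. d h) = \<kappa> h"
    using h by (rule PiM_component)
  moreover have "sets (\<kappa> h) = sets T" using data_law_in_space[OF \<pi> h, of ua] h by (simp add: \<kappa>_def space_prob_algebra)
  ultimately show ?thesis using h by (simp add: \<kappa>_def cong: distr_cong)
next
  case False
  then show ?thesis using trans_law_eq_bind[OF \<pi> h]
    by (simp add: collect_law_def data_law_def trans_law_def)
qed

lemma collect_law_in_space:
  assumes \<pi>: "\<pi> \<in> policies M"
  shows "collect_law M ua \<pi> \<in> space (prob_algebra (round_space M))"
proof (cases ua)
  case True
  have *: "obs_law M \<pi> j \<bind> step_law M j (\<lambda>_. uniform_count_measure UNIV) \<in> space (prob_algebra T)" if "j \<in> {1..H}" for j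
    using data_law_in_space[OF \<pi> that, of True] by (simp add: data_law_def)
  then have "prob_space (PiM {1..H} (\<lambda>h. obs_law M \<pi> h \<bind> step_law M h (\<lambda>_. uniform_count_measure UNIV)))"
    by (intro prob_space_PiM) (auto simp: space_prob_algebra)
  moreover have "sets (PiM {1..H} (\<lambda>h. obs_law M \<pi> h \<bind> step_law M h (\<lambda>_. uniform_count_measure UNIV))) = sets (round_space M)"
    using * by (intro sets_PiM_cong) (auto simp: space_prob_algebra)
  ultimately show ?thesis using True by (simp add: collect_law_def space_prob_algebra)
next
  case False
  then show ?thesis using roll_in_in_space[OF \<pi>, of H] by (simp add: collect_law_def episode_def)
qed

end

section \<open>Measurable dependence on the history\<close>

lemma measurable_PiM_kernel:
  assumes I: "finite I" and \<kappa>: "\<And>i. i \<in> I \<Longrightarrow> (\<lambda>w. \<kappa> w i) \<in> W \<rightarrow>\<^sub>M prob_algebra (N i)"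
  shows "(\<lambda>w. PiM I (\<kappa> w)) \<in> W \<rightarrow>\<^sub>M prob_algebra (PiM I N)"
proof (rule measurable_prob_algebra_generated[OF sets_PiM Int_stable_prod_algebra prod_algebra_sets_into_space])
  have \<kappa>w: "sets (\<kappa> w i) = sets (N i)" "prob_space (\<kappa> w i)" if "w \<in> space W" "i \<in> I" for w i
    using measurable_space[OF \<kappa>[OF that(2)] that(1)] by (auto simp: space_prob_algebra)
  show "prob_space (PiM I (\<kappa> w))" "sets (PiM I (\<kappa> w)) = sets (PiM I N)" if "w \<in> space W" for w
    using \<kappa>w that by (auto intro!: prob_space_PiM sets_PiM_cong)
  fix A assume "A \<in> prod_algebra I N"
  then obtain X where X: "A = (\<Pi>\<^sub>E i\<in>I. X i)" "\<And>i. i \<in> I \<Longrightarrow> X i \<in> sets (N i)"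
    unfolding prod_algebra_eq_finite[OF I] by auto
  \<comment> \<open>Boxes generate the product sigma-algebra and are closed under intersection, so
    they suffice; on a box the measure is a finite product of measurable functions of w.\<close>
  have "emeasure (PiM I (\<kappa> w)) A = (\<Prod>i\<in>I. emeasure (\<kappa> w i) (X i))" if w: "w \<in> space W" for w
  proof -
    define \<kappa>' where "\<kappa>' i = (if i \<in> I then \<kappa> w i else count_space {undefined})" for i
    have "sigma_finite_measure (\<kappa>' i)" for i
      using \<kappa>w[OF w, of i] by (auto simp: \<kappa>'_def prob_space_imp_sigma_finite intro!: sigma_finite_measure_count_space_finite)
    then interpret product_sigma_finite \<kappa>' by (simp add: product_sigma_finite_def)
    have "PiM I (\<kappa> w) = PiM I \<kappa>'" by (intro PiM_cong) (auto simp: \<kappa>'_def)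
    then show ?thesis
      using X \<kappa>w[OF w] emeasure_PiM[OF I, of X] by (auto simp: \<kappa>'_def intro!: prod.cong)
  qed
  moreover have "(\<lambda>w. \<Prod>i\<in>I. emeasure (\<kappa> w i) (X i)) \<in> borel_measurable W"
    using X(2) measurable_prob_algebraD[OF \<kappa>]
    by (intro borel_measurable_prod_ennreal measurable_compose[OF measurable_prob_algebraD[OF \<kappa>] measurable_emeasure_subprob_algebra]) auto
  ultimately show "(\<lambda>w. emeasure (PiM I (\<kappa> w)) A) \<in> borel_measurable W"
    by (simp cong: measurable_cong)
qed

context episodic_mdp begin

lemma obs_law_measurable:
  assumes pol: "\<And>h. h \<in> {1..H} \<Longrightarrow> (\<lambda>(D, x). pol D h x) \<in> N \<Otimes>\<^sub>M S \<rightarrow>\<^sub>M prob_algebra AS"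
    and h: "h \<in> {1..H}"
  shows "(\<lambda>D. obs_law M (pol D) h) \<in> N \<rightarrow>\<^sub>M prob_algebra S"
  unfolding obs_law_def episode_def
proof (rule measurable_compose[OF roll_in_measurable[OF pol order_refl] measurable_distr_prob_space])
  have "(\<lambda>\<tau>. \<tau> h) \<in> PiM {1..H} (\<lambda>_. T) \<rightarrow>\<^sub>M T" using h by measurable
  from measurable_compose[OF this obs_of_measurable]
  show "(\<lambda>\<tau>. obs_of (\<tau> h)) \<in> PiM {1..H} (\<lambda>_. T) \<rightarrow>\<^sub>M S" .
qed

lemma data_law_measurable:
  assumes pol: "\<And>h. h \<in> {1..H} \<Longrightarrow> (\<lambda>(D, x). pol D h x) \<in> N \<Otimes>\<^sub>M S \<rightarrow>\<^sub>M prob_algebra AS"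
    and h: "h \<in> {1..H}"
  shows "(\<lambda>D. data_law M ua (pol D) h) \<in> N \<rightarrow>\<^sub>M prob_algebra T"
  unfolding data_law_def
proof (rule measurable_bind_prob_space2[OF obs_law_measurable[OF pol h]])
  let ?p = "\<lambda>w. if ua then uniform_count_measure UNIV else pol (fst w) h (snd w)"
  have "?p \<in> N \<Otimes>\<^sub>M S \<rightarrow>\<^sub>M prob_algebra AS"
    using pol[OF h] uniform_in_space by (cases ua) (auto simp: split_beta')
  from step_law_measurable[OF h this measurable_snd]
  show "(\<lambda>(D, x). step_law M h (if ua then (\<lambda>_. uniform_count_measure UNIV) else pol D h) x) \<in> N \<Otimes>\<^sub>M S \<rightarrow>\<^sub>M prob_algebra T"
    by (cases ua) (simp_all add: split_beta' step_law_def)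
qed

lemma collect_law_measurable:
  assumes pol: "\<And>h. h \<in> {1..H} \<Longrightarrow> (\<lambda>(D, x). pol D h x) \<in> N \<Otimes>\<^sub>M S \<rightarrow>\<^sub>M prob_algebra AS"
  shows "(\<lambda>D. collect_law M ua (pol D)) \<in> N \<rightarrow>\<^sub>M prob_algebra (round_space M)"
proof (cases ua)
  case True
  have "(\<lambda>D. PiM {1..H} (\<lambda>h. data_law M True (pol D) h)) \<in> N \<rightarrow>\<^sub>M prob_algebra (round_space M)"
    by (intro measurable_PiM_kernel data_law_measurable pol) auto
  then show ?thesis using True by (simp add: collect_law_def data_law_def)
next
  case False
  then show ?thesis using roll_in_measurable[OF pol order_refl] by (simp add: collect_law_def episode_def)
qed

lemma policy_value_measurable:
  assumes pol: "\<And>h. h \<in> {1..H} \<Longrightarrow> (\<lambda>(D, x). pol D h x) \<in> N \<Otimes>\<^sub>M S \<rightarrow>\<^sub>M prob_algebra AS"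
  shows "(\<lambda>D. policy_value M (pol D)) \<in> borel_measurable N"
  unfolding policy_value_def episode_def
proof (rule measurable_compose[OF measurable_prob_algebraD[OF roll_in_measurable[OF pol order_refl]]
      integral_measurable_subprob_algebra])
  show "(\<lambda>\<tau>. \<Sum>h=1..H. cost_of (\<tau> h)) \<in> borel_measurable (PiM {1..H} (\<lambda>_. T))"
  proof (rule borel_measurable_sum)
    fix h assume "h \<in> {1..H}"
    then have "(\<lambda>\<tau>. \<tau> h) \<in> PiM {1..H} (\<lambda>_. T) \<rightarrow>\<^sub>M T" by measurable
    from measurable_compose[OF this cost_of_measurable]
    show "(\<lambda>\<tau>. cost_of (\<tau> h)) \<in> borel_measurable (PiM {1..H} (\<lambda>_. T))" .
  qed
qed

end

section \<open>The law of a run and Ville's inequality\<close>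

locale algorithm_run = episodic_mdp M for M :: "('x, 'a::finite) mdp" +
  fixes act :: "nat \<Rightarrow> ('x, 'a) history \<Rightarrow> nat \<Rightarrow> 'x \<Rightarrow> 'a" and K :: nat and ua :: bool
  assumes act_measurable: "\<And>k h. k \<in> {1..K} \<Longrightarrow> h \<in> {1..H} \<Longrightarrow>
    (\<lambda>(D, x). act k D h x) \<in> history_space M k \<Otimes>\<^sub>M S \<rightarrow>\<^sub>M AS"
begin

abbreviation "pol \<equiv> played_policy act"

text \<open>The policy of round i as a function of a history of any greater length. Cutting the
  history back makes it insensitive to rounds added later.\<close>

definition pol_at :: "nat \<Rightarrow> ('x, 'a) history \<Rightarrow> ('x, 'a) policy" where
  "pol_at i D = pol i (restrict D {1..<i})"

lemma restrict_measurable: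
  assumes "i \<le> n"
  shows "(\<lambda>D. restrict D {1..<i}) \<in> history_space M n \<rightarrow>\<^sub>M history_space M i"
  using assms by (intro measurable_restrict_subset') auto

lemma pol_kernel:
  assumes "k \<in> {1..K}" "h \<in> {1..H}"
  shows "(\<lambda>(D, x). pol k D h x) \<in> history_space M k \<Otimes>\<^sub>M S \<rightarrow>\<^sub>M prob_algebra AS"
  using measurable_compose[OF act_measurable[OF assms] measurable_return_prob_space]
  by (simp add: played_policy_def split_beta')

lemma pol_at_kernel:
  assumes k: "k \<in> {1..K}" "k \<le> n" and h: "h \<in> {1..H}"
  shows "(\<lambda>(D, x). pol_at k D h x) \<in> history_space M n \<Otimes>\<^sub>M S \<rightarrow>\<^sub>M prob_algebra AS"
proof -
  have "(\<lambda>w. restrict (fst w) {1..<k}) \<in> history_space M n \<Otimes>\<^sub>M S \<rightarrow>\<^sub>M history_space M k"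
    by (rule measurable_compose[OF measurable_fst restrict_measurable[OF k(2)]])
  from measurable_compose[OF measurable_Pair[OF this measurable_snd] pol_kernel[OF k(1) h]]
  show ?thesis by (simp add: pol_at_def split_beta')
qed

lemma pol_in_policies:
  assumes "k \<in> {1..K}" "D \<in> space (history_space M k)"
  shows "pol k D \<in> policies M"
  unfolding policies_def
proof (intro CollectI ballI)
  fix h assume h: "h \<in> {1..H}"
  show "pol k D h \<in> S \<rightarrow>\<^sub>M prob_algebra AS"
    using measurable_compose[OF measurable_Pair1'[OF assms(2)] pol_kernel[OF assms(1) h]] by simp
qed

lemma restrict_in_history:
  "D \<in> space (history_space M n) \<Longrightarrow> i \<le> n \<Longrightarrow> restrict D {1..<i} \<in> space (history_space M i)"
  using measurable_space[OF restrict_measurable] by blast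

lemma pol_at_in_policies:
  "k \<in> {1..K} \<Longrightarrow> k \<le> n \<Longrightarrow> D \<in> space (history_space M n) \<Longrightarrow> pol_at k D \<in> policies M"
  unfolding pol_at_def by (intro pol_in_policies restrict_in_history)

lemma restrict_history_id: "D \<in> space (history_space M n) \<Longrightarrow> restrict D {1..<n} = D"
  by (auto simp: space_PiM PiE_restrict)

lemma pol_at_self: "D \<in> space (history_space M k) \<Longrightarrow> pol_at k D = pol k D"
  by (simp only: pol_at_def restrict_history_id)

text \<open>Predictability: the policy of round i reads rounds strictly before i, so even round i
  itself may be overwritten.\<close>

lemma pol_at_upd: "i \<le> n \<Longrightarrow> pol_at i (D(n := d)) = pol_at i D"
  unfolding pol_at_def by (rule arg_cong[of _ _ "pol i"]) (auto simp: restrict_def fun_eq_iff)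

section \<open>The run as an iterated kernel\<close>

lemma append_round_measurable:
  "(\<lambda>(D, d). D(Suc n := d)) \<in> history_space M (Suc n) \<Otimes>\<^sub>M round_space M \<rightarrow>\<^sub>M history_space M (Suc (Suc n))"
  unfolding split_beta'
  by (rule measurable_fun_upd[where J = "{1..<Suc n}"]) auto

lemma append_round_measurable_section:
  "D \<in> space (history_space M (Suc n)) \<Longrightarrow> (\<lambda>d. D(Suc n := d)) \<in> round_space M \<rightarrow>\<^sub>M history_space M (Suc (Suc n))"
  by (rule measurable_fun_upd[where J = "{1..<Suc n}"]) auto

lemma run_kernel:
  assumes "n < K"
  shows "(\<lambda>D. distr (collect_law M ua (pol (Suc n) D)) (history_space M (Suc (Suc n))) (\<lambda>d. D(Suc n := d)))
    \<in> history_space M (Suc n) \<rightarrow>\<^sub>M prob_algebra (history_space M (Suc (Suc n)))"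
proof (rule measurable_distr_prob_space2[where M = "round_space M"])
  show "(\<lambda>D. collect_law M ua (pol (Suc n) D)) \<in> history_space M (Suc n) \<rightarrow>\<^sub>M prob_algebra (round_space M)"
    using assms by (intro collect_law_measurable pol_kernel) auto
qed (rule append_round_measurable)

lemma run_law_in_space:
  "n \<le> K \<Longrightarrow> run_law M ua act n \<in> space (prob_algebra (history_space M (Suc n)))"
proof (induction n)
  case 0
  show ?case by (auto simp: space_prob_algebra space_PiM intro!: prob_space_return)
next
  case (Suc n)
  then show ?case
    using prob_space_bind'[OF _ run_kernel[of n]] sets_bind'[OF _ run_kernel[of n]]
    by (simp add: space_prob_algebra)
qed

lemma sets_run_law: "n \<le> K \<Longrightarrow> sets (run_law M ua act n) = sets (history_space M (Suc n))"
  and prob_space_run_law: "n \<le> K \<Longrightarrow> prob_space (run_law M ua act n)"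
  using run_law_in_space by (auto simp: space_prob_algebra)

lemma space_run_law: "n \<le> K \<Longrightarrow> space (run_law M ua act n) = space (history_space M (Suc n))"
  using sets_run_law by (rule sets_eq_imp_space_eq)

lemma nn_integral_run_law_Suc:
  assumes n: "n < K" and \<phi>: "\<phi> \<in> borel_measurable (history_space M (Suc (Suc n)))"
  shows "(\<integral>\<^sup>+D. \<phi> D \<partial>run_law M ua act (Suc n)) =
    (\<integral>\<^sup>+D. (\<integral>\<^sup>+d. \<phi> (D(Suc n := d)) \<partial>collect_law M ua (pol (Suc n) D)) \<partial>run_law M ua act n)"
proof -
  have s: "sets (run_law M ua act n) = sets (history_space M (Suc n))" using n sets_run_law by simp
  have k: "(\<lambda>D. distr (collect_law M ua (pol (Suc n) D)) (history_space M (Suc (Suc n))) (\<lambda>d. D(Suc n := d)))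
    \<in> run_law M ua act n \<rightarrow>\<^sub>M subprob_algebra (history_space M (Suc (Suc n)))"
    using measurable_prob_algebraD[OF run_kernel[OF n]] measurable_cong_sets[OF s refl] by blast
  show ?thesis
    unfolding run_law.simps nn_integral_bind[OF \<phi> k]
  proof (rule nn_integral_cong)
    fix D assume "D \<in> space (run_law M ua act n)"
    then have D: "D \<in> space (history_space M (Suc n))" using n by (simp add: space_run_law)
    then have "sets (collect_law M ua (pol (Suc n) D)) = sets (round_space M)"
      using collect_law_in_space[OF pol_in_policies[OF _ D]] n by (simp add: space_prob_algebra)
    then have "(\<lambda>d. D(Suc n := d)) \<in> collect_law M ua (pol (Suc n) D) \<rightarrow>\<^sub>M history_space M (Suc (Suc n))"
      using append_round_measurable_section[OF D] measurable_cong_sets by blast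
    then show "(\<integral>\<^sup>+D. \<phi> D \<partial>distr (collect_law M ua (pol (Suc n) D)) (history_space M (Suc (Suc n))) (\<lambda>d. D(Suc n := d)))
      = (\<integral>\<^sup>+d. \<phi> (D(Suc n := d)) \<partial>collect_law M ua (pol (Suc n) D))"
      using \<phi> by (simp add: nn_integral_distr)
  qed
qed

text \<open>
  Stop the supermartingale, and replace it by \<open>1\<close>, as soon as it exceeds \<open>1\<close>.
\<close>

lemma maximal_inequality:
  fixes W :: "nat \<Rightarrow> ('x, 'a) history \<Rightarrow> ennreal"
  assumes meas: "\<And>j n. j \<le> n \<Longrightarrow> n \<le> K \<Longrightarrow> W j \<in> borel_measurable (history_space M (Suc n))"
    and adapted: "\<And>j n D d. j \<le> n \<Longrightarrow> W j (D(Suc n := d)) = W j D"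
    and super: "\<And>n D. n < K \<Longrightarrow> D \<in> space (history_space M (Suc n)) \<Longrightarrow>
       (\<integral>\<^sup>+d. W (Suc n) (D(Suc n := d)) \<partial>collect_law M ua (pol (Suc n) D)) \<le> W n D"
  shows "emeasure (run_law M ua act K) {D \<in> space (run_law M ua act K). \<exists>j\<le>K. W j D > 1} \<le> W 0 (\<lambda>_. undefined)"
proof -
  define U where "U n D = (if \<exists>j\<le>n. W j D > 1 then 1 else W n D)" for n D
  have U_meas: "U n \<in> borel_measurable (history_space M (Suc n))" if "n \<le> K" for n
  proof -
    have *: "Measurable.pred (history_space M (Suc n)) (\<lambda>D. \<exists>j\<in>{..n}. W j D > 1)"
    proof (rule pred_intros_finite)
      fix j assume "j \<in> {..n}"
      then have [measurable]: "W j \<in> borel_measurable (history_space M (Suc n))" using meas that by simp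
      show "Measurable.pred (history_space M (Suc n)) (\<lambda>D. W j D > 1)" by measurable
    qed simp
    then have "{D \<in> space (history_space M (Suc n)). \<exists>j\<le>n. W j D > 1} \<in> sets (history_space M (Suc n))"
      by (simp only: Bex_def atMost_iff pred_def)
    moreover have "W n \<in> borel_measurable (history_space M (Suc n))" by (rule meas[OF order_refl that])
    ultimately have "(\<lambda>D. if \<exists>j\<le>n. W j D > 1 then 1 else W n D) \<in> borel_measurable (history_space M (Suc n))"
      by (intro measurable_If borel_measurable_const)
    moreover have "U n = (\<lambda>D. if \<exists>j\<le>n. W j D > 1 then 1 else W n D)" by (rule ext) (simp only: U_def)
    ultimately show ?thesis by (simp only:)
  qed
  have "(\<integral>\<^sup>+D. U n D \<partial>run_law M ua act n) \<le> W 0 (\<lambda>_. undefined)" if "n \<le> K" for n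
    using that
  proof (induction n)
    case 0
    have "(\<integral>\<^sup>+D. U 0 D \<partial>run_law M ua act 0) = U 0 (\<lambda>_. undefined)"
      unfolding run_law.simps
    proof (rule nn_integral_return)
      show "U 0 \<in> borel_measurable (history_space M 1)" using U_meas[of 0] unfolding One_nat_def by blast
    qed (simp add: space_PiM)
    then show ?case by (auto simp: U_def)
  next
    case (Suc n)
    then have n: "n < K" by simp
    have "(\<integral>\<^sup>+D. U (Suc n) D \<partial>run_law M ua act (Suc n)) =
        (\<integral>\<^sup>+D. (\<integral>\<^sup>+d. U (Suc n) (D(Suc n := d)) \<partial>collect_law M ua (pol (Suc n) D)) \<partial>run_law M ua act n)"
      by (rule nn_integral_run_law_Suc[OF n U_meas[OF Suc.prems]])
    also have "\<dots> \<le> (\<integral>\<^sup>+D. U n D \<partial>run_law M ua act n)"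
    proof (rule nn_integral_mono)
      fix D assume "D \<in> space (run_law M ua act n)"
      then have D: "D \<in> space (history_space M (Suc n))" using n by (simp add: space_run_law)
      have ps: "prob_space (collect_law M ua (pol (Suc n) D))"
        using collect_law_in_space[OF pol_in_policies[OF _ D]] n by (simp add: space_prob_algebra)
      show "(\<integral>\<^sup>+d. U (Suc n) (D(Suc n := d)) \<partial>collect_law M ua (pol (Suc n) D)) \<le> U n D"
      proof (cases "\<exists>j\<le>n. W j D > 1")
        case True
        then have "\<exists>j\<le>Suc n. W j (D(Suc n := d)) > 1" for d using adapted by (metis le_Suc_eq)
        then show ?thesis using True by (simp add: U_def prob_space.emeasure_space_1[OF ps])
      next
        case False
        \<comment> \<open>If \<open>W\<close> first exceeds 1 in this round, \<open>U\<close> is 1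
          and thus smaller; otherwise the two agree.\<close>
        have "U (Suc n) (D(Suc n := d)) \<le> W (Suc n) (D(Suc n := d))" for d
          using False adapted[of _ n D d] by (auto simp: U_def le_Suc_eq)
        then have "(\<integral>\<^sup>+d. U (Suc n) (D(Suc n := d)) \<partial>collect_law M ua (pol (Suc n) D)) \<le>
            (\<integral>\<^sup>+d. W (Suc n) (D(Suc n := d)) \<partial>collect_law M ua (pol (Suc n) D))"
          by (rule nn_integral_mono)
        also have "\<dots> \<le> W n D" by (rule super[OF n D])
        also have "W n D = U n D" using False by (simp only: U_def if_False)
        finally show ?thesis .
      qed
    qed
    also have "\<dots> \<le> W 0 (\<lambda>_. undefined)" using Suc by simp
    finally show ?case .
  qed
  note UK = this[OF order_refl]
  have "emeasure (run_law M ua act K) {D \<in> space (run_law M ua act K). \<exists>j\<le>K. W j D > 1}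
      = (\<integral>\<^sup>+D. indicator {D \<in> space (run_law M ua act K). \<exists>j\<le>K. W j D > 1} D \<partial>run_law M ua act K)"
  proof (rule nn_integral_indicator[symmetric])
    have "Measurable.pred (history_space M (Suc K)) (\<lambda>D. \<exists>j\<in>{..K}. W j D > 1)"
    proof (rule pred_intros_finite)
      fix j assume "j \<in> {..K}"
      then have [measurable]: "W j \<in> borel_measurable (history_space M (Suc K))" using meas by simp
      show "Measurable.pred (history_space M (Suc K)) (\<lambda>D. W j D > 1)" by measurable
    qed simp
    then show "{D \<in> space (run_law M ua act K). \<exists>j\<le>K. W j D > 1} \<in> sets (run_law M ua act K)"
      unfolding space_run_law[OF order_refl] sets_run_law[OF order_refl]
      by (simp only: Bex_def atMost_iff pred_def)
  qed
  also have "\<dots> \<le> (\<integral>\<^sup>+D. U K D \<partial>run_law M ua act K)"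
    by (intro nn_integral_mono) (auto simp: U_def split: split_indicator)
  finally show ?thesis using UK by simp
qed

lemma regret_measurable: "regret M act K \<in> borel_measurable (history_space M (Suc K))"
proof -
  have "(\<lambda>D. policy_value M (pol_at k D)) \<in> borel_measurable (history_space M (Suc K))" if "k \<in> {1..K}" for k
    using that by (intro policy_value_measurable pol_at_kernel) auto
  then show ?thesis
    unfolding regret_def pol_at_def[symmetric] by (intro borel_measurable_sum borel_measurable_diff) auto
qed

end

section \<open>Likelihood ratios and the cross-entropy loss\<close>

text \<open>
  Affine majorant in \<open>y\<close> of \<open>exp ((bce_loss p y - bce_loss q y) / 2)\<close>. As division by zero yields
  zero, it has the right mean also for \<open>p = 0\<close> and \<open>p = 1\<close>.
\<close>

definition lr_bound :: "real \<Rightarrow> real \<Rightarrow> real \<Rightarrow> real" where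
  "lr_bound p q y = y * sqrt (q / p) + (1 - y) * sqrt ((1 - q) / (1 - p))"

text \<open>For a prediction and a target in [0,1], this says that the cross-entropy loss is finite.
  It holds almost surely when p is the mean of the target, but may fail for other
  predictions.\<close>

definition compatible :: "real \<Rightarrow> real \<Rightarrow> bool" where
  "compatible p y \<longleftrightarrow> y \<in> {0..1} \<and> (p = 0 \<longrightarrow> y = 0) \<and> (p = 1 \<longrightarrow> y = 1)"

text \<open>On compatible pairs the real logarithm with \<open>ln 0 = 0\<close> gives the right
  loss, since the term in question has coefficient 0.\<close>

definition bce_real :: "real \<Rightarrow> real \<Rightarrow> real" where
  "bce_real u y = - (y * ln u) - (1 - y) * ln (1 - u)"

lemma mult_sqrt_divide: "0 \<le> p \<Longrightarrow> 0 \<le> q \<Longrightarrow> p * sqrt (q / p) = sqrt (q * p)"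
  by (cases "p = 0") (auto simp: real_sqrt_divide real_sqrt_mult real_div_sqrt field_simps)

text \<open>\<open>lr_bound\<close> is affine in the target, so only the mean of the target matters
  and the result is the Hellinger affinity of the two Bernoulli laws. For compatibility, a variable
  in [0,1] with mean 0 or 1 is almost surely constant.\<close>

lemma (in prob_space) lr_bound_mean:
  assumes Y [measurable]: "Y \<in> borel_measurable M" and AE: "AE \<omega> in M. Y \<omega> \<in> {0..1}" and q: "q \<in> {0..1}"
    and p: "p = expectation Y"
  shows "(\<integral>\<^sup>+\<omega>. ennreal (lr_bound p q (Y \<omega>)) \<partial>M) = ennreal (1 - hellinger_ber q p)"
    and "AE \<omega> in M. compatible p (Y \<omega>)"
proof -
  have int: "integrable M Y" using AE by (intro integrable_const_bound[of _ 1]) auto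
  have p01: "p \<in> {0..1}"
    using AE integral_mono_AE[OF int, of "\<lambda>_. 1"] by (auto simp: p prob_space intro!: integral_nonneg_AE)
  have "(\<integral>\<^sup>+\<omega>. ennreal (lr_bound p q (Y \<omega>)) \<partial>M) = ennreal (\<integral>\<omega>. lr_bound p q (Y \<omega>) \<partial>M)"
    using p01 q AE int unfolding lr_bound_def
    by (intro nn_integral_eq_integral) (auto intro!: add_nonneg_nonneg mult_nonneg_nonneg)
  also have "(\<integral>\<omega>. lr_bound p q (Y \<omega>) \<partial>M) = p * sqrt (q / p) + (1 - p) * sqrt ((1 - q) / (1 - p))"
    using int unfolding lr_bound_def by (simp add: p prob_space)
  also have "\<dots> = 1 - hellinger_ber q p"
    using p01 q by (simp add: hellinger_ber_eq mult_sqrt_divide)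
  finally show "(\<integral>\<^sup>+\<omega>. ennreal (lr_bound p q (Y \<omega>)) \<partial>M) = ennreal (1 - hellinger_ber q p)" .
  have "AE \<omega> in M. p = 0 \<longrightarrow> Y \<omega> = 0"
    using integral_nonneg_eq_0_iff_AE[OF int] AE by (cases "p = 0") (auto simp: p)
  moreover have "AE \<omega> in M. p = 1 \<longrightarrow> Y \<omega> = 1"
  proof (cases "p = 1")
    case True
    then have "(\<integral>\<omega>. 1 - Y \<omega> \<partial>M) = 0" using int by (simp add: p prob_space)
    then show ?thesis using integral_nonneg_eq_0_iff_AE[of M "\<lambda>\<omega>. 1 - Y \<omega>"] int AE by auto
  qed simp
  ultimately show "AE \<omega> in M. compatible p (Y \<omega>)"
    using AE by eventually_elim (simp add: compatible_def)
qed

lemma bce_loss_eq: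
  assumes "u \<in> {0..1}" "y \<in> {0..1}"
  shows "bce_loss u y = (if compatible u y then ereal (bce_real u y) else \<infinity>)"
proof -
  consider "u = 0" | "u = 1" | "u \<noteq> 0" "u \<noteq> 1" by blast
  then show ?thesis
  proof cases
    case 1
    then show ?thesis using assms
      by (cases "y = 0") (auto simp: bce_loss_def ln_ext_def compatible_def bce_real_def)
  next
    case 2
    then show ?thesis using assms
      by (cases "y = 1") (auto simp: bce_loss_def ln_ext_def compatible_def bce_real_def zero_ereal_def[symmetric])
  next
    case 3
    then show ?thesis using assms
      by (auto simp: bce_loss_def ln_ext_def compatible_def bce_real_def)
  qed
qed

text \<open>Half the loss difference is the average, with weights y and 1 - y, of the logarithms of
  the two roots in \<open>lr_bound\<close>; concavity moves the logarithm outside. The cases y = 0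
  and y = 1 are separate because predictions on the boundary are still possible there.\<close>

lemma bce_real_diff_le:
  assumes p: "p \<in> {0..1}" "compatible p y" and q: "q \<in> {0..1}" "compatible q y"
  shows "0 < lr_bound p q y" and "bce_real p y - bce_real q y \<le> 2 * ln (lr_bound p q y)"
proof -
  have "0 < lr_bound p q y \<and> bce_real p y - bce_real q y \<le> 2 * ln (lr_bound p q y)"
  proof -
    consider "y = 0" | "y = 1" | "0 < y" "y < 1" using p by (force simp: compatible_def)
    then show ?thesis
    proof cases
      case 1
      then have "p < 1" "q < 1" using p q by (auto simp: compatible_def less_le)
      then show ?thesis using 1 by (simp add: lr_bound_def bce_real_def ln_sqrt ln_div)
    next
      case 2
      then have "0 < p" "0 < q" using p q by (auto simp: compatible_def less_le)
      then show ?thesis using 2 by (simp add: lr_bound_def bce_real_def ln_sqrt ln_div)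
    next
      case 3
      then have pq: "0 < p" "p < 1" "0 < q" "q < 1" using p q by (auto simp: compatible_def less_le)
      define a b where "a = sqrt (q / p)" and "b = sqrt ((1 - q) / (1 - p))"
      have ab: "0 < a" "0 < b" using pq by (auto simp: a_def b_def)
      define m where "m = y * a + (1 - y) * b"
      have m: "0 < m" using ab 3 by (simp add: m_def add_pos_pos)
      \<comment> \<open>The tangent to ln at m lies above the graph; as m is the weighted mean, the
        right-hand side is zero.\<close>
      have "y * (ln a - ln m) + (1 - y) * (ln b - ln m) \<le> y * ((a - m) / m) + (1 - y) * ((b - m) / m)"
        using ab m 3 by (intro add_mono mult_left_mono ln_diff_le) auto
      also have "\<dots> = (y * a + (1 - y) * b - m) / m" using m by (simp add: field_simps)
      finally have "y * ln a + (1 - y) * ln b \<le> ln m" by (simp add: m_def algebra_simps)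
      moreover have "2 * ln a = ln q - ln p" "2 * ln b = ln (1 - q) - ln (1 - p)"
        using pq by (simp_all add: a_def b_def ln_sqrt ln_div)
      then have "bce_real p y - bce_real q y = 2 * (y * ln a + (1 - y) * ln b)"
      proof -
        have "2 * (y * ln a + (1 - y) * ln b) = y * (2 * ln a) + (1 - y) * (2 * ln b)" by (simp add: algebra_simps)
        then show ?thesis
          unfolding \<open>2 * ln a = _\<close> \<open>2 * ln b = _\<close> by (simp add: bce_real_def algebra_simps)
      qed
      moreover have "lr_bound p q y = m" by (simp add: lr_bound_def m_def a_def b_def)
      ultimately show ?thesis using m by simp
    qed
  qed
  then show "0 < lr_bound p q y" "bce_real p y - bce_real q y \<le> 2 * ln (lr_bound p q y)" by auto
qed

lemma sum_bce_loss_eq: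
  assumes "finite I" "\<And>i. i \<in> I \<Longrightarrow> u i \<in> {0..1}" "\<And>i. i \<in> I \<Longrightarrow> y i \<in> {0..1}"
  shows "(\<Sum>i\<in>I. bce_loss (u i) (y i)) =
    (if \<forall>i\<in>I. compatible (u i) (y i) then ereal (\<Sum>i\<in>I. bce_real (u i) (y i)) else \<infinity>)"
proof (cases "\<forall>i\<in>I. compatible (u i) (y i)")
  case True
  then have "(\<Sum>i\<in>I. bce_loss (u i) (y i)) = (\<Sum>i\<in>I. ereal (bce_real (u i) (y i)))"
    using assms by (intro sum.cong) (auto simp: bce_loss_eq)
  then show ?thesis using True by simp
next
  case False
  then show ?thesis using assms by (auto simp: sum_Pinfty bce_loss_eq)
qed

lemma sum_bce_real_diff_le:
  assumes fin: "finite I"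
    and p: "\<And>i. i \<in> I \<Longrightarrow> p i \<in> {0..1}" "\<And>i. i \<in> I \<Longrightarrow> compatible (p i) (y i)"
    and q: "\<And>i. i \<in> I \<Longrightarrow> q i \<in> {0..1}" "\<And>i. i \<in> I \<Longrightarrow> compatible (q i) (y i)"
  shows "0 < (\<Prod>i\<in>I. lr_bound (p i) (q i) (y i))"
    and "(\<Sum>i\<in>I. bce_real (p i) (y i)) - (\<Sum>i\<in>I. bce_real (q i) (y i)) \<le> 2 * ln (\<Prod>i\<in>I. lr_bound (p i) (q i) (y i))"
proof -
  have pos: "0 < lr_bound (p i) (q i) (y i)" if "i \<in> I" for i
    using that p q by (intro bce_real_diff_le) auto
  then show "0 < (\<Prod>i\<in>I. lr_bound (p i) (q i) (y i))" by (intro prod_pos) auto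
  have "(\<Sum>i\<in>I. bce_real (p i) (y i)) - (\<Sum>i\<in>I. bce_real (q i) (y i)) \<le> (\<Sum>i\<in>I. 2 * ln (lr_bound (p i) (q i) (y i)))"
    unfolding sum_subtractf[symmetric] using p q by (intro sum_mono bce_real_diff_le) auto
  also have "\<dots> = 2 * ln (\<Prod>i\<in>I. lr_bound (p i) (q i) (y i))"
    using fin pos by (subst ln_prod) (auto simp: sum_distrib_left less_imp_neq[symmetric])
  finally show "(\<Sum>i\<in>I. bce_real (p i) (y i)) - (\<Sum>i\<in>I. bce_real (q i) (y i)) \<le> 2 * ln (\<Prod>i\<in>I. lr_bound (p i) (q i) (y i))" .
qed

section \<open>Regression targets and Bellman backups\<close>

locale value_class = episodic_mdp M for M :: "('x, 'a::finite) mdp" +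
  fixes F :: "('x, 'a) ftuple set"
  assumes cost_norm: "total_cost_normalized M"
    and fclass: "function_class M F"
    and tnorm: "targets_normalized M F"
    and complete: "bellman_complete M F"
    and realiz: "realizable M F"
begin

definition obs_act_of :: "('x, 'a) transition \<Rightarrow> 'x \<times> 'a" where
  "obs_act_of s = (obs_of s, act_of s)"

definition target :: "('x, 'a) ftuple \<Rightarrow> nat \<Rightarrow> ('x, 'a) transition \<Rightarrow> real" where
  "target f h s = cost_of s + (MIN a'. f (Suc h) (next_of s, a'))"

definition backup :: "('x, 'a) ftuple \<Rightarrow> nat \<Rightarrow> 'x \<times> 'a \<Rightarrow> real" where
  "backup f h = bellman M h (f (Suc h))"

lemma obs_act_of_measurable [measurable]: "obs_act_of \<in> T \<rightarrow>\<^sub>M Z"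
  unfolding obs_act_of_def by measurable

lemma finite_F: "finite F"
  using fclass by (simp add: function_class_def)

lemma F_measurable: "f \<in> F \<Longrightarrow> f h \<in> borel_measurable Z"
  using fclass by (cases "h \<in> {1..H}") (auto simp: function_class_def)

lemma F_01:
  assumes "f \<in> F" shows "f h z \<in> {0..1}"
proof (cases "h \<in> {1..H}")
  case True
  then show ?thesis using fclass assms unfolding function_class_def by blast
next
  case False
  then have "f h = (\<lambda>_. 0)" using fclass assms unfolding function_class_def by blast
  then show ?thesis by simp
qed

text \<open>Besides its statistical role, completeness supplies the measurability and the range of
  backups: a backup is itself a component of the class.\<close>

lemma backup_component: "f \<in> F \<Longrightarrow> h \<in> {1..H} \<Longrightarrow> \<exists>g\<in>F. backup f h = g h"
  using complete unfolding bellman_complete_def component_def backup_def by blast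

lemma backup_measurable: "f \<in> F \<Longrightarrow> h \<in> {1..H} \<Longrightarrow> backup f h \<in> borel_measurable Z"
  using backup_component F_measurable by metis

lemma backup_01: "f \<in> F \<Longrightarrow> h \<in> {1..H} \<Longrightarrow> backup f h z \<in> {0..1}"
  using backup_component F_01 by metis

lemma optimal_q_in_F: "optimal_q M \<in> F"
  using realiz by (simp add: realizable_def)

lemma backup_optimal_q: "h \<in> {1..H} \<Longrightarrow> backup (optimal_q M) h = optimal_q M h"
  unfolding backup_def by (subst (2) optimal_q.simps) simp

lemma Min_F_measurable:
  assumes "f \<in> F"
  shows "(\<lambda>x. MIN a. f h (x, a)) \<in> borel_measurable S"
proof (rule borel_measurable_Min)
  show "(\<lambda>x. f h (x, a)) \<in> borel_measurable S" for a
    by (rule measurable_compose[OF measurable_Pair2' F_measurable[OF assms]]) simp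
qed simp

lemma Min_F_01:
  assumes "f \<in> F" shows "(MIN a. f h (x, a)) \<in> {0..1}"
proof -
  have "(MIN a. f h (x, a)) \<in> range (\<lambda>a. f h (x, a))" by (intro Min_in) auto
  then show ?thesis using F_01[OF assms, of h] by force
qed

lemma target_measurable: "f \<in> F \<Longrightarrow> target f h \<in> borel_measurable T"
  unfolding target_def
  by (intro borel_measurable_add cost_of_measurable measurable_compose[OF next_of_measurable Min_F_measurable])

lemma target_outcome_measurable:
  "f \<in> F \<Longrightarrow> (\<lambda>w. target f h (x, a, w)) \<in> borel_measurable (borel \<Otimes>\<^sub>M S)"
  by (rule measurable_compose[OF _ target_measurable]) auto

lemma backup_eq_integral:
  "backup f h (x, a) = (\<integral>w. target f h (x, a, w) \<partial>outcome_law M h (x, a))"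
  by (simp add: backup_def bellman_def outcome_law_def target_def cost_of_def next_of_def split_beta')

text \<open>Normalisation of targets is given along episodes, whereas conditional means are computed
  under \<open>outcome_law\<close> at a fixed observation and action. The transfer expresses an
  almost sure property as a vanishing integral of the indicator of its failure.\<close>

lemma AE_mix_iterated:
  assumes \<nu>: "\<nu> \<in> space (prob_algebra S)" and h: "h \<in> {1..H}" and p: "p \<in> S \<rightarrow>\<^sub>M prob_algebra AS"
    and P: "Measurable.pred T P"
  shows "(AE s in \<nu> \<bind> step_law M h p. P s) \<longleftrightarrow>
    (AE x in \<nu>. AE a in p x. AE w in outcome_law M h (x, a). P (x, a, w))"
proof -
  have s: "sets \<nu> = sets S" using \<nu> by (simp add: space_prob_algebra)
  have k: "step_law M h p \<in> \<nu> \<rightarrow>\<^sub>M subprob_algebra T"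
    using measurable_prob_algebraD[OF step_law_kernel[OF h p]] measurable_cong_sets[OF s refl] by blast
  have "(AE s in step_law M h p x. P s) \<longleftrightarrow> (AE a in p x. AE w in outcome_law M h (x, a). P (x, a, w))" for x
  proof -
    have px: "p x \<in> space (prob_algebra AS)" using measurable_space[OF p, of x] by simp
    have sp: "sets (p x) = sets AS" using px by (simp add: space_prob_algebra)
    have ss: "sets (step_law M h p x) = sets T"
      using measurable_space[OF step_law_kernel[OF h p], of x] by (simp add: space_prob_algebra)
    have m: "(\<lambda>s. indicator {s. \<not> P s} s :: ennreal) \<in> borel_measurable T" using P by measurable
    have mo: "(\<lambda>w. indicator {s. \<not> P s} (x, a, w) :: ennreal) \<in> borel_measurable (outcome_law M h (x, a))" for a
    proof -
      have "(\<lambda>y. (x, a, y)) \<in> borel \<Otimes>\<^sub>M S \<rightarrow>\<^sub>M T" by measurable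
      from measurable_compose[OF this m] show ?thesis
        using measurable_cong_sets[OF sets_outcome_law[OF h, of "(x, a)"] refl] by (auto simp: split_beta')
    qed
    have "(AE s in step_law M h p x. P s) \<longleftrightarrow> (\<integral>\<^sup>+s. indicator {s. \<not> P s} s \<partial>step_law M h p x) = 0"
    proof -
      have "(\<lambda>s. indicator {s. \<not> P s} s :: ennreal) \<in> borel_measurable (step_law M h p x)"
        using m measurable_cong_sets[OF ss refl] by blast
      from nn_integral_0_iff_AE[OF this] show ?thesis by (simp add: indicator_eq_0_iff)
    qed
    also have "\<dots> \<longleftrightarrow> (\<integral>\<^sup>+a. (\<integral>\<^sup>+w. indicator {s. \<not> P s} (x, a, w) \<partial>outcome_law M h (x, a)) \<partial>p x) = 0"
      by (simp only: nn_integral_step_law[where p = p and x = x and \<phi> = "indicator {s. \<not> P s}", OF h px m])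
    also have "\<dots> \<longleftrightarrow> (AE a in p x. (\<integral>\<^sup>+w. indicator {s. \<not> P s} (x, a, w) \<partial>outcome_law M h (x, a)) = 0)"
      by (intro nn_integral_0_iff_AE) (simp add: measurable_cong_sets[OF sp refl] del: sets_eq_imp_space_eq)
    also have "\<dots> \<longleftrightarrow> (AE a in p x. AE w in outcome_law M h (x, a). P (x, a, w))"
      unfolding nn_integral_0_iff_AE[OF mo] by (simp add: split_beta' indicator_eq_0_iff)
    finally show ?thesis .
  qed
  then show ?thesis by (simp add: AE_bind[OF k P])
qed

context
  fixes \<nu> h p f
  assumes \<nu>: "\<nu> \<in> space (prob_algebra S)" and h: "h \<in> {1..H}" and p: "p \<in> S \<rightarrow>\<^sub>M prob_algebra AS"
    and f: "f \<in> F" and AE_target: "AE s in \<nu> \<bind> step_law M h p. target f h s \<in> {0..1}"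
begin

lemma AE_outcome_target:
  "AE x in \<nu>. AE a in p x. AE w in outcome_law M h (x, a). target f h (x, a, w) \<in> {0..1}"
proof -
  have "Measurable.pred T (\<lambda>s. target f h s \<in> {0..1})" using target_measurable[OF f] by measurable
  from AE_mix_iterated[OF \<nu> h p this] AE_target show ?thesis by (simp add: split_beta')
qed

lemma outcome_target_measurable:
  "(\<lambda>w. target f h (x, a, w)) \<in> borel_measurable (outcome_law M h (x, a))"
  using target_outcome_measurable[OF f] measurable_cong_sets[OF sets_outcome_law[OF h] refl] by blast

text \<open>Given observation and action, both predictions are constants and the target has mean
  \<open>backup\<close>, so \<open>lr_bound_mean\<close> applies inside the integral. It is
  available only at almost all observations and actions.\<close>

lemma nn_integral_lr_bound:
  assumes g: "g \<in> F"
  shows "(\<integral>\<^sup>+s. ennreal (lr_bound (backup f h (obs_act_of s)) (g h (obs_act_of s)) (target f h s)) \<partial>(\<nu> \<bind> step_law M h p)) =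
    (\<integral>\<^sup>+s. ennreal (1 - hellinger_ber (g h (obs_act_of s)) (backup f h (obs_act_of s))) \<partial>(\<nu> \<bind> step_law M h p))"
proof -
  note [measurable] = target_measurable[OF f] backup_measurable[OF f h] F_measurable[OF g]
  have 1: "(\<lambda>s. ennreal (lr_bound (backup f h (obs_act_of s)) (g h (obs_act_of s)) (target f h s))) \<in> borel_measurable T"
    unfolding lr_bound_def by measurable
  have 2: "(\<lambda>s. ennreal (1 - hellinger_ber (g h (obs_act_of s)) (backup f h (obs_act_of s)))) \<in> borel_measurable T"
    unfolding hellinger_ber_def by measurable
  have inner: "(\<integral>\<^sup>+w. ennreal (lr_bound (backup f h (obs_act_of (x, a, w))) (g h (obs_act_of (x, a, w))) (target f h (x, a, w))) \<partial>outcome_law M h (x, a))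
      = (\<integral>\<^sup>+w. ennreal (1 - hellinger_ber (g h (obs_act_of (x, a, w))) (backup f h (obs_act_of (x, a, w)))) \<partial>outcome_law M h (x, a))"
    if "AE w in outcome_law M h (x, a). target f h (x, a, w) \<in> {0..1}" for x a
  proof -
    interpret prob_space "outcome_law M h (x, a)" by (rule prob_space_outcome_law[OF h])
    show ?thesis
      using lr_bound_mean(1)[OF outcome_target_measurable that F_01[OF g, of h "(x, a)"] backup_eq_integral]
      by (simp add: obs_act_of_def obs_of_def act_of_def split_beta' emeasure_space_1)
  qed
  show ?thesis
    unfolding nn_integral_mix[OF \<nu> h p 1] nn_integral_mix[OF \<nu> h p 2]
  proof (rule nn_integral_cong_AE)
    show "AE x in \<nu>. (\<integral>\<^sup>+a. (\<integral>\<^sup>+w. ennreal (lr_bound (backup f h (obs_act_of (x, a, w))) (g h (obs_act_of (x, a, w))) (target f h (x, a, w))) \<partial>outcome_law M h (x, a)) \<partial>p x)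
      = (\<integral>\<^sup>+a. (\<integral>\<^sup>+w. ennreal (1 - hellinger_ber (g h (obs_act_of (x, a, w))) (backup f h (obs_act_of (x, a, w)))) \<partial>outcome_law M h (x, a)) \<partial>p x)"
      using AE_outcome_target
    proof eventually_elim
      case (elim x)
      then show ?case by (intro nn_integral_cong_AE) (erule eventually_mono, rule inner)
    qed
  qed
qed

lemma AE_compatible: "AE s in \<nu> \<bind> step_law M h p. compatible (backup f h (obs_act_of s)) (target f h s)"
proof -
  note [measurable] = target_measurable[OF f] backup_measurable[OF f h]
  have m: "Measurable.pred T (\<lambda>s. compatible (backup f h (obs_act_of s)) (target f h s))"
    unfolding compatible_def by measurable
  have inner: "AE w in outcome_law M h (x, a). compatible (backup f h (x, a)) (target f h (x, a, w))"
    if "AE w in outcome_law M h (x, a). target f h (x, a, w) \<in> {0..1}" for x a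
  proof -
    interpret prob_space "outcome_law M h (x, a)" by (rule prob_space_outcome_law[OF h])
    show ?thesis
      using lr_bound_mean(2)[OF outcome_target_measurable that F_01[OF f, of h "(x, a)"] backup_eq_integral] .
  qed
  show ?thesis
    unfolding AE_mix_iterated[OF \<nu> h p m]
    using AE_outcome_target
  proof eventually_elim
    case (elim x)
    then show ?case
      by eventually_elim (drule inner, simp add: obs_act_of_def obs_of_def act_of_def split_beta')
  qed
qed

text \<open>A backup is the conditional mean of the target. Since both integrands are almost surely
  in [0,1], equality of the nonnegative integrals suffices.\<close>

lemma integral_target:
  "(\<integral>s. target f h s \<partial>(\<nu> \<bind> step_law M h p)) = (\<integral>s. backup f h (obs_act_of s) \<partial>(\<nu> \<bind> step_law M h p))"
proof -
  let ?Q = "\<nu> \<bind> step_law M h p"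
  have Q: "sets ?Q = sets T" "prob_space ?Q" using mix_in_space[OF \<nu> h p] by (auto simp: space_prob_algebra)
  interpret Q: prob_space ?Q by (rule Q)
  note [measurable] = target_measurable[OF f] backup_measurable[OF f h]
  have inner: "(\<integral>\<^sup>+w. ennreal (target f h (x, a, w)) \<partial>outcome_law M h (x, a))
      = (\<integral>\<^sup>+w. ennreal (backup f h (obs_act_of (x, a, w))) \<partial>outcome_law M h (x, a))"
    if AE: "AE w in outcome_law M h (x, a). target f h (x, a, w) \<in> {0..1}" for x a
  proof -
    interpret prob_space "outcome_law M h (x, a)" by (rule prob_space_outcome_law[OF h])
    have "integrable (outcome_law M h (x, a)) (\<lambda>w. target f h (x, a, w))"
      using AE by (intro integrable_const_bound[of _ 1] outcome_target_measurable) auto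
    then have "(\<integral>\<^sup>+w. ennreal (target f h (x, a, w)) \<partial>outcome_law M h (x, a)) = ennreal (backup f h (x, a))"
      unfolding backup_eq_integral using AE by (intro nn_integral_eq_integral) auto
    then show ?thesis by (simp add: obs_act_of_def obs_of_def act_of_def split_beta' emeasure_space_1)
  qed
  have 1: "(\<lambda>s. ennreal (target f h s)) \<in> borel_measurable T" by measurable
  have 2: "(\<lambda>s. ennreal (backup f h (obs_act_of s))) \<in> borel_measurable T" by measurable
  have "(\<integral>\<^sup>+s. ennreal (target f h s) \<partial>?Q) = (\<integral>\<^sup>+s. ennreal (backup f h (obs_act_of s)) \<partial>?Q)"
    unfolding nn_integral_mix[OF \<nu> h p 1] nn_integral_mix[OF \<nu> h p 2]
  proof (rule nn_integral_cong_AE)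
    show "AE x in \<nu>. (\<integral>\<^sup>+a. (\<integral>\<^sup>+w. ennreal (target f h (x, a, w)) \<partial>outcome_law M h (x, a)) \<partial>p x)
      = (\<integral>\<^sup>+a. (\<integral>\<^sup>+w. ennreal (backup f h (obs_act_of (x, a, w))) \<partial>outcome_law M h (x, a)) \<partial>p x)"
      using AE_outcome_target
    proof eventually_elim
      case (elim x)
      then show ?case by (intro nn_integral_cong_AE) (erule eventually_mono, rule inner)
    qed
  qed
  then show ?thesis
    using AE_target backup_01[OF f h] Q(1)
    by (subst (1 2) integral_eq_nn_integral) (auto elim!: eventually_mono cong: measurable_cong_sets)
qed

end

end

section \<open>Likelihood ratio processes along a run\<close>

context value_class begin

abbreviation hell :: "nat \<Rightarrow> ('x, 'a) ftuple \<Rightarrow> ('x, 'a) ftuple \<Rightarrow> 'x \<times> 'a \<Rightarrow> real" where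
  "hell h f g z \<equiv> hellinger_ber (g h z) (backup f h z)"

lemma hell_measurable:
  assumes "f \<in> F" "g \<in> F" "h \<in> {1..H}"
  shows "hell h f g \<in> borel_measurable Z"
proof -
  note [measurable] = backup_measurable[OF assms(1,3)] F_measurable[OF assms(2)]
  show ?thesis unfolding hellinger_ber_def by measurable
qed

lemma hell_01: "f \<in> F \<Longrightarrow> g \<in> F \<Longrightarrow> h \<in> {1..H} \<Longrightarrow> hell h f g z \<in> {0..1}"
  using hellinger_ber_nonneg hellinger_ber_le_1[OF F_01 backup_01] by simp

lemma hell_obs_act_of_measurable:
  assumes "f \<in> F" "g \<in> F" "h \<in> {1..H}"
  shows "(\<lambda>s. hell h f g (obs_act_of s)) \<in> borel_measurable T"
  by (rule measurable_compose[OF obs_act_of_measurable hell_measurable[OF assms]])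

lemma AE_trans_law_target:
  assumes "\<pi> \<in> policies M" "h \<in> {1..H}" "f \<in> F"
  shows "AE s in trans_law M \<pi> h. target f h s \<in> {0..1}"
proof -
  have m: "(\<lambda>\<tau>. \<tau> h) \<in> episode M \<pi> \<rightarrow>\<^sub>M T"
    using measurable_component_episode[OF assms(1,2)] by (simp add: episode_def)
  have "{s \<in> space T. target f h s \<in> {0..1}} \<in> sets T"
    using target_measurable[OF assms(3)] by measurable
  moreover have "AE \<tau> in episode M \<pi>. target f h (\<tau> h) \<in> {0..1}"
    using tnorm assms unfolding targets_normalized_def target_def by blast
  ultimately show ?thesis unfolding trans_law_def by (subst AE_distr_iff[OF m])
qed

lemma AE_data_law_target:
  assumes "\<pi> \<in> policies M" "h \<in> {1..H}" "f \<in> F"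
  shows "AE s in data_law M ua \<pi> h. target f h s \<in> {0..1}"
  using data_law_eq_trans_law[OF assms(1,2), of ua] AE_trans_law_target[OF _ assms(2,3)] by metis

lemma AE_data_law_compatible:
  assumes "\<pi> \<in> policies M" "h \<in> {1..H}" "f \<in> F"
  shows "AE s in data_law M ua \<pi> h. compatible (backup f h (obs_act_of s)) (target f h s)"
  using AE_compatible[OF obs_law_in_space[OF assms(1,2)] assms(2) roll_in_policy_kernel[OF assms(1,2)] assms(3)]
    AE_data_law_target[OF assms, of ua] unfolding data_law_def by blast

lemma integrable_bounded_data_law:
  fixes \<phi> :: "('x, 'a) transition \<Rightarrow> real"
  assumes "\<pi> \<in> policies M" "h \<in> {1..H}" "\<phi> \<in> borel_measurable T" "\<And>s. \<phi> s \<in> {0..1}"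
  shows "integrable (data_law M ua \<pi> h) \<phi>"
proof -
  have *: "sets (data_law M ua \<pi> h) = sets T" "prob_space (data_law M ua \<pi> h)"
    using data_law_in_space[OF assms(1,2), of ua] by (auto simp: space_prob_algebra)
  interpret prob_space "data_law M ua \<pi> h" by (rule *)
  have "\<phi> \<in> borel_measurable (data_law M ua \<pi> h)"
    using assms(3) measurable_cong_sets[OF *(1) refl] by blast
  then show ?thesis using assms(4) by (intro integrable_const_bound[of _ 1]) auto
qed

lemma nn_integral_data_law_lr_bound:
  assumes \<pi>: "\<pi> \<in> policies M" and h: "h \<in> {1..H}" and f: "f \<in> F" and g: "g \<in> F"
  shows "(\<integral>\<^sup>+s. ennreal (lr_bound (backup f h (obs_act_of s)) (g h (obs_act_of s)) (target f h s)) \<partial>data_law M ua \<pi> h) =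
    ennreal (1 - (\<integral>s. hell h f g (obs_act_of s) \<partial>data_law M ua \<pi> h))"
proof -
  let ?Q = "data_law M ua \<pi> h"
  have *: "prob_space ?Q" using data_law_in_space[OF \<pi> h, of ua] by (simp add: space_prob_algebra)
  interpret prob_space ?Q by (rule *)
  have int: "integrable ?Q (\<lambda>s. hell h f g (obs_act_of s))"
    by (rule integrable_bounded_data_law[OF \<pi> h hell_obs_act_of_measurable[OF f g h] hell_01[OF f g h]])
  have "(\<integral>\<^sup>+s. ennreal (lr_bound (backup f h (obs_act_of s)) (g h (obs_act_of s)) (target f h s)) \<partial>?Q) =
      (\<integral>\<^sup>+s. ennreal (1 - hell h f g (obs_act_of s)) \<partial>?Q)"
    using nn_integral_lr_bound[OF obs_law_in_space[OF \<pi> h] h roll_in_policy_kernel[OF \<pi> h] f _ g]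
      AE_data_law_target[OF \<pi> h f, of ua] unfolding data_law_def by blast
  also have "\<dots> = ennreal (\<integral>s. 1 - hell h f g (obs_act_of s) \<partial>?Q)"
    using int hell_01[OF f g h] by (intro nn_integral_eq_integral) auto
  also have "(\<integral>s. 1 - hell h f g (obs_act_of s) \<partial>?Q) = 1 - (\<integral>s. hell h f g (obs_act_of s) \<partial>?Q)"
    using int by (simp add: prob_space)
  finally show ?thesis .
qed

end

locale value_class_run = value_class M F + algorithm_run M act K ua
  for M :: "('x, 'a::finite) mdp" and F :: "('x, 'a) ftuple set"
    and act :: "nat \<Rightarrow> ('x, 'a) history \<Rightarrow> nat \<Rightarrow> 'x \<Rightarrow> 'a" and K :: nat and ua :: bool
begin

text \<open>Here f supplies the regression targets and g the predictions. Two kinds of pairs are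
  used: \<open>Q\<close> with any g, for the validity of the confidence set, and g with itself, for
  its Bellman error.\<close>

definition err :: "nat \<Rightarrow> ('x, 'a) ftuple \<Rightarrow> ('x, 'a) ftuple \<Rightarrow> nat \<Rightarrow> ('x, 'a) history \<Rightarrow> real" where
  "err h f g i D = (\<integral>s. hell h f g (obs_act_of s) \<partial>data_law M ua (pol_at i D) h)"

definition lr :: "nat \<Rightarrow> ('x, 'a) ftuple \<Rightarrow> ('x, 'a) ftuple \<Rightarrow> ('x, 'a) transition \<Rightarrow> real" where
  "lr h f g s = lr_bound (backup f h (obs_act_of s)) (g h (obs_act_of s)) (target f h s)"

text \<open>The exponential is a predictable compensator: the ratio of round i has conditional mean
  \<open>1 - err\<close>, and \<open>err\<close> at i is determined by the rounds before i.\<close>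

definition lr_process :: "nat \<Rightarrow> ('x, 'a) ftuple \<Rightarrow> ('x, 'a) ftuple \<Rightarrow> nat \<Rightarrow> ('x, 'a) history \<Rightarrow> ennreal" where
  "lr_process h f g n D = (\<Prod>i\<in>{1..n}. ennreal (lr h f g (D i h)) * ennreal (exp (err h f g i D)))"

definition incompatible :: "nat \<Rightarrow> ('x, 'a) ftuple \<Rightarrow> ('x, 'a) transition set" where
  "incompatible h f = {s. \<not> compatible (backup f h (obs_act_of s)) (target f h s)}"

text \<open>Added to the supermartingale, this makes the almost sure properties of the data part of the same event.\<close>

definition null_penalty :: "nat \<Rightarrow> ('x, 'a) history \<Rightarrow> ennreal" where
  "null_penalty n D = (\<Sum>i\<in>{1..n}. \<Sum>h\<in>{1..H}. \<Sum>f\<in>F. \<top> * indicator (incompatible h f) (D i h))"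

lemma lr_measurable:
  assumes "f \<in> F" "g \<in> F" "h \<in> {1..H}"
  shows "lr h f g \<in> borel_measurable T"
proof -
  note [measurable] = backup_measurable[OF assms(1,3)] F_measurable[OF assms(2)] target_measurable[OF assms(1)]
  show ?thesis unfolding lr_def lr_bound_def by measurable
qed

lemma incompatible_sets:
  assumes "f \<in> F" "h \<in> {1..H}"
  shows "incompatible h f \<in> sets T"
proof -
  note [measurable] = backup_measurable[OF assms] target_measurable[OF assms(1)]
  have "{s \<in> space T. \<not> compatible (backup f h (obs_act_of s)) (target f h s)} \<in> sets T"
    unfolding compatible_def by measurable
  then show ?thesis by (simp add: incompatible_def)
qed

lemma component_measurable:
  assumes "i \<in> {1..n}" "h \<in> {1..H}"
  shows "(\<lambda>D. D i h) \<in> history_space M (Suc n) \<rightarrow>\<^sub>M T"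
proof -
  have "(\<lambda>D. D i) \<in> history_space M (Suc n) \<rightarrow>\<^sub>M round_space M"
    using assms by (intro measurable_component_singleton) auto
  from measurable_compose[OF this measurable_component_singleton[OF assms(2)]] show ?thesis .
qed

lemma err_measurable:
  assumes fg: "f \<in> F" "g \<in> F" and h: "h \<in> {1..H}" and i: "i \<in> {1..n}" "n \<le> K"
  shows "err h f g i \<in> borel_measurable (history_space M (Suc n))"
proof -
  have "(\<lambda>D. data_law M ua (pol_at i D) h) \<in> history_space M (Suc n) \<rightarrow>\<^sub>M prob_algebra T"
    using i by (intro data_law_measurable pol_at_kernel h) auto
  from measurable_compose[OF measurable_prob_algebraD[OF this] integral_measurable_subprob_algebra[OF hell_obs_act_of_measurable[OF fg h]]]
  show ?thesis unfolding err_def .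
qed

lemma lr_process_measurable:
  assumes fg: "f \<in> F" "g \<in> F" and h: "h \<in> {1..H}" and j: "j \<le> n" "n \<le> K"
  shows "lr_process h f g j \<in> borel_measurable (history_space M (Suc n))"
  unfolding lr_process_def
proof (intro borel_measurable_prod_ennreal borel_measurable_times_ennreal)
  fix i assume "i \<in> {1..j}"
  then have i: "i \<in> {1..n}" using j by auto
  show "(\<lambda>D. ennreal (lr h f g (D i h))) \<in> borel_measurable (history_space M (Suc n))"
    by (rule measurable_compose[OF measurable_compose[OF component_measurable[OF i h] lr_measurable[OF fg h]] measurable_ennreal])
  have "(\<lambda>D. exp (err h f g i D)) \<in> borel_measurable (history_space M (Suc n))"
    by (rule measurable_compose[OF err_measurable[OF fg h i j(2)] borel_measurable_exp])
  then show "(\<lambda>D. ennreal (exp (err h f g i D))) \<in> borel_measurable (history_space M (Suc n))"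
    by (rule measurable_compose[OF _ measurable_ennreal])
qed

lemma null_penalty_measurable:
  assumes j: "j \<le> n" "n \<le> K"
  shows "null_penalty j \<in> borel_measurable (history_space M (Suc n))"
  unfolding null_penalty_def
proof (intro borel_measurable_sum borel_measurable_times_ennreal borel_measurable_const)
  fix i h f assume "i \<in> {1..j}" and h: "h \<in> {1..H}" and f: "f \<in> F"
  then have i: "i \<in> {1..n}" using j by auto
  show "(\<lambda>D. indicator (incompatible h f) (D i h)) \<in> borel_measurable (history_space M (Suc n))"
    by (rule measurable_compose[OF component_measurable[OF i h] borel_measurable_indicator[OF incompatible_sets[OF f h]]])
qed

lemma err_upd: "i \<le> n \<Longrightarrow> err h f g i (D(n := d)) = err h f g i D"
  by (simp add: err_def pol_at_upd)

lemma lr_process_upd: "j \<le> n \<Longrightarrow> lr_process h f g j (D(Suc n := d)) = lr_process h f g j D"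
  unfolding lr_process_def by (intro prod.cong) (auto simp: err_upd)

lemma null_penalty_upd: "j \<le> n \<Longrightarrow> null_penalty j (D(Suc n := d)) = null_penalty j D"
  unfolding null_penalty_def by (intro sum.cong) auto

context
  fixes n D
  assumes n: "n < K" and D: "D \<in> space (history_space M (Suc n))"
begin

lemma pol_Suc_in_policies: "pol (Suc n) D \<in> policies M"
  using pol_in_policies[OF _ D] n by simp

lemma collect_component: "h \<in> {1..H} \<Longrightarrow> (\<lambda>d. d h) \<in> collect_law M ua (pol (Suc n) D) \<rightarrow>\<^sub>M T"
proof -
  assume h: "h \<in> {1..H}"
  have "sets (collect_law M ua (pol (Suc n) D)) = sets (round_space M)"
    using collect_law_in_space[OF pol_Suc_in_policies] by (simp add: space_prob_algebra)
  then show ?thesis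
    using measurable_component_singleton[OF h] measurable_cong_sets by blast
qed

lemma nn_integral_collect:
  assumes "h \<in> {1..H}" and \<phi>: "\<phi> \<in> borel_measurable T"
  shows "(\<integral>\<^sup>+d. \<phi> (d h) \<partial>collect_law M ua (pol (Suc n) D)) = (\<integral>\<^sup>+s. \<phi> s \<partial>data_law M ua (pol (Suc n) D) h)"
proof -
  have "(\<integral>\<^sup>+s. \<phi> s \<partial>distr (collect_law M ua (pol (Suc n) D)) T (\<lambda>d. d h)) =
      (\<integral>\<^sup>+d. \<phi> (d h) \<partial>collect_law M ua (pol (Suc n) D))"
    using nn_integral_distr[OF collect_component[OF assms(1)], of \<phi>] \<phi>
    unfolding measurable_distr_eq1 by blast
  then show ?thesis
    by (simp only: distr_collect_law[OF pol_Suc_in_policies assms(1)])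
qed

lemma lr_process_step:
  assumes fg: "f \<in> F" "g \<in> F" and h: "h \<in> {1..H}"
  shows "(\<integral>\<^sup>+d. lr_process h f g (Suc n) (D(Suc n := d)) \<partial>collect_law M ua (pol (Suc n) D)) \<le> lr_process h f g n D"
proof -
  let ?C = "collect_law M ua (pol (Suc n) D)"
  have e: "err h f g (Suc n) D = (\<integral>s. hell h f g (obs_act_of s) \<partial>data_law M ua (pol (Suc n) D) h)" (is "_ = ?e")
    by (simp only: err_def pol_at_self[OF D])
  have "lr_process h f g (Suc n) (D(Suc n := d)) =
      lr_process h f g n D * ennreal (exp ?e) * ennreal (lr h f g (d h))" for d
  proof -
    have "lr_process h f g (Suc n) (D(Suc n := d)) = lr_process h f g n (D(Suc n := d)) *
        (ennreal (lr h f g (d h)) * ennreal (exp (err h f g (Suc n) (D(Suc n := d)))))"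
      unfolding lr_process_def by simp
    then show ?thesis by (simp add: lr_process_upd err_upd e mult_ac)
  qed
  then have "(\<integral>\<^sup>+d. lr_process h f g (Suc n) (D(Suc n := d)) \<partial>?C) =
      (\<integral>\<^sup>+d. lr_process h f g n D * ennreal (exp ?e) * ennreal (lr h f g (d h)) \<partial>?C)" by (simp only:)
  also have "\<dots> = lr_process h f g n D * ennreal (exp ?e) * (\<integral>\<^sup>+d. ennreal (lr h f g (d h)) \<partial>?C)"
    by (rule nn_integral_cmult)
      (rule measurable_compose[OF measurable_compose[OF collect_component[OF h] lr_measurable[OF fg h]] measurable_ennreal])
  also have "(\<integral>\<^sup>+d. ennreal (lr h f g (d h)) \<partial>?C) = ennreal (1 - ?e)"
    using nn_integral_collect[OF h measurable_compose[OF lr_measurable[OF fg h] measurable_ennreal]]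
      nn_integral_data_law_lr_bound[OF pol_Suc_in_policies h fg, of ua]
    by (simp only: lr_def)
  also have "lr_process h f g n D * ennreal (exp ?e) * ennreal (1 - ?e) \<le> lr_process h f g n D * 1"
    unfolding mult.assoc
  proof (rule mult_left_mono)
    \<comment> \<open>From 1 - e \<le> exp (-e), the compensated factor has conditional mean at most
      1.\<close>
    have "exp ?e * (1 - ?e) \<le> exp ?e * exp (- ?e)"
      using exp_ge_add_one_self[of "- ?e"] by (intro mult_left_mono) auto
    then show "ennreal (exp ?e) * ennreal (1 - ?e) \<le> 1"
      by (simp add: exp_minus field_simps flip: ennreal_mult' )
  qed simp
  finally show ?thesis by (simp only: mult_1_right)
qed

text \<open>Incompatible transitions are null under the data law of the round, so the infinite
  weight adds nothing to the mean and the supermartingale property survives.\<close>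

lemma null_penalty_step:
  "(\<integral>\<^sup>+d. null_penalty (Suc n) (D(Suc n := d)) \<partial>collect_law M ua (pol (Suc n) D)) = null_penalty n D"
proof -
  let ?C = "collect_law M ua (pol (Suc n) D)"
  have ps: "prob_space ?C" using collect_law_in_space[OF pol_Suc_in_policies] by (simp add: space_prob_algebra)
  have ind: "(\<lambda>d. \<top> * indicator (incompatible h f) (d h) :: ennreal) \<in> borel_measurable ?C"
    if "h \<in> {1..H}" "f \<in> F" for h f
    by (intro borel_measurable_times_ennreal borel_measurable_const
        measurable_compose[OF collect_component[OF that(1)] borel_measurable_indicator[OF incompatible_sets[OF that(2,1)]]])
  have zero: "(\<integral>\<^sup>+d. \<top> * indicator (incompatible h f) (d h) \<partial>?C) = 0" if h: "h \<in> {1..H}" and f: "f \<in> F" for h f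
  proof -
    have "(\<integral>\<^sup>+d. \<top> * indicator (incompatible h f) (d h) \<partial>?C) = (\<integral>\<^sup>+s. \<top> * indicator (incompatible h f) s \<partial>data_law M ua (pol (Suc n) D) h)"
      by (rule nn_integral_collect[OF h])
        (intro borel_measurable_times_ennreal borel_measurable_const borel_measurable_indicator incompatible_sets f h)
    also have "\<dots> = (\<integral>\<^sup>+s. 0 \<partial>data_law M ua (pol (Suc n) D) h)"
      using AE_data_law_compatible[OF pol_Suc_in_policies h f, of ua]
      by (intro nn_integral_cong_AE) (auto elim!: eventually_mono simp: incompatible_def)
    finally show ?thesis by simp
  qed
  have "null_penalty (Suc n) (D(Suc n := d)) = null_penalty n D + (\<Sum>h\<in>{1..H}. \<Sum>f\<in>F. \<top> * indicator (incompatible h f) (d h))" for d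
  proof -
    have "null_penalty (Suc n) (D(Suc n := d)) = null_penalty n (D(Suc n := d)) + (\<Sum>h\<in>{1..H}. \<Sum>f\<in>F. \<top> * indicator (incompatible h f) (d h))"
      unfolding null_penalty_def by simp
    then show ?thesis by (simp only: null_penalty_upd[OF order_refl])
  qed
  then have "(\<integral>\<^sup>+d. null_penalty (Suc n) (D(Suc n := d)) \<partial>?C) =
      (\<integral>\<^sup>+d. null_penalty n D + (\<Sum>h\<in>{1..H}. \<Sum>f\<in>F. \<top> * indicator (incompatible h f) (d h)) \<partial>?C)" by (simp only:)
  also have "\<dots> = (\<integral>\<^sup>+d. null_penalty n D \<partial>?C) + (\<integral>\<^sup>+d. (\<Sum>h\<in>{1..H}. \<Sum>f\<in>F. \<top> * indicator (incompatible h f) (d h)) \<partial>?C)"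
    by (intro nn_integral_add borel_measurable_const borel_measurable_sum ind)
  also have "(\<integral>\<^sup>+d. (\<Sum>h\<in>{1..H}. \<Sum>f\<in>F. \<top> * indicator (incompatible h f) (d h)) \<partial>?C) = (\<Sum>h\<in>{1..H}. \<integral>\<^sup>+d. (\<Sum>f\<in>F. \<top> * indicator (incompatible h f) (d h)) \<partial>?C)"
    by (intro nn_integral_sum borel_measurable_sum ind)
  also have "\<dots> = (\<Sum>h\<in>{1..H}. \<Sum>f\<in>F. \<integral>\<^sup>+d. \<top> * indicator (incompatible h f) (d h) \<partial>?C)"
    by (intro sum.cong refl nn_integral_sum ind)
  also have "\<dots> = (\<Sum>h\<in>{1..H}. \<Sum>f\<in>F. 0)"
    by (intro sum.cong refl zero)
  also have "(\<integral>\<^sup>+d. null_penalty n D \<partial>?C) + (\<Sum>h\<in>{1..H}. \<Sum>f\<in>F. 0) = null_penalty n D"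
    by (simp add: prob_space.emeasure_space_1[OF ps])
  finally show ?thesis .
qed

end

end

section \<open>The confidence sets\<close>

locale optimistic_run = value_class_run M F act K ua
  for M :: "('x, 'a::finite) mdp" and F act K ua +
  fixes fsel :: "nat \<Rightarrow> ('x, 'a) history \<Rightarrow> ('x, 'a) ftuple" and \<beta> \<delta> :: real
  assumes K_ge_1: "1 \<le> K" and \<delta>: "0 < \<delta>" "\<delta> < 1"
    and \<beta>_eq: "\<beta> = 2 * ln (real H * real (card F) / \<delta>)"
    and choices: "optimistic_choices M F bce_loss \<beta> K fsel act"
begin

abbreviation "Q \<equiv> optimal_q M"
abbreviation "N \<equiv> card F"

text \<open>\<open>w1\<close> makes -2 ln w1 equal to \<beta>, the threshold of the confidence test.
  The additional factor N in \<open>w2\<close> is affordable, as - ln w2 is still at most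
  \<beta>.\<close>

definition w1 :: real where "w1 = \<delta> / (real H * real N)"
definition w2 :: real where "w2 = \<delta> / (real H * real N ^ 2)"

lemma N_ge_1: "1 \<le> N"
  using optimal_q_in_F finite_F by (metis One_nat_def Suc_leI card_gt_0_iff empty_iff)

lemma w_pos: "0 < w1" "0 < w2"
  using N_ge_1 H_ge_1 \<delta> by (auto simp: w1_def w2_def)

lemma ln_w: "- ln w1 = \<beta> / 2" "- ln w2 \<le> \<beta>" "0 < \<beta>"
proof -
  have pos: "0 < real H" "0 < real N" using N_ge_1 H_ge_1 by auto
  show "- ln w1 = \<beta> / 2" using pos \<delta> by (simp add: w1_def \<beta>_eq ln_div ln_mult)
  have "ln (real H) \<ge> 0" "ln \<delta> \<le> 0" "ln (real N) \<ge> 0" using H_ge_1 N_ge_1 \<delta> by auto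
  then show "- ln w2 \<le> \<beta>" using pos \<delta> by (simp add: w2_def \<beta>_eq ln_div ln_mult ln_realpow)
  have "ln \<delta> < 0" using \<delta> by simp
  moreover have "\<beta> = 2 * (ln (real H) + ln (real N) - ln \<delta>)" using pos \<delta> by (simp add: \<beta>_eq ln_div ln_mult)
  moreover have "0 \<le> ln (real H) + ln (real N)" using \<open>ln (real H) \<ge> 0\<close> \<open>ln (real N) \<ge> 0\<close> by (rule add_nonneg_nonneg)
  ultimately show "0 < \<beta>" by auto
qed

text \<open>
  The likelihood ratios against \<open>Q\<close> keep \<open>Q\<close> in the confidence set, those of \<open>g\<close> against its own
  Bellman backup bound the errors of the tuples in it. The weights make the initial value at most \<open>\<delta>\<close>:
  the first family alone has \<open>H (N - 1)\<close> members and exhausts \<open>\<delta>\<close> up to the fraction \<open>1/N\<close>.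
\<close>

definition W :: "nat \<Rightarrow> ('x, 'a) history \<Rightarrow> ennreal" where
  "W n D = (\<Sum>h\<in>{1..H}. \<Sum>g\<in>F - {Q}. ennreal w1 * lr_process h Q g n D + ennreal w2 * lr_process h g g n D)
     + null_penalty n D"

lemma W_measurable: "j \<le> n \<Longrightarrow> n \<le> K \<Longrightarrow> W j \<in> borel_measurable (history_space M (Suc n))"
  unfolding W_def
  by (intro borel_measurable_add borel_measurable_sum borel_measurable_times_ennreal borel_measurable_const
      lr_process_measurable null_penalty_measurable optimal_q_in_F) auto

lemma W_upd: "j \<le> n \<Longrightarrow> W j (D(Suc n := d)) = W j D"
  unfolding W_def by (simp only: lr_process_upd null_penalty_upd)

text \<open>Each of the H(N - 1) pairs of step and function contributes w1 + w2, in total \<delta>(N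
  - 1)(N + 1)/N^2. With \<open>Q\<close> included the total would be \<delta>(N + 1)/N, which is too
  large.\<close>

lemma W_0: "W 0 D \<le> ennreal \<delta>"
proof -
  have c: "card (F - {Q}) = N - 1" using finite_F optimal_q_in_F by simp
  have "W 0 D = (\<Sum>h\<in>{1..H}. \<Sum>g\<in>F - {Q}. ennreal w1 + ennreal w2)"
    by (simp add: W_def lr_process_def null_penalty_def)
  also have "\<dots> = ennreal (real H * real (N - 1) * (w1 + w2))"
  proof -
    have "ennreal w1 + ennreal w2 = ennreal (w1 + w2)" using w_pos by (simp add: ennreal_plus)
    then show ?thesis
      using w_pos c by (simp only: sum_constant card_atLeastAtMost ennreal_of_nat_eq_real_of_nat ennreal_mult'
          of_nat_0_le_iff diff_Suc_1 mult.assoc mult_nonneg_nonneg)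
  qed
  also have "real H * real (N - 1) * (w1 + w2) = \<delta> * ((real N ^ 2 - 1) / real N ^ 2)"
    using N_ge_1 H_ge_1 by (simp add: w1_def w2_def of_nat_diff field_simps power2_eq_square)
  also have "\<dots> \<le> \<delta> * 1" using \<delta> N_ge_1 by (intro mult_left_mono) auto
  finally show ?thesis by (simp add: ennreal_leI)
qed

lemma W_step:
  assumes n: "n < K" and D: "D \<in> space (history_space M (Suc n))"
  shows "(\<integral>\<^sup>+d. W (Suc n) (D(Suc n := d)) \<partial>collect_law M ua (pol (Suc n) D)) \<le> W n D"
proof -
  let ?C = "collect_law M ua (pol (Suc n) D)"
  have "sets ?C = sets (round_space M)"
    using collect_law_in_space[OF pol_Suc_in_policies[OF n D]] by (simp add: space_prob_algebra)
  then have app: "(\<lambda>d. D(Suc n := d)) \<in> ?C \<rightarrow>\<^sub>M history_space M (Suc (Suc n))"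
    using append_round_measurable_section[OF D] measurable_cong_sets by blast
  have m1: "(\<lambda>d. lr_process h f g (Suc n) (D(Suc n := d))) \<in> borel_measurable ?C"
    if "f \<in> F" "g \<in> F" "h \<in> {1..H}" for f g h
    using n by (intro measurable_compose[OF app lr_process_measurable] that) auto
  have m2: "(\<lambda>d. null_penalty (Suc n) (D(Suc n := d))) \<in> borel_measurable ?C"
    using n by (intro measurable_compose[OF app null_penalty_measurable]) auto
  have eq: "(\<integral>\<^sup>+d. W (Suc n) (D(Suc n := d)) \<partial>?C) =
     (\<integral>\<^sup>+d. (\<Sum>h\<in>{1..H}. \<Sum>g\<in>F - {Q}. ennreal w1 * lr_process h Q g (Suc n) (D(Suc n := d))
        + ennreal w2 * lr_process h g g (Suc n) (D(Suc n := d))) \<partial>?C)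
      + (\<integral>\<^sup>+d. null_penalty (Suc n) (D(Suc n := d)) \<partial>?C)"
    unfolding W_def
    by (intro nn_integral_add borel_measurable_add borel_measurable_sum borel_measurable_times_ennreal
        borel_measurable_const m1 m2 optimal_q_in_F) auto
  have "(\<integral>\<^sup>+d. (\<Sum>h\<in>{1..H}. \<Sum>g\<in>F - {Q}. ennreal w1 * lr_process h Q g (Suc n) (D(Suc n := d))
        + ennreal w2 * lr_process h g g (Suc n) (D(Suc n := d))) \<partial>?C)
     = (\<Sum>h\<in>{1..H}. \<integral>\<^sup>+d. (\<Sum>g\<in>F - {Q}. ennreal w1 * lr_process h Q g (Suc n) (D(Suc n := d))
        + ennreal w2 * lr_process h g g (Suc n) (D(Suc n := d))) \<partial>?C)"
    by (intro nn_integral_sum borel_measurable_add borel_measurable_sum borel_measurable_times_ennreal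
        borel_measurable_const m1 optimal_q_in_F) auto
  also have "\<dots> = (\<Sum>h\<in>{1..H}. \<Sum>g\<in>F - {Q}. \<integral>\<^sup>+d. ennreal w1 * lr_process h Q g (Suc n) (D(Suc n := d))
        + ennreal w2 * lr_process h g g (Suc n) (D(Suc n := d)) \<partial>?C)"
    by (intro sum.cong refl nn_integral_sum borel_measurable_add borel_measurable_times_ennreal
        borel_measurable_const m1 optimal_q_in_F) auto
  also have "\<dots> \<le> (\<Sum>h\<in>{1..H}. \<Sum>g\<in>F - {Q}. ennreal w1 * lr_process h Q g n D + ennreal w2 * lr_process h g g n D)"
  proof (intro sum_mono)
    fix h g assume h: "h \<in> {1..H}" and "g \<in> F - {Q}"
    then have g: "g \<in> F" by simp
    note m = m1[OF optimal_q_in_F g h] m1[OF g g h]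
    have "(\<integral>\<^sup>+d. ennreal w1 * lr_process h Q g (Suc n) (D(Suc n := d))
        + ennreal w2 * lr_process h g g (Suc n) (D(Suc n := d)) \<partial>?C) =
      (\<integral>\<^sup>+d. ennreal w1 * lr_process h Q g (Suc n) (D(Suc n := d)) \<partial>?C)
        + (\<integral>\<^sup>+d. ennreal w2 * lr_process h g g (Suc n) (D(Suc n := d)) \<partial>?C)"
      by (intro nn_integral_add borel_measurable_times_ennreal borel_measurable_const m)
    also have "\<dots> = ennreal w1 * (\<integral>\<^sup>+d. lr_process h Q g (Suc n) (D(Suc n := d)) \<partial>?C)
        + ennreal w2 * (\<integral>\<^sup>+d. lr_process h g g (Suc n) (D(Suc n := d)) \<partial>?C)"
      by (simp only: nn_integral_cmult[OF m(1)] nn_integral_cmult[OF m(2)])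
    also have "\<dots> \<le> ennreal w1 * lr_process h Q g n D + ennreal w2 * lr_process h g g n D"
      by (intro add_mono mult_left_mono lr_process_step[OF n D] optimal_q_in_F g h) auto
    finally show "(\<integral>\<^sup>+d. ennreal w1 * lr_process h Q g (Suc n) (D(Suc n := d))
        + ennreal w2 * lr_process h g g (Suc n) (D(Suc n := d)) \<partial>?C)
      \<le> ennreal w1 * lr_process h Q g n D + ennreal w2 * lr_process h g g n D" .
  qed
  finally have "(\<integral>\<^sup>+d. (\<Sum>h\<in>{1..H}. \<Sum>g\<in>F - {Q}. ennreal w1 * lr_process h Q g (Suc n) (D(Suc n := d))
        + ennreal w2 * lr_process h g g (Suc n) (D(Suc n := d))) \<partial>?C)
     \<le> (\<Sum>h\<in>{1..H}. \<Sum>g\<in>F - {Q}. ennreal w1 * lr_process h Q g n D + ennreal w2 * lr_process h g g n D)" .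
  then show ?thesis
    unfolding eq null_penalty_step[OF n D] W_def[of n D] by (rule add_right_mono)
qed

lemma prob_W_gt_1: "emeasure (run_law M ua act K) {D \<in> space (run_law M ua act K). \<exists>j\<le>K. W j D > 1} \<le> ennreal \<delta>"
  using maximal_inequality[of W, OF W_measurable W_upd W_step] W_0 by (rule order_trans)

text \<open>All probability is confined to this predicate; what follows from it holds for each
  single run.\<close>

definition good :: "('x, 'a) history \<Rightarrow> bool" where
  "good D \<longleftrightarrow> D \<in> space (history_space M (Suc K)) \<and> (\<forall>j\<le>K. W j D \<le> 1)"

lemma measure_ge_if_good:
  assumes A: "A \<in> sets (run_law M ua act K)" and good: "\<And>D. good D \<Longrightarrow> D \<in> A"
  shows "measure (run_law M ua act K) A \<ge> 1 - \<delta>"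
proof -
  interpret prob_space "run_law M ua act K" by (rule prob_space_run_law) simp
  have "space (run_law M ua act K) - A \<subseteq> {D \<in> space (run_law M ua act K). \<exists>j\<le>K. W j D > 1}"
    using good unfolding good_def space_run_law[OF order_refl] by (auto simp: not_less[symmetric])
  moreover have "{D \<in> space (run_law M ua act K). \<exists>j\<le>K. W j D > 1} \<in> sets (run_law M ua act K)"
  proof -
    have "Measurable.pred (history_space M (Suc K)) (\<lambda>D. \<exists>j\<in>{..K}. W j D > 1)"
    proof (rule pred_intros_finite)
      fix j assume "j \<in> {..K}"
      then have [measurable]: "W j \<in> borel_measurable (history_space M (Suc K))" using W_measurable by simp
      show "Measurable.pred (history_space M (Suc K)) (\<lambda>D. W j D > 1)" by measurable
    qed simp
    then show ?thesis
      unfolding space_run_law[OF order_refl] sets_run_law[OF order_refl]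
      by (simp only: Bex_def atMost_iff pred_def)
  qed
  ultimately have "emeasure (run_law M ua act K) (space (run_law M ua act K) - A) \<le> ennreal \<delta>"
    using prob_W_gt_1 by (meson emeasure_mono order_trans)
  then have "prob (space (run_law M ua act K) - A) \<le> \<delta>"
    using \<delta> by (simp add: emeasure_eq_measure)
  then show ?thesis using prob_compl[OF A] by simp
qed

section \<open>Consequences of the good event\<close>

context
  fixes D assumes good: "good D"
begin

text \<open>A single violation would make \<open>W\<close> infinite. In particular, all targets of
  the run lie in [0,1].\<close>

lemma good_compatible:
  assumes i: "i \<in> {1..K}" and h: "h \<in> {1..H}" and f: "f \<in> F"
  shows "compatible (backup f h (obs_act_of (D i h))) (target f h (D i h))"
proof (rule ccontr)
  assume "\<not> ?thesis"
  then have "\<top> = (\<top> * indicator (incompatible h f) (D i h) :: ennreal)" by (simp add: incompatible_def)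
  also have "\<dots> \<le> (\<Sum>f\<in>F. \<top> * indicator (incompatible h f) (D i h))"
    using finite_F f by (intro member_le_sum) auto
  also have "\<dots> \<le> (\<Sum>h\<in>{1..H}. \<Sum>f\<in>F. \<top> * indicator (incompatible h f) (D i h))"
    using h by (intro member_le_sum[of h "{1..H}" "\<lambda>h. \<Sum>f\<in>F. \<top> * indicator (incompatible h f) (D i h)"]) auto
  also have "\<dots> \<le> null_penalty K D"
    unfolding null_penalty_def
    using i by (intro member_le_sum[of i "{1..K}" "\<lambda>i. \<Sum>h\<in>{1..H}. \<Sum>f\<in>F. \<top> * indicator (incompatible h f) (D i h)"]) auto
  also have "\<dots> \<le> W K D" by (simp add: W_def)
  also have "\<dots> \<le> 1" using good by (simp add: good_def)
  finally show False by (simp add: top_unique)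
qed

lemma good_lr_process:
  assumes h: "h \<in> {1..H}" and g: "g \<in> F - {Q}" and j: "j \<le> K"
  shows "ennreal w1 * lr_process h Q g j D \<le> 1" and "ennreal w2 * lr_process h g g j D \<le> 1"
proof -
  let ?t = "\<lambda>h g. ennreal w1 * lr_process h Q g j D + ennreal w2 * lr_process h g g j D"
  have "?t h g \<le> (\<Sum>g\<in>F - {Q}. ?t h g)"
    using finite_F g by (intro member_le_sum[of g "F - {Q}" "?t h"]) auto
  also have "\<dots> \<le> (\<Sum>h\<in>{1..H}. \<Sum>g\<in>F - {Q}. ?t h g)"
    using h by (intro member_le_sum[of h "{1..H}" "\<lambda>h. \<Sum>g\<in>F - {Q}. ?t h g"]) auto
  also have "\<dots> \<le> W j D" by (simp add: W_def)
  also have "\<dots> \<le> 1" using good j by (simp add: good_def)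
  finally have *: "?t h g \<le> 1" .
  show "ennreal w1 * lr_process h Q g j D \<le> 1" "ennreal w2 * lr_process h g g j D \<le> 1"
    by (rule order_trans[OF _ *]; simp)+
qed

lemma err_nonneg: "f \<in> F \<Longrightarrow> g \<in> F \<Longrightarrow> h \<in> {1..H} \<Longrightarrow> 0 \<le> err h f g i D"
  unfolding err_def using hell_01 by (intro integral_nonneg_AE) auto

text \<open>Logarithm of the bound on the weighted process: the product of ratios dominates half the
  loss difference from below in the exponent, and the compensators become the error sum. For f =
  \<open>Q\<close> this tests \<open>Q\<close> against g; for g = f it tests f against its own
  backup.\<close>

lemma sum_loss_diff_le:
  assumes f: "f \<in> F" and g: "g \<in> F" and h: "h \<in> {1..H}" and j: "j \<le> K" and w: "0 < w"
    and le: "ennreal w * lr_process h f g j D \<le> 1"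
    and comp: "\<And>i. i \<in> {1..j} \<Longrightarrow> compatible (g h (obs_act_of (D i h))) (target f h (D i h))"
  shows "(\<Sum>i\<in>{1..j}. bce_real (backup f h (obs_act_of (D i h))) (target f h (D i h)))
      - (\<Sum>i\<in>{1..j}. bce_real (g h (obs_act_of (D i h))) (target f h (D i h)))
      + 2 * (\<Sum>i\<in>{1..j}. err h f g i D) \<le> 2 * (- ln w)"
proof -
  let ?P = "\<Prod>i\<in>{1..j}. lr h f g (D i h)" and ?E = "\<Sum>i\<in>{1..j}. err h f g i D"
  have P: "0 < ?P" and d: "(\<Sum>i\<in>{1..j}. bce_real (backup f h (obs_act_of (D i h))) (target f h (D i h)))
      - (\<Sum>i\<in>{1..j}. bce_real (g h (obs_act_of (D i h))) (target f h (D i h))) \<le> 2 * ln ?P"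
    using sum_bce_real_diff_le[of "{1..j}" "\<lambda>i. backup f h (obs_act_of (D i h))" "\<lambda>i. target f h (D i h)" "\<lambda>i. g h (obs_act_of (D i h))"]
      good_compatible[OF _ h f] comp backup_01[OF f h] F_01[OF g] j
    by (auto simp: lr_def)
  have pos: "0 \<le> lr h f g (D i h)" if "i \<in> {1..j}" for i
    using bce_real_diff_le(1)[OF backup_01[OF f h] good_compatible[OF _ h f] F_01[OF g] comp[OF that]] that j
    by (auto simp: lr_def less_imp_le)
  have "lr_process h f g j D = ennreal (\<Prod>i\<in>{1..j}. lr h f g (D i h) * exp (err h f g i D))"
    unfolding lr_process_def using pos by (subst prod_ennreal[symmetric]) (auto simp: ennreal_mult' intro!: prod.cong)
  also have "(\<Prod>i\<in>{1..j}. lr h f g (D i h) * exp (err h f g i D)) = ?P * exp ?E"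
    by (simp add: prod.distrib exp_sum)
  finally have "ennreal (w * (?P * exp ?E)) \<le> 1" using le w by (simp add: ennreal_mult')
  then have "w * (?P * exp ?E) \<le> 1" by simp
  then have "ln (w * (?P * exp ?E)) \<le> ln 1" using w P by (subst ln_le_cancel_iff) auto
  moreover have "ln (w * (?P * exp ?E)) = ln w + (ln ?P + ?E)"
    using w P by (simp only: ln_mult_pos mult_pos_pos exp_gt_zero ln_exp)
  ultimately have "ln w + ln ?P + ?E \<le> 0" by simp
  then show ?thesis using d by simp
qed

lemma emp_loss_eq:
  "emp_loss bce_loss k (restrict D {1..<k}) h fh (f (Suc h)) =
    (\<Sum>i\<in>{1..<k}. bce_loss (fh (obs_act_of (D i h))) (target f h (D i h)))"
  unfolding emp_loss_def
  by (intro sum.cong) (auto simp: target_def obs_act_of_def obs_of_def act_of_def cost_of_def next_of_def split_beta')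

lemma good_target_01: "i \<in> {1..K} \<Longrightarrow> h \<in> {1..H} \<Longrightarrow> f \<in> F \<Longrightarrow> target f h (D i h) \<in> {0..1}"
  using good_compatible by (auto simp: compatible_def)

lemma emp_loss_real:
  assumes f: "f \<in> F" and g: "g \<in> F" and h: "h \<in> {1..H}" and k: "k \<in> {1..K}"
  shows "emp_loss bce_loss k (restrict D {1..<k}) h (g h) (f (Suc h)) =
    (if \<forall>i\<in>{1..k - 1}. compatible (g h (obs_act_of (D i h))) (target f h (D i h))
     then ereal (\<Sum>i\<in>{1..k - 1}. bce_real (g h (obs_act_of (D i h))) (target f h (D i h))) else \<infinity>)"
proof -
  have "{1..<k} = {1..k - 1}" using k by auto
  then show ?thesis
    unfolding emp_loss_eq using F_01[OF g] good_target_01[OF _ h f] k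
    by (subst sum_bce_loss_eq) auto
qed

text \<open>\<open>Q\<close> is its own backup, so its excess loss over the minimiser is at most -2
  ln w1 = \<beta>, after dropping the nonnegative errors.\<close>

lemma optimal_q_in_confidence_set:
  assumes k: "k \<in> {1..K}"
  shows "Q \<in> confidence_set M F bce_loss \<beta> k (restrict D {1..<k})"
  unfolding confidence_set_def
proof (intro CollectI conjI ballI optimal_q_in_F)
  fix h assume h: "h \<in> {1..H}"
  let ?L = "\<lambda>g. emp_loss bce_loss k (restrict D {1..<k}) h g (Q (Suc h))"
  have "(MIN g\<in>component F h. ?L g) \<in> ?L ` component F h"
    using finite_F optimal_q_in_F by (intro Min_in) (auto simp: component_def)
  then obtain g where g: "g \<in> F" and min: "(MIN g\<in>component F h. ?L g) = ?L (g h)"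
    by (auto simp: component_def)
  have cQ: "\<forall>i\<in>{1..k - 1}. compatible (Q h (obs_act_of (D i h))) (target Q h (D i h))"
    using good_compatible[OF _ h optimal_q_in_F] backup_optimal_q[OF h] k by auto
  show "?L (Q h) - (MIN g\<in>component F h. ?L g) \<le> ereal \<beta>"
  \<comment> \<open>A minimiser equal to \<open>Q\<close> has no process in \<open>W\<close>, and
    one of infinite loss would make the difference -\<infinity>; both cases are immediate because
    the loss of \<open>Q\<close> is finite.\<close>
  proof (cases "g = Q \<or> (\<exists>i\<in>{1..k - 1}. \<not> compatible (g h (obs_act_of (D i h))) (target Q h (D i h)))")
    case True
    then show ?thesis
      unfolding min emp_loss_real[OF optimal_q_in_F g h k] emp_loss_real[OF optimal_q_in_F optimal_q_in_F h k]
      using cQ ln_w(3) by auto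
  next
    case False
    then have g': "g \<in> F - {Q}" using g by simp
    have j: "k - 1 \<le> K" using k by auto
    have "(\<Sum>i\<in>{1..k - 1}. bce_real (Q h (obs_act_of (D i h))) (target Q h (D i h)))
      - (\<Sum>i\<in>{1..k - 1}. bce_real (g h (obs_act_of (D i h))) (target Q h (D i h)))
      + 2 * (\<Sum>i\<in>{1..k - 1}. err h Q g i D) \<le> \<beta>"
      using sum_loss_diff_le[OF optimal_q_in_F g h j w_pos(1) good_lr_process(1)[OF h g' j]] False
      by (auto simp: backup_optimal_q[OF h] ln_w)
    moreover have "0 \<le> (\<Sum>i\<in>{1..k - 1}. err h Q g i D)"
      by (intro sum_nonneg err_nonneg optimal_q_in_F g h)
    ultimately show ?thesis
      unfolding min emp_loss_real[OF optimal_q_in_F g h k] emp_loss_real[OF optimal_q_in_F optimal_q_in_F h k]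
      using cQ False by auto
  qed
qed

text \<open>By completeness the backup of f competes in the minimum, so the loss of f exceeds that
  of its backup by at most \<beta>. The ratio bound gives the reverse comparison with twice the
  errors added; together 2 * errors \<le> \<beta> + 2\<beta>.\<close>

lemma confidence_set_err_le:
  assumes k: "k \<in> {1..K}" and f: "f \<in> confidence_set M F bce_loss \<beta> k (restrict D {1..<k})"
    and h: "h \<in> {1..H}"
  shows "(\<Sum>i\<in>{1..<k}. err h f f i D) \<le> 3 / 2 * \<beta>"
proof (cases "f = Q")
  case True
  then have "err h f f i D = 0" for i by (simp add: err_def backup_optimal_q[OF h])
  then show ?thesis using ln_w by simp
next
  case False
  let ?L = "\<lambda>g. emp_loss bce_loss k (restrict D {1..<k}) h g (f (Suc h))"
  have fF: "f \<in> F" and conf: "?L (f h) - (MIN g\<in>component F h. ?L g) \<le> ereal \<beta>"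
    using f h by (auto simp: confidence_set_def)
  obtain g where g: "g \<in> F" "backup f h = g h" using backup_component[OF fF h] by blast
  have cb: "\<forall>i\<in>{1..k - 1}. compatible (g h (obs_act_of (D i h))) (target f h (D i h))"
    using good_compatible[OF _ h fF] g(2) k by auto
  have "(MIN g\<in>component F h. ?L g) \<le> ?L (g h)"
    using finite_F g by (intro Min_le) (auto simp: component_def)
  then have le: "?L (f h) - ?L (g h) \<le> ereal \<beta>"
    using conf by (meson ereal_minus_mono order_refl order_trans)
  \<comment> \<open>In \<open>ereal\<close>, \<infinity> minus anything is \<infinity>, so
    membership in the confidence set forces a finite loss.\<close>
  have cf: "\<forall>i\<in>{1..k - 1}. compatible (f h (obs_act_of (D i h))) (target f h (D i h))"
  proof (rule ccontr)
    assume "\<not> ?thesis"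
    then have "?L (f h) = \<infinity>" unfolding emp_loss_real[OF fF fF h k] by auto
    then show False using le by simp
  qed
  have real: "(\<Sum>i\<in>{1..k - 1}. bce_real (f h (obs_act_of (D i h))) (target f h (D i h)))
      - (\<Sum>i\<in>{1..k - 1}. bce_real (backup f h (obs_act_of (D i h))) (target f h (D i h))) \<le> \<beta>"
    using le cf cb unfolding emp_loss_real[OF fF fF h k] emp_loss_real[OF fF g(1) h k] by (simp add: g(2))
  have j: "k - 1 \<le> K" using k by auto
  have f': "f \<in> F - {Q}" using fF False by simp
  have "2 * (\<Sum>i\<in>{1..k - 1}. err h f f i D) \<le> 2 * (- ln w2) + \<beta>"
    using sum_loss_diff_le[OF fF fF h j w_pos(2) good_lr_process(2)[OF h f' j]] cf real by auto
  also have "\<dots> \<le> 3 * \<beta>" using ln_w by simp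
  finally have "(\<Sum>i\<in>{1..k - 1}. err h f f i D) \<le> 3 / 2 * \<beta>" by simp
  moreover have "{1..<k} = {1..k - 1}" using k by auto
  ultimately show ?thesis by simp
qed

end

end

section \<open>Regret in terms of Bellman errors\<close>

context value_class begin

context
  fixes \<pi> h
  assumes \<pi>: "\<pi> \<in> policies M" and h: "h \<in> {1..H}"
begin

lemma prob_space_trans_law: "prob_space (trans_law M \<pi> h)"
  and sets_trans_law: "sets (trans_law M \<pi> h) = sets T"
  using trans_law_in_space[OF \<pi> h] by (auto simp: space_prob_algebra)

lemma trans_law_measurable: "\<phi> \<in> borel_measurable T \<Longrightarrow> \<phi> \<in> borel_measurable (trans_law M \<pi> h)"
  using measurable_cong_sets[OF sets_trans_law refl] by blast

lemma integrable_trans_law: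
  fixes \<phi> :: "('x, 'a) transition \<Rightarrow> real"
  assumes "\<phi> \<in> borel_measurable T" "AE s in trans_law M \<pi> h. \<phi> s \<in> {0..1}"
  shows "integrable (trans_law M \<pi> h) \<phi>"
proof -
  interpret prob_space "trans_law M \<pi> h" by (rule prob_space_trans_law)
  show ?thesis
    by (intro integrable_const_bound[of _ 1] trans_law_measurable[OF assms(1)])
      (rule eventually_mono[OF assms(2)], simp)
qed

lemma AE_trans_law_cost: "AE s in trans_law M \<pi> h. cost_of s \<in> {0..1}"
proof -
  have "AE w in outcome_law M h z. fst w \<in> {0..1}" for z
  proof -
    have d: "distr (outcome_law M h z) (cost_kernel M h z) fst = cost_kernel M h z"
      unfolding outcome_law_def using kernel_props[OF h, of z] by (intro prob_space.distr_pair_fst)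
    have "fst \<in> outcome_law M h z \<rightarrow>\<^sub>M cost_kernel M h z"
      unfolding outcome_law_def by (rule measurable_fst)
    moreover have "{c \<in> space (cost_kernel M h z). c \<in> {0..1}} \<in> sets (cost_kernel M h z)"
      using sets_eq_imp_space_eq[OF kernel_props(2)[OF h, of z]] kernel_props(2)[OF h, of z] by simp
    ultimately show ?thesis
      using AE_distr_iff[of fst "outcome_law M h z" "cost_kernel M h z" "\<lambda>c. c \<in> {0..1}"] cost_kernel_AE[OF h, of z] d
      by (simp only:)
  qed
  then have inner: "AE w in outcome_law M h (x, a). cost_of (x, a, w) \<in> {0..1}" for x a
    by (simp add: cost_of_def split_beta')
  have m: "Measurable.pred T (\<lambda>s. cost_of s \<in> {0..1})" by measurable
  show ?thesis
    unfolding trans_law_eq_bind[OF \<pi> h] AE_mix_iterated[OF obs_law_in_space[OF \<pi> h] h policyD[OF \<pi> h] m]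
    using inner by simp
qed

lemma integral_trans_law_target:
  assumes f: "f \<in> F"
  shows "(\<integral>s. target f h s \<partial>trans_law M \<pi> h) = (\<integral>s. backup f h (obs_act_of s) \<partial>trans_law M \<pi> h)"
  using integral_target[OF obs_law_in_space[OF \<pi> h] h policyD[OF \<pi> h] f] AE_trans_law_target[OF \<pi> h f]
  unfolding trans_law_eq_bind[OF \<pi> h] by blast

lemma Min_obs_measurable:
  assumes f: "f \<in> F"
  shows "(\<lambda>s. MIN a. f h (obs_of s, a)) \<in> borel_measurable T"
    and "(\<lambda>s. MIN a. f (Suc h) (next_of s, a)) \<in> borel_measurable T"
  by (rule measurable_compose[OF obs_of_measurable Min_F_measurable[OF f]])
    (rule measurable_compose[OF next_of_measurable Min_F_measurable[OF f]])

lemma integral_trans_law_backup: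
  assumes f: "f \<in> F"
  shows "(\<integral>s. backup f h (obs_act_of s) \<partial>trans_law M \<pi> h) =
    (\<integral>s. cost_of s \<partial>trans_law M \<pi> h) + (\<integral>s. (MIN a. f (Suc h) (next_of s, a)) \<partial>trans_law M \<pi> h)"
proof -
  have "integrable (trans_law M \<pi> h) cost_of"
    by (intro integrable_trans_law AE_trans_law_cost cost_of_measurable)
  moreover have "integrable (trans_law M \<pi> h) (\<lambda>s. MIN a. f (Suc h) (next_of s, a))"
    using Min_F_01[OF f] by (intro integrable_trans_law Min_obs_measurable f) auto
  ultimately have "(\<integral>s. target f h s \<partial>trans_law M \<pi> h) =
    (\<integral>s. cost_of s \<partial>trans_law M \<pi> h) + (\<integral>s. (MIN a. f (Suc h) (next_of s, a)) \<partial>trans_law M \<pi> h)"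
    unfolding target_def by (rule Bochner_Integration.integral_add)
  then show ?thesis unfolding integral_trans_law_target[OF f] .
qed

lemma integral_obs_law:
  assumes \<phi>: "\<phi> \<in> borel_measurable S"
  shows "(\<integral>x. \<phi> x \<partial>obs_law M \<pi> h) = (\<integral>s. (\<phi> (obs_of s) :: real) \<partial>trans_law M \<pi> h)"
  unfolding obs_law_eq_distr[OF \<pi> h]
  using obs_of_measurable measurable_cong_sets[OF sets_trans_law refl] \<phi> by (intro integral_distr) blast+

lemma integral_obs_act_law:
  assumes \<phi>: "\<phi> \<in> borel_measurable Z"
  shows "(\<integral>z. \<phi> z \<partial>obs_act_law M \<pi> h) = (\<integral>s. (\<phi> (obs_act_of s) :: real) \<partial>trans_law M \<pi> h)"
  unfolding obs_act_law_eq_distr[OF \<pi> h] obs_act_of_def[symmetric]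
  using obs_act_of_measurable measurable_cong_sets[OF sets_trans_law refl] \<phi> by (intro integral_distr) blast+

end

section \<open>Decomposition of values and optimism\<close>

lemma policy_value_eq:
  assumes \<pi>: "\<pi> \<in> policies M"
  shows "policy_value M \<pi> = (\<Sum>h=1..H. \<integral>s. cost_of s \<partial>trans_law M \<pi> h)"
proof -
  have m: "(\<lambda>\<tau>. \<tau> h) \<in> episode M \<pi> \<rightarrow>\<^sub>M T" if "h \<in> {1..H}" for h
    using measurable_component_episode[OF \<pi> that order_refl] by (simp add: episode_def)
  have "integrable (episode M \<pi>) (\<lambda>\<tau>. cost_of (\<tau> h))" if h: "h \<in> {1..H}" for h
  proof -
    have "integrable (trans_law M \<pi> h) cost_of"
      by (intro integrable_trans_law \<pi> h AE_trans_law_cost cost_of_measurable)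
    then show ?thesis unfolding trans_law_def by (rule integrable_distr[OF m[OF h]])
  qed
  then have "policy_value M \<pi> = (\<Sum>h=1..H. \<integral>\<tau>. cost_of (\<tau> h) \<partial>episode M \<pi>)"
    unfolding policy_value_def by (intro Bochner_Integration.integral_sum)
  also have "\<dots> = (\<Sum>h=1..H. \<integral>s. cost_of s \<partial>trans_law M \<pi> h)"
    unfolding trans_law_def by (intro sum.cong refl integral_distr[symmetric] m cost_of_measurable)
  finally show ?thesis .
qed

definition min_value :: "('x, 'a) policy \<Rightarrow> ('x, 'a) ftuple \<Rightarrow> nat \<Rightarrow> real" where
  "min_value \<pi> f h = (\<integral>s. (MIN a. f h (obs_of s, a)) \<partial>trans_law M \<pi> h)"

definition backup_value :: "('x, 'a) policy \<Rightarrow> ('x, 'a) ftuple \<Rightarrow> nat \<Rightarrow> real" where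
  "backup_value \<pi> f h = (\<integral>s. backup f h (obs_act_of s) \<partial>trans_law M \<pi> h)"

lemma min_value_1:
  assumes "\<pi> \<in> policies M" "f \<in> F"
  shows "min_value \<pi> f 1 = (MIN a. f 1 (init_obs M, a))"
proof -
  have h: "1 \<in> {1..H}" using H_ge_1 by simp
  show ?thesis
    unfolding min_value_def integral_obs_law[OF assms(1) h Min_F_measurable[OF assms(2)], symmetric] obs_law_1[OF assms(1)]
    by (rule integral_return[OF _ Min_F_measurable[OF assms(2)]]) simp
qed

text \<open>The next observation of step h has the observation law of step h + 1. The last step is
  separate: \<open>min_value\<close> at \<open>Suc H\<close> would refer to a step outside the
  episode.\<close>

lemma backup_value_eq:
  assumes \<pi>: "\<pi> \<in> policies M" and f: "f \<in> F" and h: "h \<in> {1..H}"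
  shows "backup_value \<pi> f h = (\<integral>s. cost_of s \<partial>trans_law M \<pi> h) + (if h = H then 0 else min_value \<pi> f (Suc h))"
proof (cases "h = H")
  case True
  then have "f (Suc h) = (\<lambda>_. 0)" using fclass f by (auto simp: function_class_def)
  then show ?thesis using True integral_trans_law_backup[OF \<pi> h f] by (simp add: backup_value_def)
next
  case False
  then have h': "h \<in> {1..<H}" "Suc h \<in> {1..H}" using h by auto
  have n: "next_of \<in> trans_law M \<pi> h \<rightarrow>\<^sub>M S"
    using next_of_measurable measurable_cong_sets[OF sets_trans_law[OF \<pi> h] refl] by blast
  have "min_value \<pi> f (Suc h) = (\<integral>x. (MIN a. f (Suc h) (x, a)) \<partial>obs_law M \<pi> (Suc h))"
    unfolding min_value_def by (rule integral_obs_law[OF \<pi> h'(2) Min_F_measurable[OF f], symmetric])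
  also have "\<dots> = (\<integral>s. (MIN a. f (Suc h) (next_of s, a)) \<partial>trans_law M \<pi> h)"
    unfolding obs_law_Suc[OF \<pi> h'(1)] by (rule integral_distr[OF n Min_F_measurable[OF f]])
  finally show ?thesis using False integral_trans_law_backup[OF \<pi> h f] by (simp add: backup_value_def)
qed

text \<open>Expected backups are costs plus the next \<open>min_value\<close>, so the sum
  telescopes. The policy is arbitrary, which allows the same identity to be used for greedy policies
  and for \<open>optimal_q\<close>.\<close>

lemma value_difference:
  assumes \<pi>: "\<pi> \<in> policies M" and f: "f \<in> F"
  shows "policy_value M \<pi> - (MIN a. f 1 (init_obs M, a)) = (\<Sum>h=1..H. backup_value \<pi> f h - min_value \<pi> f h)"
proof -
  let ?e = "\<lambda>h. if h \<le> H then min_value \<pi> f h else 0"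
  have "(\<Sum>h=1..H. backup_value \<pi> f h - min_value \<pi> f h) =
      (\<Sum>h=1..H. (\<integral>s. cost_of s \<partial>trans_law M \<pi> h) + (?e (Suc h) - ?e h))"
    using backup_value_eq[OF \<pi> f] by (intro sum.cong) auto
  also have "\<dots> = policy_value M \<pi> + (\<Sum>h=1..H. ?e (Suc h) - ?e h)"
    by (simp only: sum.distrib policy_value_eq[OF \<pi>])
  also have "(\<Sum>h=1..H. ?e (Suc h) - ?e h) = ?e (Suc H) - ?e 1"
    by (rule sum_Suc_diff) simp
  finally show ?thesis using H_ge_1 min_value_1[OF \<pi> f] by simp
qed

lemma policies_nonempty: "policies M \<noteq> {}"
proof -
  have "(\<lambda>_ _. uniform_count_measure UNIV) \<in> policies M"
    using uniform_in_space by (simp add: policies_def)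
  then show ?thesis by blast
qed

text \<open>\<open>optimal_q\<close> is its own backup, so in its value difference against any
  policy each term is the mean of a value minus a minimum over actions, hence nonnegative. No
  optimal policy has to be constructed.\<close>

lemma optimal_q_le_opt_value: "(MIN a. optimal_q M 1 (init_obs M, a)) \<le> opt_value M"
  unfolding opt_value_def
proof (rule cINF_greatest[OF policies_nonempty])
  fix \<pi> assume \<pi>: "\<pi> \<in> policies M"
  let ?Q = "optimal_q M"
  have "min_value \<pi> ?Q h \<le> backup_value \<pi> ?Q h" if h: "h \<in> {1..H}" for h
    unfolding min_value_def backup_value_def backup_optimal_q[OF h]
  proof (rule integral_mono)
    show "integrable (trans_law M \<pi> h) (\<lambda>s. MIN a. ?Q h (obs_of s, a))"
      using Min_F_01[OF optimal_q_in_F]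
      by (intro integrable_trans_law \<pi> h Min_obs_measurable(1)[OF \<pi> h] optimal_q_in_F) auto
    show "integrable (trans_law M \<pi> h) (\<lambda>s. ?Q h (obs_act_of s))"
      using F_01[OF optimal_q_in_F]
      by (intro integrable_trans_law \<pi> h measurable_compose[OF obs_act_of_measurable F_measurable] optimal_q_in_F) auto
    show "(MIN a. ?Q h (obs_of s, a)) \<le> ?Q h (obs_act_of s)" for s
      unfolding obs_act_of_def by (intro Min_le) auto
  qed
  then have "0 \<le> (\<Sum>h=1..H. backup_value \<pi> ?Q h - min_value \<pi> ?Q h)" by (intro sum_nonneg) auto
  then show "(MIN a. ?Q 1 (init_obs M, a)) \<le> policy_value M \<pi>"
    using value_difference[OF \<pi> optimal_q_in_F] by simp
qed

lemma opt_value_nonneg: "0 \<le> opt_value M"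
  using Min_F_01[OF optimal_q_in_F, of 1 "init_obs M"] optimal_q_le_opt_value
  unfolding atLeastAtMost_iff by linarith

lemma greedy_policy_value_le:
  assumes \<pi>: "\<pi> \<in> policies M" and f: "f \<in> F"
    and greedy: "\<And>h x. h \<in> {1..H} \<Longrightarrow> \<pi> h x = return AS (a h x)" "\<And>h x. h \<in> {1..H} \<Longrightarrow> (MIN b. f h (x, b)) = f h (x, a h x)"
    and optimistic: "(MIN a. f 1 (init_obs M, a)) \<le> v" and v: "0 \<le> v" and m: "real H \<le> m"
  shows "policy_value M \<pi> - (MIN a. f 1 (init_obs M, a))
    \<le> 3 * real H * v / m + 16 * m * (\<Sum>h=1..H. \<integral>s. hell h f f (obs_act_of s) \<partial>trans_law M \<pi> h)"
proof -
  have m1: "1 \<le> m" using m H_ge_1 by linarith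
  \<comment> \<open>Zero outside the episode, since the recursion lemma asks for nonnegative errors
    at all indices.\<close>
  define \<epsilon> where "\<epsilon> h = (if h \<in> {1..H} then \<integral>s. hell h f f (obs_act_of s) \<partial>trans_law M \<pi> h else 0)" for h
  have eqf: "min_value \<pi> f h = (\<integral>s. f h (obs_act_of s) \<partial>trans_law M \<pi> h)" if h: "h \<in> {1..H}" for h
    unfolding min_value_def
  proof (rule integral_cong_AE)
    show "(\<lambda>s. MIN a. f h (obs_of s, a)) \<in> borel_measurable (trans_law M \<pi> h)"
      by (rule trans_law_measurable[OF \<pi> h Min_obs_measurable(1)[OF \<pi> h f]])
    show "(\<lambda>s. f h (obs_act_of s)) \<in> borel_measurable (trans_law M \<pi> h)"
      by (intro trans_law_measurable \<pi> h measurable_compose[OF obs_act_of_measurable F_measurable] f)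
    have P: "Measurable.pred T (\<lambda>s. (MIN a. f h (obs_of s, a)) = f h (obs_act_of s))"
    proof -
      note [measurable] = Min_obs_measurable(1)[OF \<pi> h f] measurable_compose[OF obs_act_of_measurable F_measurable[OF f, of h]]
      show ?thesis by measurable
    qed
    show "AE s in trans_law M \<pi> h. (MIN a. f h (obs_of s, a)) = f h (obs_act_of s)"
      unfolding trans_law_eq_bind[OF \<pi> h] AE_mix_iterated[OF obs_law_in_space[OF \<pi> h] h policyD[OF \<pi> h] P]
      unfolding greedy(1)[OF h]
      by (rule AE_I2) (simp add: AE_return obs_of_def obs_act_of_def act_of_def greedy(2)[OF h])
  qed
  have "(\<Sum>h=1..H. backup_value \<pi> f h - min_value \<pi> f h) \<le> 3 * real H * v / m + 16 * m * (\<Sum>h=1..H. \<epsilon> h)"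
  proof (rule bellman_error_sum_le[OF H_ge_1 m])
    show "0 \<le> \<epsilon> h" for h
      unfolding \<epsilon>_def using hell_01[OF f f] by (auto intro!: integral_nonneg_AE)
    show "0 \<le> v" by (rule v)
    show "min_value \<pi> f 1 \<le> v" using optimistic min_value_1[OF \<pi> f] by simp
  next
    fix h assume h: "h \<in> {1..H}"
    have int: "integrable (trans_law M \<pi> h) (\<lambda>s. f h (obs_act_of s))" "integrable (trans_law M \<pi> h) (\<lambda>s. backup f h (obs_act_of s))"
      "integrable (trans_law M \<pi> h) (\<lambda>s. hell h f f (obs_act_of s))"
      by (rule integrable_trans_law[OF \<pi> h measurable_compose[OF obs_act_of_measurable F_measurable[OF f]] AE_I2[OF F_01[OF f]]]
          integrable_trans_law[OF \<pi> h measurable_compose[OF obs_act_of_measurable backup_measurable[OF f h]] AE_I2[OF backup_01[OF f h]]]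
          integrable_trans_law[OF \<pi> h hell_obs_act_of_measurable[OF f f h] AE_I2[OF hell_01[OF f f h]]])+
    have "backup_value \<pi> f h - min_value \<pi> f h = (\<integral>s. backup f h (obs_act_of s) - f h (obs_act_of s) \<partial>trans_law M \<pi> h)"
      unfolding backup_value_def eqf[OF h] using int by simp
    also have "\<dots> \<le> (\<integral>s. f h (obs_act_of s) / m + 4 * m * hell h f f (obs_act_of s) \<partial>trans_law M \<pi> h)"
    proof (rule integral_mono)
      fix s
      have "backup f h (obs_act_of s) - f h (obs_act_of s) \<le> f h (obs_act_of s) / m + (2 * m + 2) * hell h f f (obs_act_of s)"
        using backup_01[OF f h] F_01[OF f] m1 by (intro diff_le_hellinger_ber) auto
      \<comment> \<open>2m + 2 \<le> 4m because m \<ge> 1.\<close>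
      also have "\<dots> \<le> f h (obs_act_of s) / m + 4 * m * hell h f f (obs_act_of s)"
        using m1 hellinger_ber_nonneg by (intro add_mono mult_right_mono) auto
      finally show "backup f h (obs_act_of s) - f h (obs_act_of s) \<le> f h (obs_act_of s) / m + 4 * m * hell h f f (obs_act_of s)" .
    qed (use int in auto)
    also have "\<dots> = min_value \<pi> f h / m + 4 * m * \<epsilon> h"
      unfolding eqf[OF h] \<epsilon>_def using int h by simp
    finally show "backup_value \<pi> f h - min_value \<pi> f h \<le> min_value \<pi> f h / m + 4 * m * \<epsilon> h" .
  next
    fix h assume h: "h \<in> {1..<H}"
    then have h': "h \<in> {1..H}" by simp
    \<comment> \<open>Dropping the nonnegative cost leaves the next estimate below the current
      backup.\<close>
    have "0 \<le> (\<integral>s. cost_of s \<partial>trans_law M \<pi> h)"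
      using AE_trans_law_cost[OF \<pi> h'] by (intro integral_nonneg_AE) (auto elim!: eventually_mono)
    then show "min_value \<pi> f (Suc h) \<le> backup_value \<pi> f h"
      using backup_value_eq[OF \<pi> f h'] h by simp
  qed
  also have "(\<Sum>h=1..H. \<epsilon> h) = (\<Sum>h=1..H. \<integral>s. hell h f f (obs_act_of s) \<partial>trans_law M \<pi> h)"
    by (intro sum.cong) (auto simp: \<epsilon>_def)
  finally show ?thesis unfolding value_difference[OF \<pi> f] .
qed

section \<open>From uniform to rolled-in actions\<close>

lemma integral_data_law_uniform:
  assumes \<pi>: "\<pi> \<in> policies M" and h: "h \<in> {1..H}" and \<phi>: "\<phi> \<in> borel_measurable Z" "\<And>z. \<phi> z \<in> {0..1 :: real}"
  shows "(\<integral>s. \<phi> (obs_act_of s) \<partial>data_law M True \<pi> h) =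
    (\<integral>x. (\<integral>a. \<phi> (x, a) \<partial>uniform_count_measure UNIV) \<partial>obs_law M \<pi> h)"
proof -
  let ?u = "uniform_count_measure (UNIV :: 'a set)"
  have u: "(\<lambda>_. ?u) \<in> S \<rightarrow>\<^sub>M prob_algebra AS" using uniform_in_space by simp
  have m: "(\<lambda>s. ennreal (\<phi> (obs_act_of s))) \<in> borel_measurable T"
    by (rule measurable_compose[OF measurable_compose[OF obs_act_of_measurable \<phi>(1)] measurable_ennreal])
  have int_u: "(\<integral>a. \<phi> (x, a) \<partial>?u) = (\<Sum>a\<in>UNIV. \<phi> (x, a)) / real CARD('a)" for x
    by (subst integral_uniform_count_measure) auto
  have mu: "(\<lambda>x. \<integral>a. \<phi> (x, a) \<partial>?u) \<in> borel_measurable S"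
    unfolding int_u
    by (intro borel_measurable_divide borel_measurable_sum borel_measurable_const
        measurable_compose[OF measurable_Pair2' \<phi>(1)]) simp
  interpret u: prob_space ?u using uniform_in_space by (simp add: space_prob_algebra)
  have "(\<integral>\<^sup>+s. ennreal (\<phi> (obs_act_of s)) \<partial>data_law M True \<pi> h) =
    (\<integral>\<^sup>+x. (\<integral>\<^sup>+a. (\<integral>\<^sup>+w. ennreal (\<phi> (obs_act_of (x, a, w))) \<partial>outcome_law M h (x, a)) \<partial>?u) \<partial>obs_law M \<pi> h)"
    using nn_integral_mix[OF obs_law_in_space[OF \<pi> h] h u m] by (simp add: data_law_def)
  also have "\<dots> = (\<integral>\<^sup>+x. (\<integral>\<^sup>+a. ennreal (\<phi> (x, a)) \<partial>?u) \<partial>obs_law M \<pi> h)"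
    by (simp add: obs_act_of_def obs_of_def act_of_def split_beta' prob_space.emeasure_space_1[OF prob_space_outcome_law[OF h]])
  also have "\<dots> = (\<integral>\<^sup>+x. ennreal (\<integral>a. \<phi> (x, a) \<partial>?u) \<partial>obs_law M \<pi> h)"
  proof (intro nn_integral_cong nn_integral_eq_integral)
    fix x
    show "integrable ?u (\<lambda>a. \<phi> (x, a))"
      using \<phi>(2) by (intro u.integrable_const_bound[of _ 1]) (auto simp: measurable_def sets_uniform_count_measure space_uniform_count_measure)
    show "AE a in ?u. 0 \<le> \<phi> (x, a)" using \<phi>(2) by auto
  qed
  finally have eq: "(\<integral>\<^sup>+s. ennreal (\<phi> (obs_act_of s)) \<partial>data_law M True \<pi> h) = (\<integral>\<^sup>+x. ennreal (\<integral>a. \<phi> (x, a) \<partial>?u) \<partial>obs_law M \<pi> h)" .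
  have s: "sets (data_law M True \<pi> h) = sets T" "sets (obs_law M \<pi> h) = sets S"
    using data_law_in_space[OF \<pi> h, of True] obs_law_in_space[OF \<pi> h] by (auto simp: space_prob_algebra)
  have "(\<integral>s. \<phi> (obs_act_of s) \<partial>data_law M True \<pi> h) = enn2real (\<integral>\<^sup>+s. ennreal (\<phi> (obs_act_of s)) \<partial>data_law M True \<pi> h)"
    using measurable_compose[OF obs_act_of_measurable \<phi>(1)] measurable_cong_sets[OF s(1) refl] \<phi>(2)
    by (intro integral_eq_nn_integral) auto
  moreover have "(\<integral>x. (\<integral>a. \<phi> (x, a) \<partial>?u) \<partial>obs_law M \<pi> h) = enn2real (\<integral>\<^sup>+x. ennreal (\<integral>a. \<phi> (x, a) \<partial>?u) \<partial>obs_law M \<pi> h)"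
  proof (intro integral_eq_nn_integral AE_I2 integral_nonneg_AE)
    show "(\<lambda>x. \<integral>a. \<phi> (x, a) \<partial>?u) \<in> borel_measurable (obs_law M \<pi> h)"
      using mu measurable_cong_sets[OF s(2) refl] by blast
  qed (use \<phi>(2) in auto)
  ultimately show ?thesis by (simp only: eq)
qed

text \<open>The value at the action taken is at most the sum over all actions, since the function is
  nonnegative; that sum is the number of actions times the uniform mean. This is the source of the
  factor A.\<close>

lemma integral_trans_law_le_uniform:
  assumes \<pi>: "\<pi> \<in> policies M" and h: "h \<in> {1..H}" and \<phi>: "\<phi> \<in> borel_measurable Z" "\<And>z. \<phi> z \<in> {0..1 :: real}"
  shows "(\<integral>s. \<phi> (obs_act_of s) \<partial>trans_law M \<pi> h) \<le>
    real CARD('a) * (\<integral>x. (\<integral>a. \<phi> (x, a) \<partial>uniform_count_measure UNIV) \<partial>obs_law M \<pi> h)"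
proof -
  have int_u: "(\<integral>a. \<phi> (x, a) \<partial>uniform_count_measure UNIV) = (\<Sum>a\<in>UNIV. \<phi> (x, a)) / real CARD('a)" for x
    by (subst integral_uniform_count_measure) auto
  have slice: "(\<lambda>x. \<phi> (x, a)) \<in> borel_measurable S" for a
    by (rule measurable_compose[OF measurable_Pair2' \<phi>(1)]) simp
  have ms: "(\<lambda>x. \<Sum>a\<in>UNIV. \<phi> (x, a)) \<in> borel_measurable S"
    by (intro borel_measurable_sum slice)
  have "(\<integral>s. \<phi> (obs_act_of s) \<partial>trans_law M \<pi> h) \<le> (\<integral>s. (\<Sum>a\<in>UNIV. \<phi> (obs_of s, a)) \<partial>trans_law M \<pi> h)"
  proof (rule integral_mono)
    show "integrable (trans_law M \<pi> h) (\<lambda>s. \<phi> (obs_act_of s))"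
      using \<phi>(2) by (intro integrable_trans_law \<pi> h measurable_compose[OF obs_act_of_measurable \<phi>(1)]) auto
    show "integrable (trans_law M \<pi> h) (\<lambda>s. \<Sum>a\<in>UNIV. \<phi> (obs_of s, a))"
      using \<phi>(2) by (intro Bochner_Integration.integrable_sum integrable_trans_law \<pi> h measurable_compose[OF obs_of_measurable slice]) auto
    show "\<phi> (obs_act_of s) \<le> (\<Sum>a\<in>UNIV. \<phi> (obs_of s, a))" for s
      unfolding obs_act_of_def using \<phi>(2) by (intro member_le_sum[of "act_of s" UNIV "\<lambda>a. \<phi> (obs_of s, a)"]) auto
  qed
  also have "\<dots> = (\<integral>x. (\<Sum>a\<in>UNIV. \<phi> (x, a)) \<partial>obs_law M \<pi> h)"
    by (rule integral_obs_law[OF \<pi> h ms, symmetric])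
  also have "\<dots> = real CARD('a) * (\<integral>x. (\<integral>a. \<phi> (x, a) \<partial>uniform_count_measure UNIV) \<partial>obs_law M \<pi> h)"
    unfolding int_u by simp
  finally show ?thesis .
qed

end

section \<open>Summing the Bellman errors\<close>

text \<open>
  Optimises the free scale \<open>m\<close> of the per-round bounds, which trades the first term (leading to the
  square root) against the second.
\<close>

lemma scale_tradeoff:
  fixes R H K v X L db :: real
  assumes H: "1 \<le> H" and K: "0 \<le> K" and v: "0 \<le> v" and X: "0 < X" "X = 3 * L * db" and L: "1 \<le> L" and db: "0 \<le> db"
    and R: "\<And>m. H \<le> m \<Longrightarrow> R \<le> 3 * H * (K * v) / m + 16 * m * (H * X)"
  shows "R \<le> 1000 * L * (H * sqrt (v * K * db) + H\<^sup>2 * db)"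
proof -
  \<comment> \<open>At m = r the terms K v / m and m X are equal. The maximum with H is forced, as
    the hypothesis covers only scales from H on.\<close>
  define r where "r = sqrt (K * v / X)"
  define m where "m = max H r"
  have r0: "0 \<le> r" using K v X by (simp add: r_def)
  have m: "H \<le> m" "r \<le> m" "m \<le> H + r" "1 \<le> m" using H r0 by (auto simp: m_def)
  have rX: "r * X = sqrt (K * v * X)"
  proof -
    have "r * X = sqrt (K * v / X) * sqrt (X\<^sup>2)" using X(1) by (simp add: r_def)
    also have "\<dots> = sqrt (K * v / X * X\<^sup>2)" by (rule real_sqrt_mult[symmetric])
    also have "K * v / X * X\<^sup>2 = K * v * X" using X(1) by (simp add: power2_eq_square)
    finally show ?thesis .
  qed
  have Kv: "K * v = r * (r * X)"
  proof -
    have "r * r = K * v / X" using K v X(1) by (simp add: r_def)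
    then show ?thesis using X(1) by (simp add: field_simps)
  qed
  have "K * v / m \<le> r * X"
  proof -
    have "r * (r * X) \<le> m * (r * X)" using m r0 X by (intro mult_right_mono) auto
    then show ?thesis using m Kv by (simp add: field_simps)
  qed
  then have "3 * H * (K * v) / m \<le> 3 * H * (r * X)"
    using H mult_left_mono[of "K * v / m" "r * X" "3 * H"] by simp
  moreover have "16 * m * (H * X) \<le> 16 * (H + r) * (H * X)"
    using m H X by (intro mult_right_mono mult_left_mono) auto
  ultimately have "R \<le> 19 * H * (r * X) + 16 * (H\<^sup>2 * X)"
    using R[OF m(1)] by (simp add: algebra_simps power2_eq_square)
  also have "r * X = sqrt (3 * L) * sqrt (v * K * db)"
  proof -
    have "K * v * X = 3 * L * (v * K * db)" by (simp add: X(2))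
    then show ?thesis by (simp only: rX real_sqrt_mult)
  qed
  also have "19 * H * (sqrt (3 * L) * sqrt (v * K * db)) \<le> 19 * H * (3 * L * sqrt (v * K * db))"
  proof (intro mult_left_mono mult_right_mono)
    show "sqrt (3 * L) \<le> 3 * L" using L by (intro real_le_lsqrt) (auto simp: power2_eq_square intro!: mult_mono)
  qed (use H K v db in auto)
  also have "16 * (H\<^sup>2 * X) = 48 * L * (H\<^sup>2 * db)" by (simp add: X(2))
  \<comment> \<open>The computation yields 57 and 48; 1000 is a generous common bound.\<close>
  also have "19 * H * (3 * L * sqrt (v * K * db)) + 48 * L * (H\<^sup>2 * db) \<le>
      1000 * L * (H * sqrt (v * K * db)) + 1000 * L * (H\<^sup>2 * db)"
  proof (intro add_mono)
    have "57 * (L * (H * sqrt (v * K * db))) \<le> 1000 * (L * (H * sqrt (v * K * db)))"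
      using H L K v db by (intro mult_right_mono) auto
    then show "19 * H * (3 * L * sqrt (v * K * db)) \<le> 1000 * L * (H * sqrt (v * K * db))"
      by (simp add: algebra_simps)
    show "48 * L * (H\<^sup>2 * db) \<le> 1000 * L * (H\<^sup>2 * db)"
      using L db by (intro mult_right_mono) auto
  qed
  finally show ?thesis by (simp add: algebra_simps)
qed

context value_class begin

lemma finite_psi_bce: "finite (psi_bce M F h)"
proof -
  have "psi_bce M F h = (\<lambda>f z. hellinger_ber (f h z) (bellman M h (f (Suc h)) z)) ` F"
    by (auto simp: psi_bce_def)
  then show ?thesis using finite_F by simp
qed

lemma finite_psi_bce_V: "finite (psi_bce_V M F h)"
proof -
  have "psi_bce_V M F h = (\<lambda>\<psi> x. \<integral>a. \<psi> (x, a) \<partial>uniform_count_measure UNIV) ` psi_bce M F h"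
    by (auto simp: psi_bce_V_def)
  then show ?thesis using finite_psi_bce by simp
qed

lemma hell_in_psi_bce: "f \<in> F \<Longrightarrow> hell h f f \<in> psi_bce M F h"
  unfolding psi_bce_def backup_def by blast

lemma eluder_dim_le_d_bce:
  assumes "h \<in> {1..H}"
  shows "eluder_dim 1 (psi_bce M F h) {obs_act_law M \<pi> h | \<pi>. \<pi> \<in> policies M} (1 / real K) \<le> d_bce M F K"
    and "eluder_dim 1 (psi_bce_V M F h) {obs_law M \<pi> h | \<pi>. \<pi> \<in> policies M} (1 / real K) \<le> d_bce_V M F K"
  unfolding d_bce_def d_bce_V_def using assms by (auto intro!: Max_ge)

end

context optimistic_run begin

section \<open>Cumulative errors and regret on the good event\<close>

definition sel :: "nat \<Rightarrow> ('x, 'a) history \<Rightarrow> ('x, 'a) ftuple" where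
  "sel k D = fsel k (restrict D {1..<k})"

text \<open>The error under the played policy, which governs the regret, in contrast to
  \<open>err\<close>, which is taken under the data law.\<close>

definition roll_err :: "nat \<Rightarrow> nat \<Rightarrow> ('x, 'a) history \<Rightarrow> real" where
  "roll_err h k D = (\<integral>s. hell h (sel k D) (sel k D) (obs_act_of s) \<partial>trans_law M (pol_at k D) h)"

context
  fixes D assumes good: "good D"
begin

lemma D_in_space: "D \<in> space (history_space M (Suc K))"
  using good by (simp add: good_def)

lemma pol_at_policies: "k \<in> {1..K} \<Longrightarrow> pol_at k D \<in> policies M"
  by (rule pol_at_in_policies[OF _ _ D_in_space]) auto

context
  fixes k assumes k: "k \<in> {1..K}"
begin

text \<open>As \<open>Q\<close> is in the confidence set, this set is nonempty and the selection
  rule is in force; minimality then puts the selected initial value below that of \<open>Q\<close>,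
  hence below the optimal value.\<close>

lemma sel_in_F: "sel k D \<in> F"
  and sel_in_confidence_set: "sel k D \<in> confidence_set M F bce_loss \<beta> k (restrict D {1..<k})"
  and sel_optimistic: "(MIN a. sel k D 1 (init_obs M, a)) \<le> opt_value M"
  and sel_greedy: "h \<in> {1..H} \<Longrightarrow> (MIN b. sel k D h (x, b)) = sel k D h (x, act k (restrict D {1..<k}) h x)"
proof -
  let ?D = "restrict D {1..<k}"
  have sp: "?D \<in> space (history_space M k)" using restrict_in_history[OF D_in_space] k by simp
  have ch: "fsel k \<in> history_space M k \<rightarrow>\<^sub>M count_space F"
    "is_arg_min (\<lambda>f. MIN a. f 1 (init_obs M, a)) (\<lambda>f. f \<in> confidence_set M F bce_loss \<beta> k ?D) (sel k D)"
    "\<And>h x. h \<in> {1..H} \<Longrightarrow> is_arg_min (\<lambda>a. sel k D h (x, a)) (\<lambda>_. True) (act k ?D h x)"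
    using choices k sp optimal_q_in_confidence_set[OF good k] unfolding optimistic_choices_def sel_def by blast+
  show "sel k D \<in> F" using measurable_space[OF ch(1) sp] by (simp add: sel_def)
  show "sel k D \<in> confidence_set M F bce_loss \<beta> k ?D" using ch(2) by (simp add: is_arg_min_def)
  have "(MIN a. sel k D 1 (init_obs M, a)) \<le> (MIN a. Q 1 (init_obs M, a))"
    using ch(2) optimal_q_in_confidence_set[OF good k] unfolding is_arg_min_def not_ex by (meson not_le)
  then show "(MIN a. sel k D 1 (init_obs M, a)) \<le> opt_value M"
    using optimal_q_le_opt_value by (rule order_trans)
  show "(MIN b. sel k D h (x, b)) = sel k D h (x, act k ?D h x)" if "h \<in> {1..H}"
    using ch(3)[OF that, of x] by (intro Min_eqI) (auto simp: is_arg_min_def not_less)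
qed

lemma round_regret_le:
  assumes m: "real H \<le> m"
  shows "policy_value M (pol_at k D) - opt_value M
    \<le> 3 * real H * opt_value M / m + 16 * m * (\<Sum>h=1..H. roll_err h k D)"
proof -

  have *: "policy_value M (pol_at k D) - (MIN a. sel k D 1 (init_obs M, a))
    \<le> 3 * real H * opt_value M / m + 16 * m * (\<Sum>h=1..H. roll_err h k D)"
    unfolding roll_err_def
    by (rule greedy_policy_value_le[OF pol_at_policies[OF k] sel_in_F _ sel_greedy sel_optimistic opt_value_nonneg m])
      (simp_all add: pol_at_def played_policy_def)
  then show ?thesis using sel_optimistic by linarith
qed

end

lemma sum_roll_err_le:
  assumes h: "h \<in> {1..H}"
    and d: "d = (if ua then real CARD('a) * max 1 (real (d_bce_V M F K)) else max 1 (real (d_bce M F K)))"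
  shows "(\<Sum>k=1..K. roll_err h k D) \<le> 3 * (1 + ln K) * (d * \<beta>)"
\<comment> \<open>With one function, \<beta> may be arbitrarily small, so that additive constants
  cannot be absorbed into d\<beta>; but then only \<open>Q\<close> is selected and all errors
  vanish. Two functions already give \<beta> \<ge> 2 ln 2.\<close>
proof (cases "N = 1")
  case True
  then have "F = {Q}" using optimal_q_in_F by (metis card_1_singletonE singletonD)
  then have "sel k D = Q" if "k \<in> {1..K}" for k using sel_in_F[OF that] by simp
  then have "roll_err h k D = 0" if "k \<in> {1..K}" for k
    using that by (simp add: roll_err_def backup_optimal_q[OF h])
  moreover have "0 \<le> d" by (simp add: d le_max_iff_disj)
  ultimately show ?thesis using ln_w(3) K_ge_1 by simp
next
  case False
  then have N2: "2 \<le> N" using N_ge_1 by simp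
  have \<beta>2: "2 * ln 2 \<le> \<beta>"
  proof -
    have "2 * \<delta> \<le> 1 * 2" using \<delta> by simp
    also have "\<dots> \<le> real H * real N" using N2 H_ge_1 by (intro mult_mono) auto
    finally have "2 \<le> real H * real N / \<delta>" using \<delta> by (simp add: field_simps)
    then show ?thesis unfolding \<beta>_eq by simp
  qed
  have F: "sel k D \<in> F" if "k \<in> {1..K}" for k using that by (rule sel_in_F)
  have mz: "hell h (sel k D) (sel k D) \<in> borel_measurable Z" if "k \<in> {1..K}" for k
    using F[OF that] h by (intro hell_measurable)
  have err: "(\<Sum>i\<in>{1..<k}. err h (sel k D) (sel k D) i D) \<le> 3 / 2 * \<beta>" if "k \<in> {1..K}" for k
    by (rule confidence_set_err_le[OF good that sel_in_confidence_set[OF that] h])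
  show ?thesis
  proof (cases ua)
    case False
    let ?\<psi> = "\<lambda>k. hell h (sel k D) (sel k D)" and ?\<mu> = "\<lambda>k. obs_act_law M (pol_at k D) h"
    have roll: "\<bar>\<integral>z. ?\<psi> k z \<partial>?\<mu> i\<bar> = (\<integral>s. ?\<psi> k (obs_act_of s) \<partial>trans_law M (pol_at i D) h)"
      if "i \<in> {1..K}" "k \<in> {1..K}" for i k
      unfolding integral_obs_act_law[OF pol_at_policies[OF that(1)] h mz[OF that(2)]]
      using hell_01[OF F[OF that(2)] F[OF that(2)] h] by (intro abs_of_nonneg integral_nonneg_AE) auto
    have "(\<Sum>k=1..K. \<bar>\<integral>z. ?\<psi> k z \<partial>?\<mu> k\<bar>) \<le> 3 * (1 + ln K) * (d * \<beta>)"
    proof (rule eluder_sum_le[OF finite_psi_bce K_ge_1 \<beta>2])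
      show "1 \<le> d" by (simp add: d False)
      have "real (eluder_dim 1 (psi_bce M F h) {obs_act_law M \<pi> h | \<pi>. \<pi> \<in> policies M} (1 / real K)) \<le> real (d_bce M F K)"
        using eluder_dim_le_d_bce(1)[OF h] by simp
      then show "real (eluder_dim 1 (psi_bce M F h) {obs_act_law M \<pi> h | \<pi>. \<pi> \<in> policies M} (1 / real K)) \<le> d"
        by (simp add: d False)
      fix k assume k: "k \<in> {1..K}"
      show "?\<mu> k \<in> {obs_act_law M \<pi> h | \<pi>. \<pi> \<in> policies M}" using pol_at_policies[OF k] by blast
      show "?\<psi> k \<in> psi_bce M F h" by (rule hell_in_psi_bce[OF F[OF k]])
      have "(\<Sum>i\<in>{1..<k}. \<bar>\<integral>z. ?\<psi> k z \<partial>?\<mu> i\<bar>) = (\<Sum>i\<in>{1..<k}. err h (sel k D) (sel k D) i D)"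
      proof (rule sum.cong[OF refl])
        fix i assume "i \<in> {1..<k}"
        then have i: "i \<in> {1..K}" using k by auto
        show "\<bar>\<integral>z. ?\<psi> k z \<partial>?\<mu> i\<bar> = err h (sel k D) (sel k D) i D"
          unfolding roll[OF i k] err_def data_law_def trans_law_eq_bind[OF pol_at_policies[OF i] h] using False by simp
      qed
      then show "(\<Sum>i\<in>{1..<k}. \<bar>\<integral>z. ?\<psi> k z \<partial>?\<mu> i\<bar>) \<le> 3 / 2 * \<beta>" using err[OF k] by simp
      interpret prob_space "trans_law M (pol_at k D) h" by (rule prob_space_trans_law[OF pol_at_policies[OF k] h])
      show "\<bar>\<integral>z. ?\<psi> k z \<partial>?\<mu> k\<bar> \<le> 1"
        unfolding roll[OF k k] using hell_01[OF F[OF k] F[OF k] h]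
        by (intro integral_le_const integrable_trans_law[OF pol_at_policies[OF k] h] hell_obs_act_of_measurable F[OF k] h) auto
    qed
    moreover have "(\<Sum>k=1..K. roll_err h k D) = (\<Sum>k=1..K. \<bar>\<integral>z. ?\<psi> k z \<partial>?\<mu> k\<bar>)"
      by (intro sum.cong refl) (simp only: roll roll_err_def)
    ultimately show ?thesis by simp
  next
    case True
    let ?\<psi> = "\<lambda>k x. \<integral>a. hell h (sel k D) (sel k D) (x, a) \<partial>uniform_count_measure UNIV"
    let ?\<mu> = "\<lambda>k. obs_law M (pol_at k D) h"
    \<comment> \<open>The number of actions stays out of the eluder argument, which bounds errors
      under uniform actions; passing to the played actions costs this factor once, at the
      end.\<close>
    let ?d = "max 1 (real (d_bce_V M F K))"
    have uni: "(\<integral>x. ?\<psi> k x \<partial>?\<mu> i) = err h (sel k D) (sel k D) i D" if "i \<in> {1..K}" "k \<in> {1..K}" for i k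
      using integral_data_law_uniform[OF pol_at_policies[OF that(1)] h mz[OF that(2)] hell_01[OF F[OF that(2)] F[OF that(2)] h]]
      unfolding err_def using True by simp
    have abs: "\<bar>\<integral>x. ?\<psi> k x \<partial>?\<mu> i\<bar> = err h (sel k D) (sel k D) i D" if "i \<in> {1..K}" "k \<in> {1..K}" for i k
      unfolding uni[OF that] using err_nonneg[OF good F[OF that(2)] F[OF that(2)] h] by (rule abs_of_nonneg)
    have "(\<Sum>k=1..K. \<bar>\<integral>x. ?\<psi> k x \<partial>?\<mu> k\<bar>) \<le> 3 * (1 + ln K) * (?d * \<beta>)"
    proof (rule eluder_sum_le[OF finite_psi_bce_V K_ge_1 \<beta>2])
      show "1 \<le> ?d" by simp
      have "real (eluder_dim 1 (psi_bce_V M F h) {obs_law M \<pi> h | \<pi>. \<pi> \<in> policies M} (1 / real K)) \<le> real (d_bce_V M F K)"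
        using eluder_dim_le_d_bce(2)[OF h] by simp
      then show "real (eluder_dim 1 (psi_bce_V M F h) {obs_law M \<pi> h | \<pi>. \<pi> \<in> policies M} (1 / real K)) \<le> ?d"
        by simp
      fix k assume k: "k \<in> {1..K}"
      show "?\<mu> k \<in> {obs_law M \<pi> h | \<pi>. \<pi> \<in> policies M}" using pol_at_policies[OF k] by blast
      show "?\<psi> k \<in> psi_bce_V M F h"
        unfolding psi_bce_V_def
        by (intro CollectI exI[of _ "hell h (sel k D) (sel k D)"] conjI refl hell_in_psi_bce F k)
      have "(\<Sum>i\<in>{1..<k}. \<bar>\<integral>x. ?\<psi> k x \<partial>?\<mu> i\<bar>) = (\<Sum>i\<in>{1..<k}. err h (sel k D) (sel k D) i D)"
        using k by (intro sum.cong refl abs) auto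
      then show "(\<Sum>i\<in>{1..<k}. \<bar>\<integral>x. ?\<psi> k x \<partial>?\<mu> i\<bar>) \<le> 3 / 2 * \<beta>" using err[OF k] by simp
      have "prob_space (data_law M ua (pol_at k D) h)"
        using data_law_in_space[OF pol_at_policies[OF k] h] by (simp add: space_prob_algebra)
      then interpret prob_space "data_law M ua (pol_at k D) h" .
      show "\<bar>\<integral>x. ?\<psi> k x \<partial>?\<mu> k\<bar> \<le> 1"
        unfolding abs[OF k k] err_def using hell_01[OF F[OF k] F[OF k] h]
        by (intro integral_le_const integrable_bounded_data_law[OF pol_at_policies[OF k] h] hell_obs_act_of_measurable F[OF k] h) auto
    qed
    then have sum: "(\<Sum>k=1..K. err h (sel k D) (sel k D) k D) \<le> 3 * (1 + ln K) * (?d * \<beta>)"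
      by (simp only: abs cong: sum.cong)
    have "(\<Sum>k=1..K. roll_err h k D) \<le> (\<Sum>k=1..K. real CARD('a) * err h (sel k D) (sel k D) k D)"
    proof (rule sum_mono)
      fix k assume k: "k \<in> {1..K}"
      show "roll_err h k D \<le> real CARD('a) * err h (sel k D) (sel k D) k D"
        unfolding uni[OF k k, symmetric] roll_err_def
        by (rule integral_trans_law_le_uniform[OF pol_at_policies[OF k] h mz[OF k] hell_01[OF F[OF k] F[OF k] h]])
    qed
    also have "\<dots> \<le> real CARD('a) * (3 * (1 + ln K) * (?d * \<beta>))"
      unfolding sum_distrib_left[symmetric] by (rule mult_left_mono[OF sum]) simp
    finally show ?thesis using True by (simp add: d mult_ac)
  qed
qed

text \<open>The round bounds hold for every m \<ge> H, so one scale, common to all rounds, can be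
  chosen after the errors have been summed over rounds for each step.\<close>

lemma good_regret_le:
  assumes d: "d = (if ua then real CARD('a) * max 1 (real (d_bce_V M F K)) else max 1 (real (d_bce M F K)))"
  shows "regret M act K D \<le> 1000 * (1 + ln (real K)) *
    (real H * sqrt (opt_value M * real K * (d * \<beta>)) + (real H)\<^sup>2 * d * \<beta>)"
proof -
  let ?L = "1 + ln (real K)" and ?X = "3 * (1 + ln (real K)) * (d * \<beta>)"
  have d1: "1 \<le> d"
  proof (cases ua)
    case True
    have "1 * 1 \<le> real CARD('a) * max 1 (real (d_bce_V M F K))" by (intro mult_mono) auto
    then show ?thesis using True by (simp add: d)
  qed (simp add: d)
  have L: "1 \<le> ?L" using K_ge_1 by simp
  have "regret M act K D \<le> 1000 * ?L * (real H * sqrt (opt_value M * real K * (d * \<beta>)) + (real H)\<^sup>2 * (d * \<beta>))"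
  proof (rule scale_tradeoff[where X = ?X])
    show "0 < ?X" using L d1 ln_w(3) by (intro mult_pos_pos) auto
    fix m assume m: "real H \<le> m"
    have "regret M act K D \<le> (\<Sum>k=1..K. 3 * real H * opt_value M / m + 16 * m * (\<Sum>h=1..H. roll_err h k D))"
      unfolding regret_def pol_at_def[symmetric] by (intro sum_mono round_regret_le m)
    also have "\<dots> = 3 * real H * (real K * opt_value M) / m + 16 * m * (\<Sum>h=1..H. \<Sum>k=1..K. roll_err h k D)"
      unfolding sum.distrib sum_distrib_left[symmetric] sum.swap[of "\<lambda>k h. roll_err h k D" "{1..H}" "{1..K}"] by simp
    also have "\<dots> \<le> 3 * real H * (real K * opt_value M) / m + 16 * m * (\<Sum>h=1..H. ?X)"
      using m H_ge_1 by (intro add_left_mono mult_left_mono sum_mono sum_roll_err_le d) auto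
    finally show "regret M act K D \<le> 3 * real H * (real K * opt_value M) / m + 16 * m * (real H * ?X)"
      by simp
  qed (use H_ge_1 opt_value_nonneg L d1 ln_w(3) in auto)
  then show ?thesis by (simp add: mult.assoc)
qed

end

end

theorem theorem8:
  fixes M :: "('x, 'a::finite) mdp"
    and F :: "('x, 'a) ftuple set"
    and K :: nat
    and \<delta> \<beta> d :: real
    and ua :: bool
    and fsel :: "nat \<Rightarrow> ('x, 'a) history \<Rightarrow> ('x, 'a) ftuple"
    and act :: "nat \<Rightarrow> ('x, 'a) history \<Rightarrow> nat \<Rightarrow> 'x \<Rightarrow> 'a"
  assumes "is_mdp M"
    and "total_cost_normalized M"
    and "function_class M F"
    and "targets_normalized M F"
    and "bellman_complete M F"
    and "realizable M F"
    and "1 \<le> K"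
    and "0 < \<delta>" "\<delta> < 1"
    and "\<beta> = 2 * ln (real (horizon M) * real (card F) / \<delta>)"
    and "optimistic_choices M F bce_loss \<beta> K fsel act"
    and "d = (if ua then real CARD('a) * max 1 (real (d_bce_V M F K))
              else max 1 (real (d_bce M F K)))"
  shows "measure (run_law M ua act K)
           {D \<in> space (run_law M ua act K).
              regret M act K D \<le> 1000 * (1 + ln (real K)) *
                (real (horizon M) * sqrt (opt_value M * real K * (d * \<beta>))
                 + (real (horizon M))\<^sup>2 * d * \<beta>)}
         \<ge> 1 - \<delta>"
proof -
  interpret optimistic_run M F act K ua fsel \<beta> \<delta>
    using assms by unfold_locales (auto simp: optimistic_choices_def)
  show ?thesis
  proof (rule measure_ge_if_good)
    \<comment> \<open>The regret event must be measurable for its probability to follow from that of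
      its complement.\<close>
    have "{D \<in> space (history_space M (Suc K)). regret M act K D \<le> c} \<in> sets (history_space M (Suc K))" for c
      by (rule borel_measurable_le[OF regret_measurable borel_measurable_const])
    then show "{D \<in> space (run_law M ua act K). regret M act K D \<le> 1000 * (1 + ln (real K)) *
        (real (horizon M) * sqrt (opt_value M * real K * (d * \<beta>)) + (real (horizon M))\<^sup>2 * d * \<beta>)}
      \<in> sets (run_law M ua act K)"
      unfolding space_run_law[OF order_refl] sets_run_law[OF order_refl] .
    fix D assume "good D"
    then show "D \<in> {D \<in> space (run_law M ua act K). regret M act K D \<le> 1000 * (1 + ln (real K)) *
        (real (horizon M) * sqrt (opt_value M * real K * (d * \<beta>)) + (real (horizon M))\<^sup>2 * d * \<beta>)}"
      using good_regret_le[OF _ assms(12)] by (simp add: good_def space_run_law[OF order_refl])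
  qed
qed

end
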